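(* Let $d\ge5$. (i) Let a planar $d$-web be defined by web functions $f_1,\dots,f_d$ in coordinates $(x,y)=(x_1,x_2)$. Write $f_{i,1}=\partial f_i/\partial x$, $f_{i,2}=\partial f_i/\partial y$, $J(f_i,f_j)=f_{i,1}f_{j,2}-f_{i,2}f_{j,1}$, and $\operatorname{Flex} f=f_y^2f_{xx}-2f_xf_yf_{xy}+f_x^2f_{yy}$. Define functions $\Pi^1_{22},\Pi^2_{11},\Pi^1_{12},\Pi^2_{12}$ by $$\Pi_{22}^1=\sum_{i=1}^4\frac{\prod_{k\ne i}f_{k,2}}{\prod_{k\neq i}J(f_i,f_k)}\operatorname{Flex} f_i,\qquad \Pi_{11}^2=-\sum_{i=1}^4\frac{\prod_{k\ne i}f_{k,1}}{\prod_{k\neq i}J(f_i,f_k)}\operatorname{Flex} f_i,$$ $$-3\Pi_{12}^1=-\sum_{i=1}^4\frac{\sum_{k\ne i}f_{k,1}\prod_{l\ne i,k}f_{l,2}}{\prod_{m\neq i}J(f_i,f_m)}\operatorname{Flex} f_i,\qquad -3\Pi_{12}^2=\sum_{i=1}^4\frac{\sum_{k\ne i}f_{k,2}\prod_{l\ne i,k}f_{l,1}}{\prod_{m\neq i}J(f_i,f_m)}\operatorname{Flex} f_i,$$ where all indices $k,l,m$ range over $\{1,2,3,4\}$. Then the $d$-web is geodesic if and only if each of the functions $f=f_5,\dots,f_d$ satisfies $$\Pi_{22}^1f_x^3-3\Pi_{12}^1f_x^2f_y-3\Pi_{12}^2f_xf_y^2+\Pi_{11}^2f_y^3=\operatorname{Flex}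 f .$$ (ii) Let a planar $d$-web be defined by web functions $x,y,f_3,\dots,f_d$. Then it is locally equivalent to a geodesic $d$-web with respect to a symmetric projective structure if and only if the $d-4$ conditions in (i) (with $f_1=x$, $f_2=y$) are satisfied and, in addition, $$\alpha_{xx}+2\beta_{xy}=\beta\alpha_x+2\beta\beta_y,\qquad 2\alpha_{xy}+\beta_{yy}=2\alpha\alpha_x+\alpha\beta_y,$$ where, with $\Delta=f_{3,x}f_{4,y}-f_{3,y}f_{4,x}$, $$\alpha =\frac{f_{4,y}\operatorname{Flex} f_3}{f_{3,x}f_{3,y}\Delta}-\frac{f_{3,y}\operatorname{Flex} f_4}{f_{4,x}f_{4,y}\Delta},\qquad \beta=-\frac{f_{4,x}\operatorname{Flex} f_3}{f_{3,x}f_{3,y}\Delta}+\frac{f_{3,x}\operatorname{Flex} f_4}{f_{4,x}f_{4,y}\Delta}.$$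
   Context: All objects are smooth and considerations are local (in a neighbourhood of each point of the domain). A planar $d$-web is given by $d$ foliations, pairwise transversal at every point, which are the level sets of web functions $f_1,\dots,f_d$ with $df_i\wedge df_j\neq0$ for $i\ne j$. Affine connections are torsion-free. Two affine connections $\nabla,\widetilde\nabla$ are projectively equivalent if $\nabla_X(Y)-\widetilde\nabla_X(Y)=\rho(X)Y+\rho(Y)X$ for some $1$-form $\rho$ and all vector fields $X,Y$; a projective structure is a class of projectively equivalent affine connections, and its geodesics are the unparametrized geodesics of any connection in the class. A planar $d$-web is called geodesic if there is a torsion-free affine connection (equivalently, a projective structure) for which the leaves of all its $d$ foliations are geodesics; it is geodesic with respect to a given projective structure if all leaves are geodesics of that structure. An affine connection is symmetric if it is torsion-free and its curvature tensor satisfies $\nabla R=0$; a projective structure is symmetric if its class contains an affine symmetric connection. Two webs are locally equivalent if there is a local diffeomorphism mapping the leaves of one to the leaves of the other. *)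

theory Defs
  imports "HOL-Analysis.Analysis"
begin

section \<open>Smooth maps\<close>

text \<open>
  The sets \<open>S\<close> are always open. A map is \<open>n\<close> times continuously differentiable if it is
  differentiable and all its directional derivatives are \<open>n - 1\<close> times continuously
  differentiable; smooth means \<open>C\<close>-infinity.
\<close>

primrec C_on :: "nat \<Rightarrow> 'a::real_normed_vector set \<Rightarrow> ('a \<Rightarrow> 'b::real_normed_vector) \<Rightarrow> bool" where
  "C_on 0 S f \<longleftrightarrow> continuous_on S f"
| "C_on (Suc n) S f \<longleftrightarrow>
     (\<forall>x\<in>S. f differentiable (at x)) \<and> (\<forall>v. C_on n S (\<lambda>x. frechet_derivative f (at x) v))"

definition smooth_on :: "'a::real_normed_vector set \<Rightarrow> ('a \<Rightarrow> 'b::real_normed_vector) \<Rightarrow> bool" where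
  "smooth_on S f \<longleftrightarrow> (\<forall>n. C_on n S f)"

definition diffeomorphism ::
    "'a::real_normed_vector set \<Rightarrow> 'b::real_normed_vector set \<Rightarrow> ('a \<Rightarrow> 'b) \<Rightarrow> bool" where
  "diffeomorphism S T \<phi> \<longleftrightarrow>
     smooth_on S \<phi> \<and> (\<exists>\<psi>. smooth_on T \<psi> \<and> homeomorphism S T \<phi> \<psi>)"

type_synonym plane = "real ^ 2"

definition pd :: "2 \<Rightarrow> (plane \<Rightarrow> real) \<Rightarrow> plane \<Rightarrow> real" where
  "pd j f p = frechet_derivative f (at p) (axis j 1)"


section \<open>Planar webs\<close>

definition jac :: "(plane \<Rightarrow> real) \<Rightarrow> (plane \<Rightarrow> real) \<Rightarrow> plane \<Rightarrow> real" where
  "jac f g p = pd 1 f p * pd 2 g p - pd 2 f p * pd 1 g p"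

text \<open>
  A web is given by its web functions \<open>f 1, \<dots>, f d\<close> on the open set \<open>U\<close>; the values of
  \<open>f\<close> at other indices and outside \<open>U\<close> are irrelevant.
\<close>

definition planar_web :: "nat \<Rightarrow> plane set \<Rightarrow> (nat \<Rightarrow> plane \<Rightarrow> real) \<Rightarrow> bool" where
  "planar_web d U f \<longleftrightarrow>
     open U \<and> (\<forall>i\<in>{1..d}. smooth_on U (f i)) \<and>
     (\<forall>i\<in>{1..d}. \<forall>j\<in>{1..d}. i \<noteq> j \<longrightarrow> (\<forall>p\<in>U. jac (f i) (f j) p \<noteq> 0))"

definition leaves :: "plane set \<Rightarrow> (plane \<Rightarrow> real) \<Rightarrow> plane set set" where
  "leaves U f = (\<Union>c. components {p\<in>U. f p = c})"

definition web_leaves :: "nat \<Rightarrow> plane set \<Rightarrow> (nat \<Rightarrow> plane \<Rightarrow> real) \<Rightarrow> plane set set" where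
  "web_leaves d U f = (\<Union>i\<in>{1..d}. leaves U (f i))"

definition locally_equivalent_at ::
    "nat \<Rightarrow> plane \<Rightarrow> plane set \<Rightarrow> (nat \<Rightarrow> plane \<Rightarrow> real) \<Rightarrow> plane set \<Rightarrow> (nat \<Rightarrow> plane \<Rightarrow> real) \<Rightarrow> bool" where
  "locally_equivalent_at d p U f U' g \<longleftrightarrow>
     (\<exists>V V' \<phi>. open V \<and> p \<in> V \<and> V \<subseteq> U \<and> open V' \<and> V' \<subseteq> U' \<and> diffeomorphism V V' \<phi> \<and>
        image \<phi> ` web_leaves d V f = web_leaves d V' g)"


section \<open>Affine connections\<close>

text \<open>
  A connection is given by its Christoffel symbols: \<open>\<Gamma> k i j\<close> is the \<open>k\<close>-th component of
  the covariant derivative of the \<open>j\<close>-th coordinate field along the \<open>i\<close>-th one.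
\<close>

type_synonym connection = "2 \<Rightarrow> 2 \<Rightarrow> 2 \<Rightarrow> plane \<Rightarrow> real"
type_synonym vfield = "plane \<Rightarrow> plane"

definition christoffel :: "connection \<Rightarrow> plane \<Rightarrow> plane \<Rightarrow> plane \<Rightarrow> plane" where
  "christoffel \<Gamma> p u v = (\<chi> k. \<Sum>i\<in>UNIV. \<Sum>j\<in>UNIV. \<Gamma> k i j p * u $ i * v $ j)"

definition cov :: "connection \<Rightarrow> vfield \<Rightarrow> vfield \<Rightarrow> vfield" where
  "cov \<Gamma> X Y p = frechet_derivative Y (at p) (X p) + christoffel \<Gamma> p (X p) (Y p)"

definition lie_bracket :: "vfield \<Rightarrow> vfield \<Rightarrow> vfield" where
  "lie_bracket X Y p = frechet_derivative Y (at p) (X p) - frechet_derivative X (at p) (Y p)"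

definition torsion_free_connection :: "plane set \<Rightarrow> connection \<Rightarrow> bool" where
  "torsion_free_connection U \<Gamma> \<longleftrightarrow>
     (\<forall>k i j. smooth_on U (\<Gamma> k i j)) \<and>
     (\<forall>X Y. smooth_on U X \<longrightarrow> smooth_on U Y \<longrightarrow>
        (\<forall>p\<in>U. cov \<Gamma> X Y p - cov \<Gamma> Y X p = lie_bracket X Y p))"

definition curvature :: "connection \<Rightarrow> vfield \<Rightarrow> vfield \<Rightarrow> vfield \<Rightarrow> vfield" where
  "curvature \<Gamma> X Y Z p =
     cov \<Gamma> X (cov \<Gamma> Y Z) p - cov \<Gamma> Y (cov \<Gamma> X Z) p - cov \<Gamma> (lie_bracket X Y) Z p"

definition cov_curvature :: "connection \<Rightarrow> vfield \<Rightarrow> vfield \<Rightarrow> vfield \<Rightarrow> vfield \<Rightarrow> vfield" where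
  "cov_curvature \<Gamma> W X Y Z p =
     cov \<Gamma> W (curvature \<Gamma> X Y Z) p - curvature \<Gamma> (cov \<Gamma> W X) Y Z p
     - curvature \<Gamma> X (cov \<Gamma> W Y) Z p - curvature \<Gamma> X Y (cov \<Gamma> W Z) p"

definition symmetric_connection :: "plane set \<Rightarrow> connection \<Rightarrow> bool" where
  "symmetric_connection U \<Gamma> \<longleftrightarrow>
     torsion_free_connection U \<Gamma> \<and>
     (\<forall>W X Y Z. smooth_on U W \<longrightarrow> smooth_on U X \<longrightarrow> smooth_on U Y \<longrightarrow> smooth_on U Z \<longrightarrow>
        (\<forall>p\<in>U. cov_curvature \<Gamma> W X Y Z p = 0))"


section \<open>Projective structures\<close>

text \<open>The vector \<open>\<rho> p\<close> holds the components of a 1-form, so \<open>\<rho>(X) = \<rho> \<bullet> X\<close>.\<close>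

definition projectively_equivalent :: "plane set \<Rightarrow> connection \<Rightarrow> connection \<Rightarrow> bool" where
  "projectively_equivalent U \<Gamma> \<Gamma>' \<longleftrightarrow>
     (\<exists>\<rho>::plane \<Rightarrow> plane. smooth_on U \<rho> \<and>
        (\<forall>X Y. smooth_on U X \<longrightarrow> smooth_on U Y \<longrightarrow>
           (\<forall>p\<in>U. cov \<Gamma> X Y p - cov \<Gamma>' X Y p = (\<rho> p \<bullet> X p) *\<^sub>R Y p + (\<rho> p \<bullet> Y p) *\<^sub>R X p)))"

definition projective_structure :: "plane set \<Rightarrow> connection set \<Rightarrow> bool" where
  "projective_structure U P \<longleftrightarrow>
     (\<exists>\<Gamma>. torsion_free_connection U \<Gamma> \<and>
        P = {\<Gamma>'. torsion_free_connection U \<Gamma>' \<and> projectively_equivalent U \<Gamma> \<Gamma>'})"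

definition symmetric_projective_structure :: "plane set \<Rightarrow> connection set \<Rightarrow> bool" where
  "symmetric_projective_structure U P \<longleftrightarrow>
     projective_structure U P \<and> (\<exists>\<Gamma>\<in>P. symmetric_connection U \<Gamma>)"


section \<open>Geodesic webs\<close>

definition velocity :: "(real \<Rightarrow> plane) \<Rightarrow> real \<Rightarrow> plane" where
  "velocity \<gamma> t = vector_derivative \<gamma> (at t)"

definition regular_curve :: "real \<Rightarrow> real \<Rightarrow> (real \<Rightarrow> plane) \<Rightarrow> bool" where
  "regular_curve a b \<gamma> \<longleftrightarrow>
     a < b \<and> smooth_on {a<..<b} \<gamma> \<and> (\<forall>t\<in>{a<..<b}. velocity \<gamma> t \<noteq> 0)"

text \<open>
  Unparametrized geodesics: the covariant derivative of the velocity along the curve is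
  proportional to the velocity.
\<close>

definition unparam_geodesic :: "connection \<Rightarrow> real \<Rightarrow> real \<Rightarrow> (real \<Rightarrow> plane) \<Rightarrow> bool" where
  "unparam_geodesic \<Gamma> a b \<gamma> \<longleftrightarrow>
     (\<forall>t\<in>{a<..<b}. \<exists>\<mu>::real.
        velocity (velocity \<gamma>) t + christoffel \<Gamma> (\<gamma> t) (velocity \<gamma> t) (velocity \<gamma> t)
          = \<mu> *\<^sub>R velocity \<gamma> t)"

text \<open>
  A leaf of a web is a one-dimensional submanifold, so it is locally parametrized by regular
  curves near each of its points and the quantification over \<open>\<gamma>\<close> is not vacuous.
\<close>

definition geodesic_leaf :: "connection \<Rightarrow> plane set \<Rightarrow> bool" where
  "geodesic_leaf \<Gamma> L \<longleftrightarrow>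
     (\<forall>a b \<gamma>. regular_curve a b \<gamma> \<longrightarrow> \<gamma> ` {a<..<b} \<subseteq> L \<longrightarrow> unparam_geodesic \<Gamma> a b \<gamma>)"

definition geodesic_web :: "nat \<Rightarrow> plane set \<Rightarrow> (nat \<Rightarrow> plane \<Rightarrow> real) \<Rightarrow> bool" where
  "geodesic_web d U f \<longleftrightarrow>
     planar_web d U f \<and>
     (\<exists>\<Gamma>. torsion_free_connection U \<Gamma> \<and> (\<forall>L\<in>web_leaves d U f. geodesic_leaf \<Gamma> L))"

definition geodesic_web_wrt ::
    "nat \<Rightarrow> plane set \<Rightarrow> (nat \<Rightarrow> plane \<Rightarrow> real) \<Rightarrow> connection set \<Rightarrow> bool" where
  "geodesic_web_wrt d U f P \<longleftrightarrow>
     planar_web d U f \<and> (\<forall>\<Gamma>\<in>P. \<forall>L\<in>web_leaves d U f. geodesic_leaf \<Gamma> L)"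


section \<open>The differential invariants\<close>

definition Flex :: "(plane \<Rightarrow> real) \<Rightarrow> plane \<Rightarrow> real" where
  "Flex f p = (pd 2 f p)\<^sup>2 * pd 1 (pd 1 f) p - 2 * pd 1 f p * pd 2 f p * pd 2 (pd 1 f) p
     + (pd 1 f p)\<^sup>2 * pd 2 (pd 2 f) p"

text \<open>In \<open>Pi_k_ij\<close> the first index is the upper one.\<close>

definition Pi_1_22 :: "(nat \<Rightarrow> plane \<Rightarrow> real) \<Rightarrow> plane \<Rightarrow> real" where
  "Pi_1_22 f p = (\<Sum>i\<in>{1..4}. (\<Prod>k\<in>{1..4}-{i}. pd 2 (f k) p)
     / (\<Prod>k\<in>{1..4}-{i}. jac (f i) (f k) p) * Flex (f i) p)"

definition Pi_2_11 :: "(nat \<Rightarrow> plane \<Rightarrow> real) \<Rightarrow> plane \<Rightarrow> real" where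
  "Pi_2_11 f p = - (\<Sum>i\<in>{1..4}. (\<Prod>k\<in>{1..4}-{i}. pd 1 (f k) p)
     / (\<Prod>k\<in>{1..4}-{i}. jac (f i) (f k) p) * Flex (f i) p)"

definition Pi_1_12 :: "(nat \<Rightarrow> plane \<Rightarrow> real) \<Rightarrow> plane \<Rightarrow> real" where
  "Pi_1_12 f p = 1 / 3 * (\<Sum>i\<in>{1..4}.
     (\<Sum>k\<in>{1..4}-{i}. pd 1 (f k) p * (\<Prod>l\<in>{1..4}-{i,k}. pd 2 (f l) p))
     / (\<Prod>m\<in>{1..4}-{i}. jac (f i) (f m) p) * Flex (f i) p)"

definition Pi_2_12 :: "(nat \<Rightarrow> plane \<Rightarrow> real) \<Rightarrow> plane \<Rightarrow> real" where
  "Pi_2_12 f p = - 1 / 3 * (\<Sum>i\<in>{1..4}.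
     (\<Sum>k\<in>{1..4}-{i}. pd 2 (f k) p * (\<Prod>l\<in>{1..4}-{i,k}. pd 1 (f l) p))
     / (\<Prod>m\<in>{1..4}-{i}. jac (f i) (f m) p) * Flex (f i) p)"

definition flex_condition :: "(nat \<Rightarrow> plane \<Rightarrow> real) \<Rightarrow> (plane \<Rightarrow> real) \<Rightarrow> plane \<Rightarrow> bool" where
  "flex_condition f g p \<longleftrightarrow>
     Pi_1_22 f p * (pd 1 g p)^3 - 3 * Pi_1_12 f p * (pd 1 g p)\<^sup>2 * pd 2 g p
     - 3 * Pi_2_12 f p * pd 1 g p * (pd 2 g p)\<^sup>2 + Pi_2_11 f p * (pd 2 g p)^3 = Flex g p"

definition alpha :: "(nat \<Rightarrow> plane \<Rightarrow> real) \<Rightarrow> plane \<Rightarrow> real" where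
  "alpha f p =
     pd 2 (f 4) p * Flex (f 3) p / (pd 1 (f 3) p * pd 2 (f 3) p * jac (f 3) (f 4) p)
     - pd 2 (f 3) p * Flex (f 4) p / (pd 1 (f 4) p * pd 2 (f 4) p * jac (f 3) (f 4) p)"

definition beta :: "(nat \<Rightarrow> plane \<Rightarrow> real) \<Rightarrow> plane \<Rightarrow> real" where
  "beta f p =
     - pd 1 (f 4) p * Flex (f 3) p / (pd 1 (f 3) p * pd 2 (f 3) p * jac (f 3) (f 4) p)
     + pd 1 (f 3) p * Flex (f 4) p / (pd 1 (f 4) p * pd 2 (f 4) p * jac (f 3) (f 4) p)"

end

theory Submission
  imports Defs
begin

text \<open>
  Along a level curve of \<open>f\<close> the geodesic equation reduces to the single scalar identity
  \<open>Q(f\<^sub>x, f\<^sub>y) = Flex f\<close>, where \<open>Q\<close> is a binary cubic form whose coefficients are the projective invariants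
  of the connection. Lagrange interpolation recovers \<open>Q\<close> from four of the web functions, and the remaining
  ones give the conditions of (i).

  For (ii), a symmetric connection on a surface has parallel Ricci tensor, whose skew part is forced to
  vanish; so the Cotton tensor vanishes, which for a structure having the coordinate lines as geodesics
  is the pair of second order equations in \<open>\<alpha>\<close> and \<open>\<beta>\<close> (Liouville's equations). Symmetry is invariant
  under diffeomorphisms, which gives necessity. Conversely Liouville's equations are the integrability
  conditions of a linear system whose solution produces a flat, hence symmetric, connection in the
  projective class.
\<close>

section \<open>Calculus of smooth maps\<close>

text \<open>A torsion-free connection of the plane has six Christoffel symbols, and a projective
  change shifts them by the two components of a 1-form. The four invariants left over are the
  coefficients of one binary cubic: this is why four foliations can be prescribed freely and each
  further one costs exactly one condition.

  In the necessity half of (ii) an equivalence matches only the sets of leaves, not the web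
  functions. Therefore the connection is pulled back to the original coordinates, where the first
  two foliations are still the coordinate lines and Liouville's equations take their short form.

  In the converse nothing is lost by aiming at a flat connection, since Liouville's equations
  already express local projective flatness. The Riccati system for \<rho> is nonlinear; its linear
  form is solvable on a whole small square, but the way back divides by \<sigma>. Hence the
  existence theorem for flat linear systems carries an estimate that keeps the solution close to its
  initial value.\<close>

lemma has_derivative_frechet:
  "f differentiable (at x) \<Longrightarrow> (f has_derivative frechet_derivative f (at x)) (at x)"
  by (simp add: frechet_derivative_works[symmetric])

lemma frechet_derivative_eqI:
  "(f has_derivative f') (at x) \<Longrightarrow> frechet_derivative f (at x) v = f' v"
  using frechet_derivative_at by metis

lemma has_derivative_cong_open:
  assumes "open S" "x \<in> S" "\<And>y. y \<in> S \<Longrightarrow> f y = g y"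
  shows "(f has_derivative D) (at x) \<longleftrightarrow> (g has_derivative D) (at x)"
proof
  show "(g has_derivative D) (at x)" if "(f has_derivative D) (at x)"
    by (rule has_derivative_transform_within_open[OF that assms])
  show "(f has_derivative D) (at x)" if "(g has_derivative D) (at x)"
    by (rule has_derivative_transform_within_open[OF that assms(1,2)]) (simp add: assms(3))
qed

lemma frechet_derivative_cong_open:
  assumes "open S" "x \<in> S" "\<And>y. y \<in> S \<Longrightarrow> f y = g y"
  shows "frechet_derivative f (at x) = frechet_derivative g (at x)"
  using has_derivative_cong_open[OF assms] by (simp add: frechet_derivative_def)

lemma differentiable_cong_open:
  assumes "open S" "x \<in> S" "\<And>y. y \<in> S \<Longrightarrow> f y = g y"
  shows "f differentiable (at x) \<longleftrightarrow> g differentiable (at x)"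
  using has_derivative_cong_open[OF assms] by (simp add: differentiable_def)

section \<open>Stability of C^n maps under algebra and composition\<close>

lemma C_on_cong:
  assumes "open S"
  shows "(\<And>x. x \<in> S \<Longrightarrow> f x = g x) \<Longrightarrow> C_on n S f \<longleftrightarrow> C_on n S g"
proof (induction n arbitrary: f g)
  case 0
  then show ?case by (simp cong: continuous_on_cong)
next
  case (Suc n)
  have "C_on n S (\<lambda>x. frechet_derivative f (at x) v) = C_on n S (\<lambda>x. frechet_derivative g (at x) v)" for v
    by (intro Suc.IH) (simp add: frechet_derivative_cong_open[OF assms _ Suc.prems])
  then show ?case
    using differentiable_cong_open[OF assms _ Suc.prems] by simp
qed

lemma smooth_on_cong:
  assumes "open S" "\<And>x. x \<in> S \<Longrightarrow> f x = g x"
  shows "smooth_on S f \<longleftrightarrow> smooth_on S g"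
  using C_on_cong[OF assms] by (simp add: smooth_on_def)

lemma C_on_subset: "C_on n S f \<Longrightarrow> T \<subseteq> S \<Longrightarrow> C_on n T f"
  by (induction n arbitrary: f) (auto intro: continuous_on_subset)

lemma smooth_on_subset: "smooth_on S f \<Longrightarrow> T \<subseteq> S \<Longrightarrow> smooth_on T f"
  by (auto simp: smooth_on_def intro: C_on_subset)

lemma C_on_imp_continuous_on: "C_on n S f \<Longrightarrow> continuous_on S f"
proof (cases n)
  case (Suc m)
  assume "C_on n S f"
  with Suc have "\<forall>x\<in>S. f differentiable (at x)" by simp
  then show ?thesis
    by (intro continuous_at_imp_continuous_on ballI differentiable_imp_continuous_within) auto
qed simp

lemma C_on_SucD: "C_on (Suc n) S f \<Longrightarrow> C_on n S f"
proof (induction n arbitrary: f)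
  case 0
  then show ?case using C_on_imp_continuous_on by (metis C_on.simps(1))
next
  case (Suc n)
  then show ?case by (metis C_on.simps(2))
qed

lemma C_on_Suc_differentiable: "C_on (Suc n) S f \<Longrightarrow> x \<in> S \<Longrightarrow> f differentiable (at x)"
  by simp

lemma C_on_Suc_hd:
  "C_on (Suc n) S f \<Longrightarrow> x \<in> S \<Longrightarrow> (f has_derivative frechet_derivative f (at x)) (at x)"
  by (simp add: has_derivative_frechet)

text \<open>Lets any explicit formula for the derivative, valid on the open set, stand in for
  \<open>frechet_derivative\<close>; the inductions below all pass through it.\<close>

lemma C_on_SucI:
  assumes "open S" "\<And>x. x \<in> S \<Longrightarrow> (f has_derivative f' x) (at x)" "\<And>v. C_on n S (\<lambda>x. f' x v)"
  shows "C_on (Suc n) S f"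
proof -
  have "C_on n S (\<lambda>x. frechet_derivative f (at x) v)" for v
    using C_on_cong[OF assms(1), of "\<lambda>x. frechet_derivative f (at x) v" "\<lambda>x. f' x v"]
      frechet_derivative_eqI[OF assms(2)] assms(3) by simp
  then show ?thesis using assms(2) by (auto intro: differentiableI)
qed

lemma C_on_const: "C_on n S (\<lambda>x. c)"
  by (induction n arbitrary: c) auto

lemma C_on_bounded_linear:
  assumes "bounded_linear h"
  shows "open S \<Longrightarrow> C_on n S f \<Longrightarrow> C_on n S (\<lambda>x. h (f x))"
proof (induction n arbitrary: f)
  case 0
  then show ?case by (simp add: bounded_linear.continuous_on[OF assms])
next
  case (Suc n)
  show ?case
  proof (rule C_on_SucI[OF Suc.prems(1)])
    fix x assume "x \<in> S"
    show "((\<lambda>x. h (f x)) has_derivative (\<lambda>v. h (frechet_derivative f (at x) v))) (at x)"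
      by (intro bounded_linear.has_derivative[OF assms] C_on_Suc_hd[OF Suc.prems(2) \<open>x \<in> S\<close>])
  next
    fix v
    show "C_on n S (\<lambda>x. h (frechet_derivative f (at x) v))"
      using Suc by (intro Suc.IH) auto
  qed
qed

lemma C_on_add:
  shows "open S \<Longrightarrow> C_on n S f \<Longrightarrow> C_on n S g \<Longrightarrow> C_on n S (\<lambda>x. f x + g x)"
proof (induction n arbitrary: f g)
  case 0
  then show ?case by (simp add: continuous_on_add)
next
  case (Suc n)
  show ?case
  proof (rule C_on_SucI[OF Suc.prems(1)])
    fix x assume "x \<in> S"
    show "((\<lambda>x. f x + g x) has_derivative
        (\<lambda>v. frechet_derivative f (at x) v + frechet_derivative g (at x) v)) (at x)"
      using C_on_Suc_hd[OF Suc.prems(2) \<open>x \<in> S\<close>] C_on_Suc_hd[OF Suc.prems(3) \<open>x \<in> S\<close>]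
      by (rule has_derivative_add)
  next
    fix v
    show "C_on n S (\<lambda>x. frechet_derivative f (at x) v + frechet_derivative g (at x) v)"
      using Suc by (intro Suc.IH) auto
  qed
qed

lemma C_on_bilinear:
  assumes "bounded_bilinear h"
  shows "open S \<Longrightarrow> C_on n S f \<Longrightarrow> C_on n S g \<Longrightarrow> C_on n S (\<lambda>x. h (f x) (g x))"
proof (induction n arbitrary: f g)
  case 0
  then show ?case by (simp add: bounded_bilinear.continuous_on[OF assms])
next
  case (Suc n)
  show ?case
  proof (rule C_on_SucI[OF Suc.prems(1)])
    fix x assume "x \<in> S"
    show "((\<lambda>x. h (f x) (g x)) has_derivative
        (\<lambda>v. h (f x) (frechet_derivative g (at x) v) + h (frechet_derivative f (at x) v) (g x))) (at x)"
      using C_on_Suc_hd[OF Suc.prems(2) \<open>x \<in> S\<close>] C_on_Suc_hd[OF Suc.prems(3) \<open>x \<in> S\<close>]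
      by (rule bounded_bilinear.FDERIV[OF assms])
  next
    fix v
    show "C_on n S (\<lambda>x. h (f x) (frechet_derivative g (at x) v) + h (frechet_derivative f (at x) v) (g x))"
      using Suc C_on_SucD[OF Suc.prems(2)] C_on_SucD[OF Suc.prems(3)] by (intro C_on_add Suc.IH) auto
  qed
qed

lemma C_on_sum:
  "open S \<Longrightarrow> (\<And>i. i \<in> I \<Longrightarrow> C_on n S (f i)) \<Longrightarrow> C_on n S (\<lambda>x. \<Sum>i\<in>I. f i x)"
  by (induction I rule: infinite_finite_induct) (auto intro: C_on_add C_on_const)

lemma linear_expand_Basis:
  "linear h \<Longrightarrow> h v = (\<Sum>b\<in>Basis. (v \<bullet> b) *\<^sub>R h b)" for v :: "'a::euclidean_space"
proof -
  assume h: "linear h"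
  have "h v = h (\<Sum>b\<in>Basis. (v \<bullet> b) *\<^sub>R b)"
    by (simp add: euclidean_representation)
  also have "\<dots> = (\<Sum>b\<in>Basis. (v \<bullet> b) *\<^sub>R h b)"
    using h by (simp add: linear_sum linear_cmul)
  finally show ?thesis .
qed

text \<open>\<open>C_on\<close> speaks only of derivatives in constant directions, whereas the chain
  rule applies the derivative of \<open>g\<close> to the varying vector Df(x)v. Expanding that
  vector in \<open>Basis\<close> turns the derivative into a sum of products of known C^n maps;
  hence the Euclidean middle space.\<close>

lemma C_on_compose:
  fixes f :: "'a::real_normed_vector \<Rightarrow> 'b::euclidean_space" and g :: "'b \<Rightarrow> 'c::real_normed_vector"
  shows "open S \<Longrightarrow> open T \<Longrightarrow> C_on n S f \<Longrightarrow> C_on n T g \<Longrightarrow> f ` S \<subseteq> T \<Longrightarrow> C_on n S (\<lambda>x. g (f x))"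
proof (induction n arbitrary: g)
  case 0
  then show ?case by (auto intro: continuous_on_compose2)
next
  case (Suc n)
  show ?case
  proof (rule C_on_SucI[OF Suc.prems(1)])
    fix x assume "x \<in> S"
    with Suc.prems have gx: "(g has_derivative frechet_derivative g (at (f x))) (at (f x))"
      by (intro C_on_Suc_hd[OF Suc.prems(4)]) auto
    have lin: "linear (frechet_derivative g (at (f x)))"
      using gx has_derivative_linear by blast
    have "((\<lambda>x. g (f x)) has_derivative (\<lambda>v. frechet_derivative g (at (f x)) (frechet_derivative f (at x) v))) (at x)"
      using has_derivative_compose[OF C_on_Suc_hd[OF Suc.prems(3) \<open>x \<in> S\<close>] gx] .
    also have "(\<lambda>v. frechet_derivative g (at (f x)) (frechet_derivative f (at x) v))
      = (\<lambda>v. \<Sum>b\<in>Basis. (frechet_derivative f (at x) v \<bullet> b) *\<^sub>R frechet_derivative g (at (f x)) b)"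
      using linear_expand_Basis[OF lin] by blast
    finally show "((\<lambda>x. g (f x)) has_derivative
      (\<lambda>v. \<Sum>b\<in>Basis. (frechet_derivative f (at x) v \<bullet> b) *\<^sub>R frechet_derivative g (at (f x)) b)) (at x)" .
  next
    fix v
    show "C_on n S (\<lambda>x. \<Sum>b\<in>Basis. (frechet_derivative f (at x) v \<bullet> b) *\<^sub>R frechet_derivative g (at (f x)) b)"
    proof (intro C_on_sum Suc.prems(1) C_on_bilinear[OF bounded_bilinear_scaleR])
      fix b :: 'b
      show "C_on n S (\<lambda>x. frechet_derivative f (at x) v \<bullet> b)"
        using Suc.prems by (intro C_on_bounded_linear[OF bounded_linear_inner_left]) auto
      show "C_on n S (\<lambda>x. frechet_derivative g (at (f x)) b)"
        using Suc.prems C_on_SucD[OF Suc.prems(3)] by (intro Suc.IH) auto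
    qed
  qed
qed

text \<open>The derivative of 1/f is a product of Df with copies of 1/f, so the induction hypothesis
  for 1/f itself closes the step.\<close>

lemma C_on_inverse:
  fixes f :: "'a::real_normed_vector \<Rightarrow> real"
  shows "open S \<Longrightarrow> C_on n S f \<Longrightarrow> (\<And>x. x \<in> S \<Longrightarrow> f x \<noteq> 0) \<Longrightarrow> C_on n S (\<lambda>x. inverse (f x))"
proof (induction n)
  case 0
  then show ?case by (auto intro: continuous_on_inverse)
next
  case (Suc n)
  show ?case
  proof (rule C_on_SucI[OF Suc.prems(1)])
    fix x assume "x \<in> S"
    show "((\<lambda>x. inverse (f x)) has_derivative
        (\<lambda>v. - (inverse (f x) * frechet_derivative f (at x) v * inverse (f x)))) (at x)"
      using Suc.prems(3)[OF \<open>x \<in> S\<close>] C_on_Suc_hd[OF Suc.prems(2) \<open>x \<in> S\<close>]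
      by (rule Deriv.has_derivative_inverse)
  next
    fix v
    have "C_on n S (\<lambda>x. - (inverse (f x) * frechet_derivative f (at x) v * inverse (f x)))"
      if "C_on n S (\<lambda>x. inverse (f x))"
      using that Suc.prems
      by (intro C_on_bounded_linear[OF bounded_linear_minus[OF bounded_linear_ident]]
          C_on_bilinear[OF bounded_bilinear_mult]) auto
    then show "C_on n S (\<lambda>x. - (inverse (f x) * frechet_derivative f (at x) v * inverse (f x)))"
      using Suc C_on_SucD by blast
  qed
qed

section \<open>Closure rules for smooth maps\<close>

named_theorems smooth_intros

lemma smooth_on_const [smooth_intros]: "smooth_on S (\<lambda>x. c)"
  by (simp add: smooth_on_def C_on_const)

lemma smooth_on_id [smooth_intros]: "open S \<Longrightarrow> smooth_on S (\<lambda>x. x)"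
  unfolding smooth_on_def
proof
  fix n assume "open S"
  then show "C_on n S (\<lambda>x. x)"
    by (cases n) (auto intro!: C_on_SucI C_on_const)
qed

lemma smooth_on_bounded_linear:
  "bounded_linear h \<Longrightarrow> open S \<Longrightarrow> smooth_on S f \<Longrightarrow> smooth_on S (\<lambda>x. h (f x))"
  by (simp add: smooth_on_def C_on_bounded_linear)

lemma smooth_on_bilinear:
  "bounded_bilinear h \<Longrightarrow> open S \<Longrightarrow> smooth_on S f \<Longrightarrow> smooth_on S g \<Longrightarrow> smooth_on S (\<lambda>x. h (f x) (g x))"
  by (simp add: smooth_on_def C_on_bilinear)

lemma smooth_on_add [smooth_intros]:
  "open S \<Longrightarrow> smooth_on S f \<Longrightarrow> smooth_on S g \<Longrightarrow> smooth_on S (\<lambda>x. f x + g x)"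
  by (simp add: smooth_on_def C_on_add)

lemma smooth_on_minus [smooth_intros]:
  "open S \<Longrightarrow> smooth_on S f \<Longrightarrow> smooth_on S (\<lambda>x. - f x)"
  by (rule smooth_on_bounded_linear[OF bounded_linear_minus[OF bounded_linear_ident]])

lemma smooth_on_diff [smooth_intros]:
  "open S \<Longrightarrow> smooth_on S f \<Longrightarrow> smooth_on S g \<Longrightarrow> smooth_on S (\<lambda>x. f x - g x)"
  using smooth_on_add[of S f "\<lambda>x. - g x"] smooth_on_minus[of S g] by simp

lemma smooth_on_mult [smooth_intros]:
  fixes f g :: "'a::real_normed_vector \<Rightarrow> real"
  shows "open S \<Longrightarrow> smooth_on S f \<Longrightarrow> smooth_on S g \<Longrightarrow> smooth_on S (\<lambda>x. f x * g x)"
  by (rule smooth_on_bilinear[OF bounded_bilinear_mult])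

lemma smooth_on_scaleR [smooth_intros]:
  "open S \<Longrightarrow> smooth_on S f \<Longrightarrow> smooth_on S g \<Longrightarrow> smooth_on S (\<lambda>x. f x *\<^sub>R g x)"
  by (rule smooth_on_bilinear[OF bounded_bilinear_scaleR])

lemma smooth_on_power [smooth_intros]:
  fixes f :: "'a::real_normed_vector \<Rightarrow> real"
  shows "open S \<Longrightarrow> smooth_on S f \<Longrightarrow> smooth_on S (\<lambda>x. f x ^ n)"
  by (induction n) (auto intro: smooth_intros)

lemma smooth_on_sum [smooth_intros]:
  "open S \<Longrightarrow> (\<And>i. i \<in> I \<Longrightarrow> smooth_on S (f i)) \<Longrightarrow> smooth_on S (\<lambda>x. \<Sum>i\<in>I. f i x)"
  by (simp add: smooth_on_def C_on_sum)

lemma smooth_on_prod [smooth_intros]: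
  fixes f :: "'i \<Rightarrow> 'a::real_normed_vector \<Rightarrow> real"
  shows "open S \<Longrightarrow> (\<And>i. i \<in> I \<Longrightarrow> smooth_on S (f i)) \<Longrightarrow> smooth_on S (\<lambda>x. \<Prod>i\<in>I. f i x)"
  by (induction I rule: infinite_finite_induct) (auto intro: smooth_intros)

lemma smooth_on_divide [smooth_intros]:
  fixes f g :: "'a::real_normed_vector \<Rightarrow> real"
  shows "open S \<Longrightarrow> smooth_on S f \<Longrightarrow> smooth_on S g \<Longrightarrow> (\<And>x. x \<in> S \<Longrightarrow> g x \<noteq> 0) \<Longrightarrow>
    smooth_on S (\<lambda>x. f x / g x)"
  unfolding divide_inverse
  by (rule smooth_on_mult) (auto simp: smooth_on_def C_on_inverse)

lemma smooth_on_vec_nth [smooth_intros]: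
  "open S \<Longrightarrow> smooth_on S f \<Longrightarrow> smooth_on S (\<lambda>x. f x $ i)"
  by (rule smooth_on_bounded_linear[OF bounded_linear_vec_nth])

lemma smooth_on_compose:
  fixes f :: "'a::real_normed_vector \<Rightarrow> 'b::euclidean_space" and g :: "'b \<Rightarrow> 'c::real_normed_vector"
  shows "open S \<Longrightarrow> open T \<Longrightarrow> smooth_on S f \<Longrightarrow> smooth_on T g \<Longrightarrow> f ` S \<subseteq> T \<Longrightarrow> smooth_on S (\<lambda>x. g (f x))"
  by (simp add: smooth_on_def C_on_compose)

lemma smooth_on_vec_lambda [smooth_intros]:
  fixes f :: "'i::finite \<Rightarrow> 'a::real_normed_vector \<Rightarrow> real"
  assumes "open S" "\<And>i. smooth_on S (f i)"
  shows "smooth_on S (\<lambda>x. \<chi> i. f i x)"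
proof -
  have "(\<lambda>x. \<chi> i. f i x) = (\<lambda>x. \<Sum>i\<in>UNIV. f i x *\<^sub>R axis i 1)"
    by (auto simp: vec_eq_iff axis_def if_distrib cong: if_cong)
  with assms show ?thesis by (auto intro!: smooth_intros)
qed

lemma smooth_on_differentiable: "smooth_on S f \<Longrightarrow> x \<in> S \<Longrightarrow> f differentiable (at x)"
  by (meson C_on_Suc_differentiable smooth_on_def)

lemma smooth_on_hd:
  "smooth_on S f \<Longrightarrow> x \<in> S \<Longrightarrow> (f has_derivative frechet_derivative f (at x)) (at x)"
  by (meson C_on_Suc_hd smooth_on_def)

lemma smooth_on_continuous: "smooth_on S f \<Longrightarrow> continuous_on S f"
  using C_on.simps(1) smooth_on_def by blast

lemma smooth_on_frechet_const: "smooth_on S f \<Longrightarrow> smooth_on S (\<lambda>x. frechet_derivative f (at x) v)"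
  using C_on.simps(2) smooth_on_def by metis

lemma smooth_on_frechet [smooth_intros]:
  fixes f :: "'a::euclidean_space \<Rightarrow> 'b::real_normed_vector"
  assumes "open S" "smooth_on S f" "smooth_on S v"
  shows "smooth_on S (\<lambda>x. frechet_derivative f (at x) (v x))"
proof -
  have "frechet_derivative f (at x) (v x) = (\<Sum>b\<in>Basis. (v x \<bullet> b) *\<^sub>R frechet_derivative f (at x) b)"
    if "x \<in> S" for x
    using linear_expand_Basis[OF linear_frechet_derivative[OF smooth_on_differentiable[OF assms(2) that]]] .
  moreover have "smooth_on S (\<lambda>x. \<Sum>b\<in>Basis. (v x \<bullet> b) *\<^sub>R frechet_derivative f (at x) b)"
    using assms
    by (intro smooth_intros smooth_on_frechet_const smooth_on_bounded_linear[OF bounded_linear_inner_left])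
  ultimately show ?thesis
    by (subst smooth_on_cong[OF assms(1)])
qed

section \<open>Symmetry of second derivatives and partial derivatives\<close>

text \<open>The mean value theorem is used twice: for s \<mapsto> f(x + su + hv) - f(x + su), then
  in the direction v for the derivative along u. The left side is symmetric in u and v, the right
  side is one particular mixed derivative.\<close>

lemma second_difference_mean_value:
  fixes f :: "'a::real_normed_vector \<Rightarrow> real"
  assumes f: "C_on (Suc (Suc 0)) S f" and h: "0 < h"
    and S: "\<And>s t. 0 \<le> s \<Longrightarrow> s \<le> h \<Longrightarrow> 0 \<le> t \<Longrightarrow> t \<le> h \<Longrightarrow> x + s *\<^sub>R u + t *\<^sub>R v \<in> S"
  obtains s t where "0 \<le> s" "s \<le> h" "0 \<le> t" "t \<le> h"
    "f (x + h *\<^sub>R u + h *\<^sub>R v) - f (x + h *\<^sub>R u) - f (x + h *\<^sub>R v) + f x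
      = h * (h * frechet_derivative (\<lambda>y. frechet_derivative f (at y) u) (at (x + s *\<^sub>R u + t *\<^sub>R v)) v)"
proof -
  let ?f1 = "\<lambda>y. frechet_derivative f (at y) u"
  let ?f2 = "\<lambda>y. frechet_derivative ?f1 (at y) v"
  have f1: "C_on (Suc 0) S ?f1" using f by simp
  have d1: "((\<lambda>s. f (x + s *\<^sub>R u + t *\<^sub>R v)) has_derivative (\<lambda>r. ?f1 (x + s *\<^sub>R u + t *\<^sub>R v) * r)) (at s)"
    if "0 \<le> s" "s \<le> h" "0 \<le> t" "t \<le> h" for s t
  proof -
    have D: "(f has_derivative frechet_derivative f (at (x + s *\<^sub>R u + t *\<^sub>R v))) (at (x + s *\<^sub>R u + t *\<^sub>R v))"
      using C_on_Suc_hd[OF f S[OF that]] .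
    have "((\<lambda>s. f (x + s *\<^sub>R u + t *\<^sub>R v)) has_derivative
       (\<lambda>r. frechet_derivative f (at (x + s *\<^sub>R u + t *\<^sub>R v)) (r *\<^sub>R u))) (at s)"
      by (rule has_derivative_compose[where g = f and f = "\<lambda>s. x + s *\<^sub>R u + t *\<^sub>R v", OF _ D]) (auto intro!: derivative_eq_intros)
    then show ?thesis
      using linear_cmul[OF has_derivative_linear[OF D]] by (simp add: mult.commute)
  qed
  have d2: "((\<lambda>t. ?f1 (x + s *\<^sub>R u + t *\<^sub>R v)) has_derivative (\<lambda>r. ?f2 (x + s *\<^sub>R u + t *\<^sub>R v) * r)) (at t)"
    if "0 \<le> s" "s \<le> h" "0 \<le> t" "t \<le> h" for s t
  proof -
    have D: "(?f1 has_derivative frechet_derivative ?f1 (at (x + s *\<^sub>R u + t *\<^sub>R v))) (at (x + s *\<^sub>R u + t *\<^sub>R v))"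
      using C_on_Suc_hd[OF f1 S[OF that]] .
    have "((\<lambda>t. ?f1 (x + s *\<^sub>R u + t *\<^sub>R v)) has_derivative
       (\<lambda>r. frechet_derivative ?f1 (at (x + s *\<^sub>R u + t *\<^sub>R v)) (r *\<^sub>R v))) (at t)"
      by (rule has_derivative_compose[where g = ?f1 and f = "\<lambda>t. x + s *\<^sub>R u + t *\<^sub>R v", OF _ D]) (auto intro!: derivative_eq_intros)
    then show ?thesis
      using linear_cmul[OF has_derivative_linear[OF D]] by (simp add: mult.commute)
  qed
  let ?g = "\<lambda>s. f (x + s *\<^sub>R u + h *\<^sub>R v) - f (x + s *\<^sub>R u + 0 *\<^sub>R v)"
  have "(?g has_derivative (\<lambda>r. ?f1 (x + s *\<^sub>R u + h *\<^sub>R v) * r - ?f1 (x + s *\<^sub>R u + 0 *\<^sub>R v) * r)) (at s)"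
    if "0 \<le> s" "s \<le> h" for s
    by (intro has_derivative_diff d1) (use that h in auto)
  then have "\<exists>s\<in>{0<..<h}. ?g h - ?g 0 =
      ?f1 (x + s *\<^sub>R u + h *\<^sub>R v) * (h - 0) - ?f1 (x + s *\<^sub>R u + 0 *\<^sub>R v) * (h - 0)"
    by (intro mvt_simple[OF h]) (auto intro: has_derivative_at_withinI)
  then obtain s where s: "0 < s" "s < h"
    "?g h - ?g 0 = ?f1 (x + s *\<^sub>R u + h *\<^sub>R v) * h - ?f1 (x + s *\<^sub>R u + 0 *\<^sub>R v) * h" by auto
  have "\<exists>t\<in>{0<..<h}. ?f1 (x + s *\<^sub>R u + h *\<^sub>R v) - ?f1 (x + s *\<^sub>R u + 0 *\<^sub>R v) =
      ?f2 (x + s *\<^sub>R u + t *\<^sub>R v) * (h - 0)"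
    using s by (intro mvt_simple[OF h]) (auto intro!: has_derivative_at_withinI[OF d2])
  then obtain t where t: "0 < t" "t < h"
    "?f1 (x + s *\<^sub>R u + h *\<^sub>R v) - ?f1 (x + s *\<^sub>R u + 0 *\<^sub>R v) = ?f2 (x + s *\<^sub>R u + t *\<^sub>R v) * h" by auto
  have "f (x + h *\<^sub>R u + h *\<^sub>R v) - f (x + h *\<^sub>R u) - f (x + h *\<^sub>R v) + f x = ?g h - ?g 0"
    by simp
  also have "\<dots> = h * (?f1 (x + s *\<^sub>R u + h *\<^sub>R v) - ?f1 (x + s *\<^sub>R u + 0 *\<^sub>R v))"
    unfolding s(3) by (simp add: algebra_simps)
  also have "\<dots> = h * (h * ?f2 (x + s *\<^sub>R u + t *\<^sub>R v))"
    unfolding t(3) by simp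
  finally show ?thesis
    using that[of s t] s t by simp
qed

text \<open>Both mixed derivatives, taken at suitable points near x, equal the same second
  difference; a gap between them at x would contradict their continuity there.\<close>

theorem second_derivative_symmetric:
  fixes f :: "'a::real_normed_vector \<Rightarrow> real"
  assumes "open S" and f: "C_on (Suc (Suc 0)) S f" and "x \<in> S"
  shows "frechet_derivative (\<lambda>y. frechet_derivative f (at y) u) (at x) v
       = frechet_derivative (\<lambda>y. frechet_derivative f (at y) v) (at x) u"
proof (rule ccontr)
  define F where "F u v y = frechet_derivative (\<lambda>y. frechet_derivative f (at y) u) (at y) v" for u v y
  assume "\<not> ?thesis"
  then have ne: "F u v x \<noteq> F v u x" by (simp add: F_def)
  define e where "e = \<bar>F u v x - F v u x\<bar> / 2"
  have e: "0 < e" using ne by (simp add: e_def)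
  have cont: "continuous (at x) (F u v)" for u v
    using f \<open>open S\<close> \<open>x \<in> S\<close> by (simp add: F_def[abs_def] continuous_on_eq_continuous_at)
  obtain d1 where d1: "d1 > 0" "\<And>y. dist y x < d1 \<Longrightarrow> dist (F u v y) (F u v x) < e"
    using cont[of u v] e unfolding continuous_at_eps_delta by blast
  obtain d2 where d2: "d2 > 0" "\<And>y. dist y x < d2 \<Longrightarrow> dist (F v u y) (F v u x) < e"
    using cont[of v u] e unfolding continuous_at_eps_delta by blast
  obtain d3 where d3: "d3 > 0" "\<And>y. dist y x < d3 \<Longrightarrow> y \<in> S"
    using \<open>open S\<close> \<open>x \<in> S\<close> unfolding open_dist by blast
  define d where "d = min d1 (min d2 d3)"
  have d: "0 < d" using d1 d2 d3 by (simp add: d_def)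
  \<comment> \<open>Small enough for the parallelogram spanned by hu and hv to stay within distance
    d of x; the \<open>+ 1\<close> covers u = v = 0.\<close>
  define h where "h = d / (2 * (norm u + norm v + 1))"
  have h: "0 < h" using d by (simp add: h_def add_nonneg_pos)
  have near: "dist (x + s *\<^sub>R u + t *\<^sub>R v) x < d" if "0 \<le> s" "s \<le> h" "0 \<le> t" "t \<le> h" for s t
  proof -
    have "dist (x + s *\<^sub>R u + t *\<^sub>R v) x = norm (s *\<^sub>R u + t *\<^sub>R v)" by (simp add: dist_norm)
    also have "\<dots> \<le> s * norm u + t * norm v"
      using that norm_triangle_ineq[of "s *\<^sub>R u" "t *\<^sub>R v"] by simp
    also have "\<dots> \<le> h * norm u + h * norm v"
      using that by (intro add_mono mult_right_mono) auto
    also have "\<dots> < h * (2 * (norm u + norm v + 1))"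
      using h by (simp add: algebra_simps add_pos_nonneg add_strict_increasing2)
    also have "\<dots> = d"
      using add_nonneg_pos[of "norm u + norm v" 1] by (simp add: h_def)
    finally show ?thesis .
  qed
  obtain s t where st: "0 \<le> s" "s \<le> h" "0 \<le> t" "t \<le> h"
    "f (x + h *\<^sub>R u + h *\<^sub>R v) - f (x + h *\<^sub>R u) - f (x + h *\<^sub>R v) + f x
      = h * (h * F u v (x + s *\<^sub>R u + t *\<^sub>R v))"
    unfolding F_def
    by (rule second_difference_mean_value[OF f h, of x u v]) (use near d3 d_def in auto)
  obtain s' t' where st': "0 \<le> s'" "s' \<le> h" "0 \<le> t'" "t' \<le> h"
    "f (x + h *\<^sub>R v + h *\<^sub>R u) - f (x + h *\<^sub>R v) - f (x + h *\<^sub>R u) + f x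
      = h * (h * F v u (x + s' *\<^sub>R v + t' *\<^sub>R u))"
    unfolding F_def
  proof (rule second_difference_mean_value[OF f h, of x v u])
    fix s t assume "0 \<le> s" "s \<le> h" "0 \<le> t" "t \<le> h"
    then show "x + s *\<^sub>R v + t *\<^sub>R u \<in> S"
      using near[of t s] d3 by (simp add: d_def add.commute add.left_commute)
  qed auto
  have swap: "x + h *\<^sub>R v + h *\<^sub>R u = x + h *\<^sub>R u + h *\<^sub>R v" by simp
  have "h * (h * F u v (x + s *\<^sub>R u + t *\<^sub>R v)) = h * (h * F v u (x + s' *\<^sub>R v + t' *\<^sub>R u))"
    using st(5) st'(5)[unfolded swap] by linarith
  then have eq: "F u v (x + s *\<^sub>R u + t *\<^sub>R v) = F v u (x + s' *\<^sub>R v + t' *\<^sub>R u)" using h by simp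
  have "dist (F u v (x + s *\<^sub>R u + t *\<^sub>R v)) (F u v x) < e"
    using near[OF st(1-4)] by (intro d1) (simp add: d_def)
  moreover have "dist (F v u (x + s' *\<^sub>R v + t' *\<^sub>R u)) (F v u x) < e"
    using near[OF st'(3,4,1,2)] by (intro d2) (simp add: d_def add.commute add.left_commute)
  ultimately have "\<bar>F u v x - F v u x\<bar> < 2 * e"
    unfolding eq dist_real_def by linarith
  then show False by (simp add: e_def)
qed

lemma frechet_component:
  assumes "f differentiable (at x)"
  shows "frechet_derivative (\<lambda>y. f y $ k) (at x) v = frechet_derivative f (at x) v $ k"
  by (rule frechet_derivative_eqI)
    (rule bounded_linear.has_derivative[OF bounded_linear_vec_nth has_derivative_frechet[OF assms]])

lemma second_derivative_symmetric_vec: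
  fixes f :: "'a::real_normed_vector \<Rightarrow> real ^ 'n"
  assumes "open S" "smooth_on S f" "x \<in> S"
  shows "frechet_derivative (\<lambda>y. frechet_derivative f (at y) u) (at x) v
       = frechet_derivative (\<lambda>y. frechet_derivative f (at y) v) (at x) u"
proof (rule vec_eq_iff[THEN iffD2], rule allI)
  fix k
  have sm: "smooth_on S (\<lambda>y. f y $ k)" using assms by (intro smooth_intros)
  have "frechet_derivative (\<lambda>y. frechet_derivative (\<lambda>z. f z $ k) (at y) u) (at x) v
      = frechet_derivative (\<lambda>y. frechet_derivative f (at y) u) (at x) v $ k" for u v
  proof -
    have "frechet_derivative (\<lambda>y. frechet_derivative (\<lambda>z. f z $ k) (at y) u) (at x)
        = frechet_derivative (\<lambda>y. frechet_derivative f (at y) u $ k) (at x)"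
      by (rule frechet_derivative_cong_open[OF assms(1,3)])
        (simp add: frechet_component smooth_on_differentiable[OF assms(2)])
    then show ?thesis
      by (simp add: frechet_component smooth_on_differentiable[OF smooth_on_frechet_const[OF assms(2)] assms(3)])
  qed
  then show "frechet_derivative (\<lambda>y. frechet_derivative f (at y) u) (at x) v $ k
     = frechet_derivative (\<lambda>y. frechet_derivative f (at y) v) (at x) u $ k"
    using second_derivative_symmetric[OF assms(1) _ assms(3), of "\<lambda>z. f z $ k" u v] sm
    unfolding smooth_on_def by metis
qed

section \<open>Partial derivatives and their calculus rules\<close>

lemma smooth_on_pd [smooth_intros]: "smooth_on S f \<Longrightarrow> smooth_on S (\<lambda>p. pd j f p)"
  unfolding pd_def by (rule smooth_on_frechet_const)

lemma smooth_on_pd' [smooth_intros]: "smooth_on S f \<Longrightarrow> smooth_on S (pd j f)"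
  using smooth_on_pd .

lemma pd_swap:
  assumes "open S" "smooth_on S f" "p \<in> S"
  shows "pd 2 (pd 1 f) p = pd 1 (pd 2 f) p"
  using second_derivative_symmetric[OF assms(1) _ assms(3), of f] assms(2)
  unfolding smooth_on_def pd_def[abs_def] by metis

lemma pd_cong_open:
  assumes "open S" "p \<in> S" "\<And>y. y \<in> S \<Longrightarrow> f y = g y"
  shows "pd j f p = pd j g p"
  using frechet_derivative_cong_open[OF assms] by (simp add: pd_def)

lemma pd_const [simp]: "pd j (\<lambda>x. c) p = 0"
  by (simp add: pd_def)

lemma pd_add:
  "f differentiable (at p) \<Longrightarrow> g differentiable (at p) \<Longrightarrow> pd j (\<lambda>q. f q + g q) p = pd j f p + pd j g p"
  unfolding pd_def
  by (rule frechet_derivative_eqI) (intro has_derivative_add has_derivative_frechet)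

lemma pd_diff:
  "f differentiable (at p) \<Longrightarrow> g differentiable (at p) \<Longrightarrow> pd j (\<lambda>q. f q - g q) p = pd j f p - pd j g p"
  unfolding pd_def
  by (rule frechet_derivative_eqI) (intro has_derivative_diff has_derivative_frechet)

lemma pd_minus:
  "f differentiable (at p) \<Longrightarrow> pd j (\<lambda>q. - f q) p = - pd j f p"
  unfolding pd_def
  by (rule frechet_derivative_eqI) (intro has_derivative_minus has_derivative_frechet)

lemma pd_mult:
  "f differentiable (at p) \<Longrightarrow> g differentiable (at p) \<Longrightarrow>
    pd j (\<lambda>q. f q * g q) p = f p * pd j g p + pd j f p * g p"
  unfolding pd_def
  by (rule frechet_derivative_eqI) (intro has_derivative_mult has_derivative_frechet)

lemma pd_cmult:
  "f differentiable (at p) \<Longrightarrow> pd j (\<lambda>q. c * f q) p = c * pd j f p"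
  by (simp add: pd_mult)

lemma pd_divide:
  "f differentiable (at p) \<Longrightarrow> g differentiable (at p) \<Longrightarrow> g p \<noteq> 0 \<Longrightarrow>
    pd j (\<lambda>q. f q / g q) p = pd j f p / g p - f p * pd j g p / (g p)\<^sup>2"
proof -
  assume f: "f differentiable (at p)" and g: "g differentiable (at p)" and nz: "g p \<noteq> 0"
  have "pd j (\<lambda>q. f q / g q) p
    = - f p * (inverse (g p) * frechet_derivative g (at p) (axis j 1) * inverse (g p))
      + frechet_derivative f (at p) (axis j 1) / g p"
    unfolding pd_def
    by (rule frechet_derivative_eqI)
      (use has_derivative_divide[OF has_derivative_frechet[OF f] has_derivative_frechet[OF g] nz] in simp)
  then show ?thesis
    by (simp add: pd_def field_simps power2_eq_square)
qed

lemma pd_component_coordinate: "pd j (\<lambda>q. q $ k) p = (if j = k then 1 else 0)"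
  unfolding pd_def
  by (subst frechet_derivative_eqI[OF bounded_linear_imp_has_derivative[OF bounded_linear_vec_nth]])
    (simp add: axis_def)

lemma plane_expand: "v = v $ 1 *\<^sub>R axis 1 1 + v $ 2 *\<^sub>R axis 2 1" for v :: plane
  by (simp add: vec_eq_iff forall_2 axis_def)

lemma frechet_derivative_plane:
  fixes f :: "plane \<Rightarrow> 'b::real_normed_vector"
  assumes "f differentiable (at p)"
  shows "frechet_derivative f (at p) v
    = v $ 1 *\<^sub>R frechet_derivative f (at p) (axis 1 1) + v $ 2 *\<^sub>R frechet_derivative f (at p) (axis 2 1)"
proof -
  have lin: "linear (frechet_derivative f (at p))"
    using assms by (rule linear_frechet_derivative)
  show ?thesis
    by (subst plane_expand[of v]) (simp add: linear_add[OF lin] linear_cmul[OF lin])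
qed

lemma frechet_derivative_pd:
  "f differentiable (at p) \<Longrightarrow> frechet_derivative f (at p) v = v $ 1 * pd 1 f p + v $ 2 * pd 2 f p"
  using frechet_derivative_plane[of f p v] by (simp add: pd_def)

section \<open>Geodesic leaves\<close>

lemma christoffel_component:
  "christoffel \<Gamma> p u v $ k =
    \<Gamma> k 1 1 p * u $ 1 * v $ 1 + \<Gamma> k 1 2 p * u $ 1 * v $ 2 + \<Gamma> k 2 1 p * u $ 2 * v $ 1 + \<Gamma> k 2 2 p * u $ 2 * v $ 2"
  by (simp add: christoffel_def sum_2)

text \<open>The pairing of the covector (\<xi>, \<eta>) with \<Gamma>(v, v) for v = (-\<eta>,
  \<xi>), the vector it annihilates. Its coefficients are the four combinations of Christoffel
  symbols that survive a projective change.\<close>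

definition geodesic_cubic :: "connection \<Rightarrow> plane \<Rightarrow> real \<Rightarrow> real \<Rightarrow> real" where
  "geodesic_cubic \<Gamma> p \<xi> \<eta> = \<Gamma> 1 2 2 p * \<xi>^3 + (\<Gamma> 2 2 2 p - 2 * \<Gamma> 1 1 2 p) * \<xi>\<^sup>2 * \<eta>
     + (\<Gamma> 1 1 1 p - 2 * \<Gamma> 2 1 2 p) * \<xi> * \<eta>\<^sup>2 + \<Gamma> 2 1 1 p * \<eta>^3"

lemma has_vector_derivative_velocity:
  "smooth_on {a<..<b} \<gamma> \<Longrightarrow> t \<in> {a<..<b} \<Longrightarrow> (\<gamma> has_vector_derivative velocity \<gamma> t) (at t)"
  unfolding velocity_def
  using smooth_on_differentiable vector_derivative_works by blast

lemma smooth_on_velocity: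
  assumes "smooth_on {a<..<b} \<gamma>"
  shows "smooth_on {a<..<b} (velocity \<gamma>)"
proof -
  have "velocity \<gamma> t = frechet_derivative \<gamma> (at t) 1" if "t \<in> {a<..<b}" for t
    using frechet_derivative_eq_vector_derivative[OF smooth_on_differentiable[OF assms that]]
    by (simp add: velocity_def)
  then show ?thesis
    using smooth_on_frechet_const[OF assms, of 1] smooth_on_cong[of "{a<..<b}" "velocity \<gamma>"] by simp
qed

lemma has_real_derivative_along_curve:
  assumes "h differentiable (at (\<gamma> t))" "(\<gamma> has_vector_derivative v) (at t)"
  shows "((\<lambda>t. h (\<gamma> t)) has_real_derivative pd 1 h (\<gamma> t) * v $ 1 + pd 2 h (\<gamma> t) * v $ 2) (at t)"
proof -
  have "((\<lambda>t. h (\<gamma> t)) has_derivative (\<lambda>r. frechet_derivative h (at (\<gamma> t)) (r *\<^sub>R v))) (at t)"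
    by (rule has_derivative_compose[OF assms(2)[unfolded has_vector_derivative_def]
        has_derivative_frechet[OF assms(1)]])
  moreover have "(\<lambda>r. frechet_derivative h (at (\<gamma> t)) (r *\<^sub>R v))
      = (*) (pd 1 h (\<gamma> t) * v $ 1 + pd 2 h (\<gamma> t) * v $ 2)"
    by (rule ext) (simp add: frechet_derivative_pd[OF assms(1)] algebra_simps)
  ultimately show ?thesis
    by (simp add: has_field_derivative_def)
qed

lemma has_real_derivative_component:
  "(\<gamma> has_vector_derivative v) (at t) \<Longrightarrow> ((\<lambda>t. \<gamma> t $ k) has_real_derivative v $ k) (at t)"
  using bounded_linear.has_vector_derivative[OF bounded_linear_vec_nth]
  by (auto simp: has_real_derivative_iff_has_vector_derivative)

text \<open>The first identity holds on the whole interval, so it can be differentiated once more to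
  give the second.\<close>

lemma level_curve_derivatives:
  assumes U: "open U" "smooth_on U f" and \<gamma>: "smooth_on {a<..<b} \<gamma>" "\<gamma> ` {a<..<b} \<subseteq> U"
    and level: "\<And>t. t \<in> {a<..<b} \<Longrightarrow> f (\<gamma> t) = c" and t: "t \<in> {a<..<b}"
  defines "v \<equiv> velocity \<gamma> t" and "w \<equiv> velocity (velocity \<gamma>) t"
  shows "pd 1 f (\<gamma> t) * v $ 1 + pd 2 f (\<gamma> t) * v $ 2 = 0"
    and "pd 1 f (\<gamma> t) * w $ 1 + pd 2 f (\<gamma> t) * w $ 2 + pd 1 (pd 1 f) (\<gamma> t) * (v $ 1)\<^sup>2
      + 2 * pd 2 (pd 1 f) (\<gamma> t) * v $ 1 * v $ 2 + pd 2 (pd 2 f) (\<gamma> t) * (v $ 2)\<^sup>2 = 0"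
proof -
  have zero: "D = 0" if "t \<in> {a<..<b}" "\<And>s. s \<in> {a<..<b} \<Longrightarrow> g s = k" "(g has_real_derivative D) (at t)"
    for g :: "real \<Rightarrow> real" and k D t
  proof -
    have "(g has_real_derivative 0) (at t)"
      by (rule has_field_derivative_transform_within_open[OF DERIV_const[of k] _ that(1)])
        (simp_all add: that(2))
    with that(3) show ?thesis using DERIV_unique by blast
  qed
  have inU: "\<gamma> s \<in> U" if "s \<in> {a<..<b}" for s using \<gamma>(2) that by auto
  have first: "pd 1 f (\<gamma> s) * velocity \<gamma> s $ 1 + pd 2 f (\<gamma> s) * velocity \<gamma> s $ 2 = 0"
    if "s \<in> {a<..<b}" for s
    using zero[OF that level has_real_derivative_along_curve[OF smooth_on_differentiable[OF U(2) inU[OF that]]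
        has_vector_derivative_velocity[OF \<gamma>(1) that]]] .
  then show "pd 1 f (\<gamma> t) * v $ 1 + pd 2 f (\<gamma> t) * v $ 2 = 0"
    using t by (simp add: v_def)
  have vt: "(velocity \<gamma> has_vector_derivative w) (at t)"
    unfolding w_def by (rule has_vector_derivative_velocity[OF smooth_on_velocity[OF \<gamma>(1)] t])
  have gt: "(\<gamma> has_vector_derivative v) (at t)"
    unfolding v_def by (rule has_vector_derivative_velocity[OF \<gamma>(1) t])
  have diff: "pd j f differentiable (at (\<gamma> t))" for j
    using smooth_on_differentiable[OF smooth_on_pd'[OF U(2)] inU[OF t]] .
  have "((\<lambda>s. pd 1 f (\<gamma> s) * velocity \<gamma> s $ 1 + pd 2 f (\<gamma> s) * velocity \<gamma> s $ 2) has_real_derivative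
    ((pd 1 (pd 1 f) (\<gamma> t) * v $ 1 + pd 2 (pd 1 f) (\<gamma> t) * v $ 2) * velocity \<gamma> t $ 1 + w $ 1 * pd 1 f (\<gamma> t)
     + ((pd 1 (pd 2 f) (\<gamma> t) * v $ 1 + pd 2 (pd 2 f) (\<gamma> t) * v $ 2) * velocity \<gamma> t $ 2 + w $ 2 * pd 2 f (\<gamma> t)))) (at t)"
    by (intro DERIV_add DERIV_mult has_real_derivative_along_curve diff gt has_real_derivative_component[OF vt])
  from zero[OF t first this]
  show "pd 1 f (\<gamma> t) * w $ 1 + pd 2 f (\<gamma> t) * w $ 2 + pd 1 (pd 1 f) (\<gamma> t) * (v $ 1)\<^sup>2
      + 2 * pd 2 (pd 1 f) (\<gamma> t) * v $ 1 * v $ 2 + pd 2 (pd 2 f) (\<gamma> t) * (v $ 2)\<^sup>2 = 0"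
    unfolding pd_swap[OF U inU[OF t]] v_def[symmetric]
    by (simp add: power2_eq_square algebra_simps)
qed

text \<open>The kernel of a nonzero covector in the plane is a line. This replaces the unknown
  factor in the geodesic equation by a single scalar equation.\<close>

lemma orthogonal_plane_proportional:
  fixes v z :: plane
  assumes "v \<noteq> 0" "(m, n) \<noteq> (0, 0)" "m * v $ 1 + n * v $ 2 = 0"
  shows "(\<exists>\<mu>. z = \<mu> *\<^sub>R v) \<longleftrightarrow> m * z $ 1 + n * z $ 2 = 0"
proof
  assume "\<exists>\<mu>. z = \<mu> *\<^sub>R v"
  then obtain \<mu> where "z = \<mu> *\<^sub>R v" by blast
  then have "m * z $ 1 + n * z $ 2 = \<mu> * (m * v $ 1 + n * v $ 2)" by (simp add: algebra_simps)
  then show "m * z $ 1 + n * z $ 2 = 0" using assms(3) by simp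
next
  assume z: "m * z $ 1 + n * z $ 2 = 0"
  have det: "v $ 1 * z $ 2 = v $ 2 * z $ 1"
  proof -
    have "m * (v $ 1 * z $ 2 - v $ 2 * z $ 1) = 0" "n * (v $ 1 * z $ 2 - v $ 2 * z $ 1) = 0"
      using z assms(3) by algebra+
    then show ?thesis using assms(2) by auto
  qed
  show "\<exists>\<mu>. z = \<mu> *\<^sub>R v"
  proof (cases "v $ 1 = 0")
    case True
    then have "v $ 2 \<noteq> 0" using assms(1) by (auto simp: vec_eq_iff forall_2)
    then have "z = (z $ 2 / v $ 2) *\<^sub>R v"
      using det True by (auto simp: vec_eq_iff forall_2)
    then show ?thesis by blast
  next
    case False
    then have "z = (z $ 1 / v $ 1) *\<^sub>R v"
      using det by (auto simp: vec_eq_iff forall_2 field_simps)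
    then show ?thesis by blast
  qed
qed

text \<open>The geodesic equation is tested by pairing it with df. The velocity is \<mu>(-f_y, f_x)
  with \<mu> nonzero, so the acceleration contributes -\<mu>^2 Flex f, the Christoffel term
  contributes \<mu>^2 times the cubic, and \<mu> cancels.\<close>

lemma geodesic_at_iff_Flex:
  assumes U: "open U" "smooth_on U f" and \<gamma>: "regular_curve a b \<gamma>" "\<gamma> ` {a<..<b} \<subseteq> U"
    and level: "\<And>t. t \<in> {a<..<b} \<Longrightarrow> f (\<gamma> t) = c" and t: "t \<in> {a<..<b}"
    and grad: "(pd 1 f (\<gamma> t), pd 2 f (\<gamma> t)) \<noteq> (0, 0)"
    and sym: "\<And>k. \<Gamma> k 2 1 (\<gamma> t) = \<Gamma> k 1 2 (\<gamma> t)"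
  shows "(\<exists>\<mu>. velocity (velocity \<gamma>) t + christoffel \<Gamma> (\<gamma> t) (velocity \<gamma> t) (velocity \<gamma> t) = \<mu> *\<^sub>R velocity \<gamma> t)
    \<longleftrightarrow> geodesic_cubic \<Gamma> (\<gamma> t) (pd 1 f (\<gamma> t)) (pd 2 f (\<gamma> t)) = Flex f (\<gamma> t)"
proof -
  define v where "v = velocity \<gamma> t"
  define w where "w = velocity (velocity \<gamma>) t"
  define m where "m = pd 1 f (\<gamma> t)"
  define n where "n = pd 2 f (\<gamma> t)"
  have sm: "smooth_on {a<..<b} \<gamma>" and v0: "v \<noteq> 0" using \<gamma>(1) t by (auto simp: regular_curve_def v_def)
  note d = level_curve_derivatives[OF U sm \<gamma>(2) level t, folded v_def w_def m_def n_def]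
  have mn: "(m, n) \<noteq> (0, 0)" using grad by (simp add: m_def n_def)
  obtain \<mu> where mu: "v = \<mu> *\<^sub>R (\<chi> k. if k = 1 then - n else m)"
  proof -
    have "\<exists>\<mu>. v = \<mu> *\<^sub>R (\<chi> k. if k = 1 then - n else m)"
      by (rule orthogonal_plane_proportional[of _ m n, THEN iffD2])
        (use mn d(1) in \<open>auto simp: vec_eq_iff forall_2\<close>)
    with that show ?thesis by blast
  qed
  have v: "v $ 1 = - \<mu> * n" "v $ 2 = \<mu> * m" using mu by auto
  have \<mu>0: "\<mu> \<noteq> 0" using v0 mu by auto
  let ?C = "christoffel \<Gamma> (\<gamma> t) v v"
  have C: "m * ?C $ 1 + n * ?C $ 2 = \<mu>\<^sup>2 * geodesic_cubic \<Gamma> (\<gamma> t) m n"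
    unfolding christoffel_component geodesic_cubic_def sym v
    by (simp add: power2_eq_square power3_eq_cube algebra_simps)
  have W: "m * w $ 1 + n * w $ 2 = - \<mu>\<^sup>2 * Flex f (\<gamma> t)"
    using d(2) unfolding v Flex_def m_def[symmetric] n_def[symmetric]
    by (simp add: power2_eq_square algebra_simps)
  have "(\<exists>\<mu>. w + ?C = \<mu> *\<^sub>R v) \<longleftrightarrow> m * (w + ?C) $ 1 + n * (w + ?C) $ 2 = 0"
    by (rule orthogonal_plane_proportional[OF v0 mn d(1)])
  also have "\<dots> \<longleftrightarrow> (m * w $ 1 + n * w $ 2) + (m * ?C $ 1 + n * ?C $ 2) = 0"
    by (simp add: algebra_simps)
  also have "\<dots> \<longleftrightarrow> geodesic_cubic \<Gamma> (\<gamma> t) m n = Flex f (\<gamma> t)"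
    unfolding C W using \<mu>0 by (simp add: algebra_simps)
  finally show ?thesis unfolding v_def w_def m_def n_def .
qed

text \<open>Shows that \<open>geodesic_leaf\<close> is not vacuous at any point. The inverse
  function theorem straightens the level curves near p; it yields only differentiability, and
  smoothness of the curve comes from the differential equation that the curve satisfies.\<close>

lemma regular_curve_in_leaf:
  assumes U: "open U" "smooth_on U f" "p \<in> U" and grad: "(pd 1 f p, pd 2 f p) \<noteq> (0, 0)"
  obtains L \<epsilon> \<gamma> where "L \<in> leaves U f" "0 < \<epsilon>" "regular_curve (-\<epsilon>) \<epsilon> \<gamma>" "\<gamma> ` {-\<epsilon><..<\<epsilon>} \<subseteq> L" "\<gamma> 0 = p"
proof -
  define m where "m = pd 1 f p"
  define n where "n = pd 2 f p"
  \<comment> \<open>Up to sign the Jacobian determinant of the chart \<open>F\<close> below; at p it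
    is m^2 + n^2.\<close>
  define den where "den q = m * pd 1 f q + n * pd 2 f q" for q
  define U1 where "U1 = {q \<in> U. den q \<noteq> 0}"
  have den_sm: "smooth_on U den"
    unfolding den_def[abs_def] using U by (intro smooth_intros)
  have U1: "open U1"
  proof -
    have "U1 = U \<inter> den -` (- {0})" by (auto simp: U1_def)
    then show ?thesis
      using continuous_on_open_vimage[OF U(1)] smooth_on_continuous[OF den_sm]
      by (metis Int_commute open_Compl closed_singleton)
  qed
  have "m \<noteq> 0 \<or> n \<noteq> 0" using grad by (auto simp: m_def n_def)
  then have mn: "m * m + n * n \<noteq> 0" by (simp add: sum_squares_eq_zero_iff)
  then have p: "p \<in> U1" using U by (simp add: U1_def den_def m_def n_def)
  have U1U: "U1 \<subseteq> U" by (auto simp: U1_def)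
  have fd: "f differentiable (at q)" if "q \<in> U1" for q
    using that U1U smooth_on_differentiable[OF U(2)] by blast
  \<comment> \<open>Second coordinate f, first coordinate a linear function that increases along
    (-n, m), the tangent direction of the leaf at p. Horizontal lines in the image correspond to
    level curves.\<close>
  define F :: "plane \<Rightarrow> plane" where "F q = (\<chi> k. if k = 1 then m * q $ 2 - n * q $ 1 else f q)" for q
  define F' :: "plane \<Rightarrow> plane \<Rightarrow> plane" where
    "F' q v = (\<chi> k. if k = 1 then m * v $ 2 - n * v $ 1 else v $ 1 * pd 1 f q + v $ 2 * pd 2 f q)" for q v
  have dF: "(F has_derivative F' q) (at q)" if "q \<in> U1" for q
  proof -
    have "(f has_derivative (\<lambda>v. v $ 1 * pd 1 f q + v $ 2 * pd 2 f q)) (at q)"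
      using has_derivative_frechet[OF fd[OF that]] unfolding frechet_derivative_pd[OF fd[OF that]] by metis
    then have "((\<lambda>x. if k = 1 then m * x $ 2 - n * x $ 1 else f x) has_derivative
        (\<lambda>v. if k = 1 then m * v $ 2 - n * v $ 1 else v $ 1 * pd 1 f q + v $ 2 * pd 2 f q)) (at q)" for k :: 2
      by (cases "k = 1")
        (auto intro!: derivative_eq_intros bounded_linear_imp_has_derivative[OF bounded_linear_vec_nth])
    then show ?thesis
      unfolding F_def[abs_def] F'_def[abs_def]
      by (subst has_derivative_componentwise_within) (auto simp: Basis_vec_def inner_axis)
  qed
  have bl: "bounded_linear (F' q)" if "q \<in> U1" for q
    using dF[OF that] has_derivative_bounded_linear by blast
  define F'' where "F'' q = Blinfun (F' q)" for q
  have F'': "blinfun_apply (F'' q) = F' q" if "q \<in> U1" for q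
    using bl[OF that] by (simp add: F''_def bounded_linear_Blinfun_apply)
  have cont: "continuous_on U1 F''"
  proof (rule continuous_on_blinfun_componentwise)
    fix i :: plane
    have "continuous_on U1 (\<lambda>q. pd j f q)" for j
      using smooth_on_continuous[OF smooth_on_pd'[OF U(2)]] U1U continuous_on_subset by blast
    then have "continuous_on U1 (\<lambda>q. if k = 1 then m * i $ 2 - n * i $ 1 else i $ 1 * pd 1 f q + i $ 2 * pd 2 f q)"
      for k :: 2
      by (cases "k = 1") (auto intro!: continuous_intros)
    then have "continuous_on U1 (\<lambda>q. F' q i)"
      unfolding F'_def by (intro continuous_on_vec_lambda)
    then show "continuous_on U1 (\<lambda>q. blinfun_apply (F'' q) i)"
      by (rule continuous_on_eq) (simp add: F'')
  qed
  have "inj (F' p)"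
    unfolding linear_injective_0[OF bounded_linear.linear[OF bl[OF p]]]
  proof (intro allI impI)
    fix v assume "F' p v = 0"
    then have "m * v $ 2 - n * v $ 1 = 0" "v $ 1 * m + v $ 2 * n = 0"
      by (auto simp: F'_def vec_eq_iff forall_2 m_def n_def)
    then have "(m * m + n * n) * v $ 1 = 0" "(m * m + n * n) * v $ 2 = 0" by algebra+
    then show "v = 0" using mn by (auto simp: vec_eq_iff forall_2)
  qed
  then obtain G where G: "linear G" "G \<circ> F' p = id"
    using linear_injective_left_inverse[OF bounded_linear.linear[OF bl[OF p]]] by blast
  have inv: "Blinfun G o\<^sub>L F'' p = id_blinfun"
  proof (rule blinfun_eqI)
    fix i
    have "blinfun_apply (Blinfun G) = G"
      using G(1) by (simp add: bounded_linear_Blinfun_apply linear_conv_bounded_linear)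
    then show "blinfun_apply (Blinfun G o\<^sub>L F'' p) i = blinfun_apply id_blinfun i"
      using G(2) by (simp add: F''[OF p] pointfree_idE)
  qed
  obtain U' V g g' where inv: "open U'" "U' \<subseteq> U1" "p \<in> U'" "open V" "F p \<in> V" "homeomorphism U' V F g"
    "\<And>y. y \<in> V \<Longrightarrow> (g has_derivative (g' y)) (at y)"
    using inverse_function_theorem[OF U1 _ cont p inv, of F] dF F'' by (metis (no_types, lifting))
  obtain \<epsilon> where \<epsilon>: "0 < \<epsilon>" "ball (F p) \<epsilon> \<subseteq> V"
    using inv(4,5) open_contains_ball by blast
  define I where "I = {-\<epsilon><..<\<epsilon>}"
  define \<gamma> where "\<gamma> t = g (F p + t *\<^sub>R axis 1 1)" for t
  have inV: "F p + t *\<^sub>R axis 1 1 \<in> V" if "t \<in> I" for t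
    using that \<epsilon> by (intro subsetD[OF \<epsilon>(2)]) (auto simp: I_def dist_norm)
  have \<gamma>U: "\<gamma> t \<in> U1" and F\<gamma>: "F (\<gamma> t) = F p + t *\<^sub>R axis 1 1" if "t \<in> I" for t
    using inv(2,6) inV[OF that] unfolding homeomorphism_def \<gamma>_def by auto
  have f\<gamma>: "f (\<gamma> t) = f p" if "t \<in> I" for t
    using arg_cong[OF F\<gamma>[OF that], of "\<lambda>v. v $ 2"] by (simp add: F_def axis_def)
  \<comment> \<open>The vector field tangent to the level curves along which the first coordinate of
    \<open>F\<close> grows at unit speed.\<close>
  define \<Phi> :: "plane \<Rightarrow> plane" where "\<Phi> q = (\<chi> k. if k = 1 then - pd 2 f q / den q else pd 1 f q / den q)" for q
  have d\<gamma>: "(\<gamma> has_vector_derivative \<Phi> (\<gamma> t)) (at t)" if "t \<in> I" for t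
  proof -
    define u where "u = g' (F p + t *\<^sub>R axis 1 1) (axis 1 1)"
    have lin: "linear (g' (F p + t *\<^sub>R axis 1 1))"
      using inv(7)[OF inV[OF that]] has_derivative_linear by blast
    have "(\<gamma> has_derivative (\<lambda>r. g' (F p + t *\<^sub>R axis 1 1) (r *\<^sub>R axis 1 1))) (at t)"
      unfolding \<gamma>_def[abs_def]
      by (rule has_derivative_compose[where f="\<lambda>t. F p + t *\<^sub>R axis 1 1" and g=g, OF _ inv(7)[OF inV[OF that]]])
        (auto intro!: derivative_eq_intros)
    then have u: "(\<gamma> has_vector_derivative u) (at t)"
      by (simp add: has_vector_derivative_def u_def linear_cmul[OF lin])
    have op: "open I" by (simp add: I_def)
    have "((\<lambda>t. F (\<gamma> t)) has_derivative (\<lambda>r. F' (\<gamma> t) (r *\<^sub>R u))) (at t)"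
      using has_derivative_compose[OF u[unfolded has_vector_derivative_def] dF[OF \<gamma>U[OF that]]] .
    then have "((\<lambda>t. F p + t *\<^sub>R axis 1 1) has_derivative (\<lambda>r. F' (\<gamma> t) (r *\<^sub>R u))) (at t)"
      using has_derivative_cong_open[OF op that, of "\<lambda>t. F (\<gamma> t)" "\<lambda>t. F p + t *\<^sub>R axis 1 1"] F\<gamma> by blast
    moreover have "((\<lambda>t. F p + t *\<^sub>R axis 1 1) has_derivative (\<lambda>r. r *\<^sub>R axis 1 1)) (at t)"
      by (auto intro!: derivative_eq_intros)
    ultimately have "(\<lambda>r. F' (\<gamma> t) (r *\<^sub>R u)) = (\<lambda>r. r *\<^sub>R axis 1 1)"
      by (rule has_derivative_unique)
    from fun_cong[OF this, of 1] have "F' (\<gamma> t) u = axis 1 1" by simp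
    then have e: "m * u $ 2 - n * u $ 1 = 1" "u $ 1 * pd 1 f (\<gamma> t) + u $ 2 * pd 2 f (\<gamma> t) = 0"
      by (auto simp: F'_def axis_def vec_eq_iff forall_2)
    have "u $ 1 * den (\<gamma> t) = - pd 2 f (\<gamma> t)" "u $ 2 * den (\<gamma> t) = pd 1 f (\<gamma> t)"
      unfolding den_def using e by algebra+
    then have "u = \<Phi> (\<gamma> t)"
      using \<gamma>U[OF that] by (simp add: vec_eq_iff forall_2 \<Phi>_def U1_def field_simps)
    with u show ?thesis by simp
  qed
  have \<Phi>: "smooth_on U1 \<Phi>"
  proof -
    have "smooth_on U1 f" "smooth_on U1 den" using U den_sm U1U smooth_on_subset by blast+
    then have "smooth_on U1 (\<lambda>q. if k = 1 then - pd 2 f q / den q else pd 1 f q / den q)" for k :: 2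
      using U1 by (cases "k = 1") (auto intro!: smooth_intros simp: U1_def)
    then show ?thesis unfolding \<Phi>_def[abs_def] by (intro smooth_intros U1)
  qed
  \<comment> \<open>Bootstrapping through \<gamma>' = \<Phi>(\<gamma>): since \<Phi> is smooth, each
    class C^n of \<gamma> improves to the next.\<close>
  have "C_on n I \<gamma>" for n
  proof (induction n)
    case 0
    have "continuous (at t) \<gamma>" if "t \<in> I" for t
      using d\<gamma>[OF that] has_vector_derivative_continuous by blast
    then show ?case by (auto intro: continuous_at_imp_continuous_on)
  next
    case (Suc n)
    have "C_on n I (\<lambda>t. \<Phi> (\<gamma> t))"
      using \<gamma>U \<Phi> U1 by (intro C_on_compose[OF _ U1 Suc]) (auto simp: I_def smooth_on_def)
    then show ?case
      by (intro C_on_SucI[OF _ d\<gamma>[unfolded has_vector_derivative_def]] C_on_bilinear[OF bounded_bilinear_scaleR] C_on_const)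
        (auto simp: I_def)
  qed
  then have sm: "smooth_on I \<gamma>" by (simp add: smooth_on_def)
  have "velocity \<gamma> t \<noteq> 0" if "t \<in> I" for t
  proof
    assume "velocity \<gamma> t = 0"
    then have "\<Phi> (\<gamma> t) = 0"
      using vector_derivative_at[OF d\<gamma>[OF that]] by (simp add: velocity_def)
    then have "den (\<gamma> t) = 0"
      using \<gamma>U[OF that] by (auto simp: \<Phi>_def den_def vec_eq_iff forall_2 U1_def)
    then show False using \<gamma>U[OF that] by (simp add: U1_def)
  qed
  with sm \<epsilon>(1) have reg: "regular_curve (-\<epsilon>) \<epsilon> \<gamma>" by (simp add: regular_curve_def I_def)
  have \<gamma>0: "\<gamma> 0 = p" using inv(3,6) by (simp add: \<gamma>_def homeomorphism_def)
  define L where "L = connected_component_set {q \<in> U. f q = f p} p"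
  have "L \<in> components {q \<in> U. f q = f p}"
    unfolding L_def using U(3) by (intro componentsI) auto
  then have "L \<in> leaves U f" by (auto simp: leaves_def)
  moreover have "\<gamma> ` I \<subseteq> L"
    unfolding L_def
  proof (rule connected_component_maximal)
    show "p \<in> \<gamma> ` I" using \<gamma>0 \<epsilon>(1) by (intro image_eqI[of _ _ 0]) (auto simp: I_def)
    show "connected (\<gamma> ` I)"
      using smooth_on_continuous[OF sm] by (intro connected_continuous_image) (auto simp: I_def)
    show "\<gamma> ` I \<subseteq> {q \<in> U. f q = f p}" using \<gamma>U f\<gamma> U1U by auto
  qed
  ultimately show ?thesis using that reg \<gamma>0 \<epsilon>(1) by (auto simp: I_def)
qed

lemma leaf_subset: "L \<in> leaves U f \<Longrightarrow> L \<subseteq> U"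
  unfolding leaves_def using in_components_subset by fastforce

lemma leaf_level: "L \<in> leaves U f \<Longrightarrow> \<exists>c. \<forall>q\<in>L. f q = c"
  unfolding leaves_def using in_components_subset by fastforce

text \<open>\<open>regular_curve_in_leaf\<close> puts a test curve through every point, which turns
  the statement about curves into a pointwise identity on \<open>U\<close>; conversely every curve
  inside a leaf is a level curve.\<close>

theorem geodesic_leaves_iff_Flex:
  assumes U: "open U" "smooth_on U f" and grad: "\<And>p. p \<in> U \<Longrightarrow> (pd 1 f p, pd 2 f p) \<noteq> (0, 0)"
    and sym: "\<And>p k. p \<in> U \<Longrightarrow> \<Gamma> k 2 1 p = \<Gamma> k 1 2 p"
  shows "(\<forall>L\<in>leaves U f. geodesic_leaf \<Gamma> L)
    \<longleftrightarrow> (\<forall>p\<in>U. geodesic_cubic \<Gamma> p (pd 1 f p) (pd 2 f p) = Flex f p)"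
proof safe
  fix p assume L: "\<forall>L\<in>leaves U f. geodesic_leaf \<Gamma> L" and p: "p \<in> U"
  obtain L \<epsilon> \<gamma> where c: "L \<in> leaves U f" "0 < \<epsilon>" "regular_curve (-\<epsilon>) \<epsilon> \<gamma>" "\<gamma> ` {-\<epsilon><..<\<epsilon>} \<subseteq> L" "\<gamma> 0 = p"
    using regular_curve_in_leaf[OF U p grad[OF p]] .
  obtain k where k: "\<forall>q\<in>L. f q = k" using leaf_level[OF c(1)] by blast
  have "unparam_geodesic \<Gamma> (-\<epsilon>) \<epsilon> \<gamma>" using L c by (simp add: geodesic_leaf_def)
  then show "geodesic_cubic \<Gamma> p (pd 1 f p) (pd 2 f p) = Flex f p"
    using geodesic_at_iff_Flex[OF U c(3) subset_trans[OF c(4) leaf_subset[OF c(1)]], of k 0 \<Gamma>]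
      c k grad[OF p] sym[OF p]
    by (auto simp: unparam_geodesic_def image_subset_iff)
next
  fix L assume F: "\<forall>p\<in>U. geodesic_cubic \<Gamma> p (pd 1 f p) (pd 2 f p) = Flex f p" and L: "L \<in> leaves U f"
  obtain k where k: "\<forall>q\<in>L. f q = k" using leaf_level[OF L] by blast
  show "geodesic_leaf \<Gamma> L"
    unfolding geodesic_leaf_def unparam_geodesic_def
  proof (intro allI impI ballI)
    fix a b \<gamma> t assume \<gamma>: "regular_curve a b \<gamma>" "\<gamma> ` {a<..<b} \<subseteq> L" "t \<in> {a<..<b}"
    then have sub: "\<gamma> t \<in> U" "\<gamma> ` {a<..<b} \<subseteq> U" using leaf_subset[OF L]
      by (auto simp: image_subset_iff subset_iff)
    show "\<exists>\<mu>. velocity (velocity \<gamma>) t + christoffel \<Gamma> (\<gamma> t) (velocity \<gamma> t) (velocity \<gamma> t) = \<mu> *\<^sub>R velocity \<gamma> t"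
      using geodesic_at_iff_Flex[OF U \<gamma>(1) sub(2), of k t \<Gamma>] \<gamma>(2,3) k F sub(1) grad[OF sub(1)] sym[OF sub(1)]
      by (auto simp: image_subset_iff)
  qed
qed

section \<open>Geodesic webs and interpolation\<close>

lemma torsion_free_smooth: "torsion_free_connection U \<Gamma> \<Longrightarrow> smooth_on U (\<Gamma> k i j)"
  by (simp add: torsion_free_connection_def)

lemma cov_const: "cov \<Gamma> (\<lambda>_. u) (\<lambda>_. v) p = christoffel \<Gamma> p u v"
  by (simp add: cov_def)

lemma christoffel_axis: "christoffel \<Gamma> p (axis i 1) (axis j 1) $ k = \<Gamma> k i j p"
  using exhaust_2[of i] exhaust_2[of j] by (auto simp: christoffel_component axis_def)

lemma torsion_free_symmetric:
  assumes "torsion_free_connection U \<Gamma>" "p \<in> U"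
  shows "\<Gamma> k i j p = \<Gamma> k j i p"
proof -
  have "cov \<Gamma> (\<lambda>_. axis i 1) (\<lambda>_. axis j 1) p - cov \<Gamma> (\<lambda>_. axis j 1) (\<lambda>_. axis i 1) p
      = lie_bracket (\<lambda>_. axis i 1) (\<lambda>_. axis j 1) p"
    using assms by (simp add: torsion_free_connection_def smooth_on_const)
  then have "christoffel \<Gamma> p (axis i 1) (axis j 1) $ k = christoffel \<Gamma> p (axis j 1) (axis i 1) $ k"
    by (simp add: cov_const lie_bracket_def)
  then show ?thesis by (simp add: christoffel_axis)
qed

lemma torsion_freeI:
  assumes "\<And>k i j. smooth_on U (\<Gamma> k i j)" "\<And>k p. p \<in> U \<Longrightarrow> \<Gamma> k 2 1 p = \<Gamma> k 1 2 p"
  shows "torsion_free_connection U \<Gamma>"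
  unfolding torsion_free_connection_def
proof (intro conjI allI impI ballI)
  fix X Y :: vfield and p assume p: "p \<in> U"
  show "cov \<Gamma> X Y p - cov \<Gamma> Y X p = lie_bracket X Y p"
    by (simp add: cov_def lie_bracket_def vec_eq_iff christoffel_component assms(2)[OF p])
qed (rule assms(1))

lemma planar_web_smooth: "planar_web d U f \<Longrightarrow> i \<in> {1..d} \<Longrightarrow> smooth_on U (f i)"
  by (simp add: planar_web_def)

lemma planar_web_open: "planar_web d U f \<Longrightarrow> open U"
  by (simp add: planar_web_def)

lemma planar_web_jac:
  "planar_web d U f \<Longrightarrow> i \<in> {1..d} \<Longrightarrow> j \<in> {1..d} \<Longrightarrow> i \<noteq> j \<Longrightarrow> p \<in> U \<Longrightarrow> jac (f i) (f j) p \<noteq> 0"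
  by (simp add: planar_web_def)

lemma planar_web_subset: "planar_web d U f \<Longrightarrow> open V \<Longrightarrow> V \<subseteq> U \<Longrightarrow> planar_web d V f"
  unfolding planar_web_def by (auto intro: smooth_on_subset)

lemma planar_web_grad:
  assumes "planar_web d U f" "2 \<le> d" "i \<in> {1..d}" "p \<in> U"
  shows "(pd 1 (f i) p, pd 2 (f i) p) \<noteq> (0, 0)"
proof -
  obtain j where "j \<in> {1..d}" "i \<noteq> j"
    using assms(2) by (cases "i = 1") (auto intro: that[of 1] that[of 2])
  then have "jac (f i) (f j) p \<noteq> 0" using assms by (intro planar_web_jac)
  then show ?thesis by (auto simp: jac_def)
qed

lemma web_leaves_geodesic_iff:
  assumes "planar_web d U f" "2 \<le> d" and sym: "\<And>p k. p \<in> U \<Longrightarrow> \<Gamma> k 2 1 p = \<Gamma> k 1 2 p"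
  shows "(\<forall>L\<in>web_leaves d U f. geodesic_leaf \<Gamma> L)
    \<longleftrightarrow> (\<forall>i\<in>{1..d}. \<forall>p\<in>U. geodesic_cubic \<Gamma> p (pd 1 (f i) p) (pd 2 (f i) p) = Flex (f i) p)"
proof -
  have "(\<forall>L\<in>leaves U (f i). geodesic_leaf \<Gamma> L)
      \<longleftrightarrow> (\<forall>p\<in>U. geodesic_cubic \<Gamma> p (pd 1 (f i) p) (pd 2 (f i) p) = Flex (f i) p)"
    if "i \<in> {1..d}" for i
    using that by (intro geodesic_leaves_iff_Flex planar_web_open[OF assms(1)]
        planar_web_smooth[OF assms(1)] planar_web_grad[OF assms(1,2)] sym)
  then show ?thesis by (auto simp: web_leaves_def)
qed

lemma smooth_on_Flex [smooth_intros]: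
  "open U \<Longrightarrow> smooth_on U f \<Longrightarrow> smooth_on U (\<lambda>p. Flex f p)"
  unfolding Flex_def by (intro smooth_intros)

lemma smooth_on_jac [smooth_intros]:
  "open U \<Longrightarrow> smooth_on U f \<Longrightarrow> smooth_on U g \<Longrightarrow> smooth_on U (\<lambda>p. jac f g p)"
  unfolding jac_def by (intro smooth_intros)

lemma smooth_on_Pi:
  assumes web: "planar_web d U f" and "4 \<le> d"
  shows "smooth_on U (Pi_1_22 f)" "smooth_on U (Pi_2_11 f)" "smooth_on U (Pi_1_12 f)" "smooth_on U (Pi_2_12 f)"
proof -
  have U: "open U" and sm: "\<And>i. i \<in> {1..4} \<Longrightarrow> smooth_on U (f i)"
    using web \<open>4 \<le> d\<close> by (auto simp: planar_web_def)
  have nz: "(\<Prod>k\<in>{1..4} - {i}. jac (f i) (f k) p) \<noteq> 0" if "i \<in> {1..4}" "p \<in> U" for i p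
  proof -
    have "jac (f i) (f k) p \<noteq> 0" if "k \<in> {1..4} - {i}" for k
      using that \<open>i \<in> {1..4}\<close> \<open>p \<in> U\<close> \<open>4 \<le> d\<close> by (intro planar_web_jac[OF web]) auto
    then show ?thesis by (simp only: prod_zero_iff finite_Diff finite_atLeastAtMost) blast
  qed
  show "smooth_on U (Pi_1_22 f)" "smooth_on U (Pi_2_11 f)" "smooth_on U (Pi_1_12 f)" "smooth_on U (Pi_2_12 f)"
    unfolding Pi_1_22_def[abs_def] Pi_2_11_def[abs_def] Pi_1_12_def[abs_def] Pi_2_12_def[abs_def]
    by (intro smooth_intros U sm nz; auto)+
qed

text \<open>Lagrange interpolation of a binary cubic form at the four points \<open>(f\<^sub>i\<^sub>,\<^sub>1, f\<^sub>i\<^sub>,\<^sub>2)\<close>.\<close>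

definition interpolation_cubic :: "(nat \<Rightarrow> plane \<Rightarrow> real) \<Rightarrow> plane \<Rightarrow> real \<Rightarrow> real \<Rightarrow> real" where
  "interpolation_cubic f p \<xi> \<eta> =
     (\<Sum>i\<in>{1..4}. (\<Prod>k\<in>{1..4}-{i}. (\<xi> * pd 2 (f k) p - \<eta> * pd 1 (f k) p) / jac (f i) (f k) p) * Flex (f i) p)"

lemma prod_three_linear_forms:
  fixes a b :: "'i \<Rightarrow> real"
  assumes "card K = 3"
  shows "(\<Prod>k\<in>K. \<xi> * b k - \<eta> * a k) = prod b K * \<xi>^3 - (\<Sum>k\<in>K. a k * prod b (K - {k})) * (\<xi>\<^sup>2 * \<eta>)
    + (\<Sum>k\<in>K. b k * prod a (K - {k})) * (\<xi> * \<eta>\<^sup>2) - prod a K * \<eta>^3"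
proof -
  obtain k l m where "K = {k, l, m}" "k \<noteq> l" "k \<noteq> m" "l \<noteq> m"
    using assms unfolding card_3_iff by blast
  moreover from this have "K - {k} = {l, m}" "K - {l} = {k, m}" "K - {m} = {k, l}" by auto
  ultimately show ?thesis
    by (simp add: power2_eq_square power3_eq_cube algebra_simps)
qed

text \<open>Identifies the sums defining the \<open>Pi\<close> functions as the coefficients of the
  Lagrange interpolant, so that \<open>flex_condition\<close> asks for the interpolant to take the
  value Flex g at the gradient of g.\<close>

lemma interpolation_cubic_Pi:
  "Pi_1_22 f p * \<xi>^3 - 3 * Pi_1_12 f p * \<xi>\<^sup>2 * \<eta> - 3 * Pi_2_12 f p * \<xi> * \<eta>\<^sup>2 + Pi_2_11 f p * \<eta>^3
    = interpolation_cubic f p \<xi> \<eta>"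
proof -
  let ?a = "\<lambda>k. pd 1 (f k) p" and ?b = "\<lambda>k. pd 2 (f k) p" and ?K = "\<lambda>i. {1..4::nat} - {i}"
  define w where "w i = Flex (f i) p / (\<Prod>k\<in>?K i. jac (f i) (f k) p)" for i
  have K: "{1..4} - {i,k} = ?K i - {k}" for i k by auto
  have "interpolation_cubic f p \<xi> \<eta> = (\<Sum>i\<in>{1..4}. w i * (\<Prod>k\<in>?K i. \<xi> * ?b k - \<eta> * ?a k))"
    unfolding interpolation_cubic_def w_def by (simp add: prod_dividef mult.commute)
  also have "\<dots> = (\<Sum>i\<in>{1..4}. w i * prod ?b (?K i) * \<xi>^3
      - w i * (\<Sum>k\<in>?K i. ?a k * prod ?b (?K i - {k})) * (\<xi>\<^sup>2 * \<eta>)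
      + w i * (\<Sum>k\<in>?K i. ?b k * prod ?a (?K i - {k})) * (\<xi> * \<eta>\<^sup>2) - w i * prod ?a (?K i) * \<eta>^3)"
  proof (rule sum.cong[OF refl])
    fix i :: nat assume "i \<in> {1..4}"
    then have c: "card (?K i) = 3" by simp
    show "w i * (\<Prod>k\<in>?K i. \<xi> * ?b k - \<eta> * ?a k) = w i * prod ?b (?K i) * \<xi>^3
      - w i * (\<Sum>k\<in>?K i. ?a k * prod ?b (?K i - {k})) * (\<xi>\<^sup>2 * \<eta>)
      + w i * (\<Sum>k\<in>?K i. ?b k * prod ?a (?K i - {k})) * (\<xi> * \<eta>\<^sup>2) - w i * prod ?a (?K i) * \<eta>^3"
      unfolding prod_three_linear_forms[OF c] by (simp only: ring_distribs mult.assoc)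
  qed
  also have "\<dots> = (\<Sum>i\<in>{1..4}. w i * prod ?b (?K i)) * \<xi>^3
      - (\<Sum>i\<in>{1..4}. w i * (\<Sum>k\<in>?K i. ?a k * prod ?b (?K i - {k}))) * (\<xi>\<^sup>2 * \<eta>)
      + (\<Sum>i\<in>{1..4}. w i * (\<Sum>k\<in>?K i. ?b k * prod ?a (?K i - {k}))) * (\<xi> * \<eta>\<^sup>2)
      - (\<Sum>i\<in>{1..4}. w i * prod ?a (?K i)) * \<eta>^3"
    by (simp only: sum.distrib sum_subtractf sum_distrib_right)
  also have "(\<Sum>i\<in>{1..4}. w i * prod ?b (?K i)) = Pi_1_22 f p"
    unfolding Pi_1_22_def w_def by (simp add: mult.commute)
  also have "(\<Sum>i\<in>{1..4}. w i * prod ?a (?K i)) = - Pi_2_11 f p"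
    unfolding Pi_2_11_def w_def by (simp add: mult.commute)
  also have "(\<Sum>i\<in>{1..4}. w i * (\<Sum>k\<in>?K i. ?a k * prod ?b (?K i - {k}))) = 3 * Pi_1_12 f p"
    unfolding Pi_1_12_def w_def K by (simp add: mult.commute)
  also have "(\<Sum>i\<in>{1..4}. w i * (\<Sum>k\<in>?K i. ?b k * prod ?a (?K i - {k}))) = - 3 * Pi_2_12 f p"
    unfolding Pi_2_12_def w_def K by (simp add: mult.commute)
  finally show ?thesis by simp
qed

text \<open>At the j-th node every summand with i different from j contains the vanishing factor k =
  j, and in the summand i = j each numerator equals its Jacobian.\<close>

lemma interpolation_cubic_node:
  assumes "\<And>k. k \<in> {1..4} - {j} \<Longrightarrow> jac (f j) (f k) p \<noteq> 0" "j \<in> {1..4}"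
  shows "interpolation_cubic f p (pd 1 (f j) p) (pd 2 (f j) p) = Flex (f j) p"
proof -
  define P where "P i = (\<Prod>k\<in>{1..4}-{i}. (pd 1 (f j) p * pd 2 (f k) p - pd 2 (f j) p * pd 1 (f k) p) / jac (f i) (f k) p)"
    for i
  have j: "P j = 1"
    unfolding P_def using assms(1) by (intro prod.neutral) (auto simp: jac_def)
  have "P i = 0" if "i \<noteq> j" for i
    unfolding P_def using that assms(2) by (intro prod_zero) (auto intro!: bexI[of _ j])
  then have "(\<Sum>i\<in>{1..4}. P i * Flex (f i) p) = (\<Sum>i\<in>{1..4}. if i = j then Flex (f j) p else 0)"
    by (intro sum.cong) (auto simp: j)
  also have "\<dots> = Flex (f j) p" using assms(2) by (subst sum.delta) auto
  finally show ?thesis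
    by (simp only: interpolation_cubic_def P_def)
qed

text \<open>A nonzero binary cubic has at most three zeros on the projective line. In the basis of
  the first two zeros only the two middle coefficients are left, and the other two zeros give a
  regular 2 by 2 system for them.\<close>

lemma binary_cubic_unique:
  fixes x y :: "nat \<Rightarrow> real"
  assumes "\<And>i k. i \<in> {1..4} \<Longrightarrow> k \<in> {1..4} \<Longrightarrow> i < k \<Longrightarrow> x i * y k - y i * x k \<noteq> 0"
    and "\<And>i. i \<in> {1..4} \<Longrightarrow> a * x i^3 + b * (x i)\<^sup>2 * y i + c * x i * (y i)\<^sup>2 + e * y i^3 = 0"
  shows "a = 0" "b = 0" "c = 0" "e = 0"
proof -
  define q where "q \<xi> \<eta> = a * \<xi>^3 + b * \<xi>\<^sup>2 * \<eta> + c * \<xi> * \<eta>\<^sup>2 + e * \<eta>^3" for \<xi> \<eta>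
  have q0: "q (x i) (y i) = 0" if "i \<in> {1..4}" for i using assms(2)[OF that] by (simp add: q_def)
  define S where "S \<xi> \<eta> = \<xi> * y 2 - \<eta> * x 2" for \<xi> \<eta>
  define T where "T \<xi> \<eta> = x 1 * \<eta> - y 1 * \<xi>" for \<xi> \<eta>
  define D where "D = x 1 * y 2 - y 1 * x 2"
  \<comment> \<open>The middle coefficients of \<open>q\<close> in the new basis: the derivative of
    \<open>q\<close> at the first point in the direction of the second, and for \<open>C\<close> the
    other way round.\<close>
  define B where "B = 3 * a * (x 1)\<^sup>2 * x 2 + b * ((x 1)\<^sup>2 * y 2 + 2 * x 1 * y 1 * x 2)
    + c * (2 * x 1 * y 1 * y 2 + (y 1)\<^sup>2 * x 2) + 3 * e * (y 1)\<^sup>2 * y 2"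
  define C where "C = 3 * a * (x 2)\<^sup>2 * x 1 + b * ((x 2)\<^sup>2 * y 1 + 2 * x 2 * y 2 * x 1)
    + c * (2 * x 2 * y 2 * y 1 + (y 2)\<^sup>2 * x 1) + 3 * e * (y 2)\<^sup>2 * y 1"
  have D0: "D \<noteq> 0" using assms(1)[of 1 2] by (simp add: D_def)
  \<comment> \<open>the coordinates of \<open>(\<xi>, \<eta>)\<close> in the basis of the first two points are \<open>S / D\<close> and \<open>T / D\<close>\<close>
  have id: "D^3 * q \<xi> \<eta> = S \<xi> \<eta> * T \<xi> \<eta> * (B * S \<xi> \<eta> + C * T \<xi> \<eta>)" for \<xi> \<eta>
  proof -
    have "D^3 * q \<xi> \<eta> = S \<xi> \<eta>^3 * q (x 1) (y 1) + T \<xi> \<eta>^3 * q (x 2) (y 2)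
        + S \<xi> \<eta> * T \<xi> \<eta> * (B * S \<xi> \<eta> + C * T \<xi> \<eta>)"
      unfolding q_def S_def T_def D_def B_def C_def by algebra
    then show ?thesis by (simp add: q0)
  qed
  have BC: "B * S (x i) (y i) + C * T (x i) (y i) = 0" if "i \<in> {3,4}" for i
  proof -
    have "S (x i) (y i) \<noteq> 0" "T (x i) (y i) \<noteq> 0"
      using that assms(1)[of 2 i] assms(1)[of 1 i] by (auto simp: S_def T_def mult.commute)
    moreover have "q (x i) (y i) = 0" using that by (auto intro!: q0)
    ultimately show ?thesis using id[of "x i" "y i"] by simp
  qed
  have "S (x 3) (y 3) * T (x 4) (y 4) - S (x 4) (y 4) * T (x 3) (y 3) = D * (x 3 * y 4 - y 3 * x 4)"
    unfolding S_def T_def D_def by algebra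
  moreover have "x 3 * y 4 - y 3 * x 4 \<noteq> 0" using assms(1)[of 3 4] by simp
  ultimately have d: "S (x 3) (y 3) * T (x 4) (y 4) - S (x 4) (y 4) * T (x 3) (y 3) \<noteq> 0" using D0 by simp
  have "B * (S (x 3) (y 3) * T (x 4) (y 4) - S (x 4) (y 4) * T (x 3) (y 3)) = 0"
    "C * (S (x 3) (y 3) * T (x 4) (y 4) - S (x 4) (y 4) * T (x 3) (y 3)) = 0"
    using BC[of 3] BC[of 4] by simp_all algebra+
  then have "B = 0" "C = 0" using d by auto
  then have "q \<xi> \<eta> = 0" for \<xi> \<eta> using id[of \<xi> \<eta>] D0 by simp
  then have "q 1 0 = 0" "q 0 1 = 0" "q 1 1 = 0" "q 1 (-1) = 0" by auto
  then show "a = 0" "b = 0" "c = 0" "e = 0" by (auto simp: q_def)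
qed

text \<open>The cubic of the connection and the interpolant agree at four pairwise independent
  gradients, hence coefficientwise. The first four foliations thus determine the projective
  structure.\<close>

lemma geodesic_cubic_eq_Pi:
  assumes web: "planar_web d U f" and "4 \<le> d" and p: "p \<in> U"
    and nodes: "\<And>i. i \<in> {1..4} \<Longrightarrow> geodesic_cubic \<Gamma> p (pd 1 (f i) p) (pd 2 (f i) p) = Flex (f i) p"
  shows "\<Gamma> 1 2 2 p = Pi_1_22 f p" "\<Gamma> 2 2 2 p - 2 * \<Gamma> 1 1 2 p = - 3 * Pi_1_12 f p"
    "\<Gamma> 1 1 1 p - 2 * \<Gamma> 2 1 2 p = - 3 * Pi_2_12 f p" "\<Gamma> 2 1 1 p = Pi_2_11 f p"
proof -
  have jac: "jac (f i) (f k) p \<noteq> 0" if "i \<in> {1..4}" "k \<in> {1..4}" "i \<noteq> k" for i k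
    using that \<open>4 \<le> d\<close> by (intro planar_web_jac[OF web _ _ _ p]) auto
  let ?a = "\<Gamma> 1 2 2 p - Pi_1_22 f p" and ?b = "\<Gamma> 2 2 2 p - 2 * \<Gamma> 1 1 2 p + 3 * Pi_1_12 f p"
  let ?c = "\<Gamma> 1 1 1 p - 2 * \<Gamma> 2 1 2 p + 3 * Pi_2_12 f p" and ?e = "\<Gamma> 2 1 1 p - Pi_2_11 f p"
  have j: "pd 1 (f i) p * pd 2 (f k) p - pd 2 (f i) p * pd 1 (f k) p \<noteq> 0"
    if "i \<in> {1..4}" "k \<in> {1..4}" "i < k" for i k
    using jac[OF that(1,2)] that(3) by (simp add: jac_def)
  have z: "?a * pd 1 (f i) p^3 + ?b * (pd 1 (f i) p)\<^sup>2 * pd 2 (f i) p + ?c * pd 1 (f i) p * (pd 2 (f i) p)\<^sup>2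
      + ?e * pd 2 (f i) p^3 = 0" if "i \<in> {1..4}" for i
  proof -
    have "interpolation_cubic f p (pd 1 (f i) p) (pd 2 (f i) p) = Flex (f i) p"
      using that by (intro interpolation_cubic_node jac) auto
    then show ?thesis
      using nodes[OF that] unfolding interpolation_cubic_Pi[symmetric] geodesic_cubic_def
      by (simp add: algebra_simps)
  qed
  note u = binary_cubic_unique[of "\<lambda>i. pd 1 (f i) p" "\<lambda>i. pd 2 (f i) p" ?a ?b ?c ?e, OF j z]
  show "\<Gamma> 1 2 2 p = Pi_1_22 f p" "\<Gamma> 2 2 2 p - 2 * \<Gamma> 1 1 2 p = - 3 * Pi_1_12 f p"
    "\<Gamma> 1 1 1 p - 2 * \<Gamma> 2 1 2 p = - 3 * Pi_2_12 f p" "\<Gamma> 2 1 1 p = Pi_2_11 f p"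
    using u by auto
qed

lemma flex_condition_iff_geodesic_cubic:
  assumes "\<Gamma> 1 2 2 p = Pi_1_22 f p" "\<Gamma> 2 2 2 p - 2 * \<Gamma> 1 1 2 p = - 3 * Pi_1_12 f p"
    "\<Gamma> 1 1 1 p - 2 * \<Gamma> 2 1 2 p = - 3 * Pi_2_12 f p" "\<Gamma> 2 1 1 p = Pi_2_11 f p"
  shows "flex_condition f g p \<longleftrightarrow> geodesic_cubic \<Gamma> p (pd 1 g p) (pd 2 g p) = Flex g p"
  unfolding geodesic_cubic_def flex_condition_def assms by simp

text \<open>For the indices 1 to 4 the condition holds automatically, because these functions are
  the interpolation nodes; only the remaining d - 4 carry information.\<close>

lemma geodesic_cubic_all_iff_flex_condition:
  assumes web: "planar_web d U f" and "4 \<le> d" and p: "p \<in> U"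
    and \<Gamma>: "\<Gamma> 1 2 2 p = Pi_1_22 f p" "\<Gamma> 2 2 2 p - 2 * \<Gamma> 1 1 2 p = - 3 * Pi_1_12 f p"
    "\<Gamma> 1 1 1 p - 2 * \<Gamma> 2 1 2 p = - 3 * Pi_2_12 f p" "\<Gamma> 2 1 1 p = Pi_2_11 f p"
  shows "(\<forall>i\<in>{1..d}. geodesic_cubic \<Gamma> p (pd 1 (f i) p) (pd 2 (f i) p) = Flex (f i) p)
    \<longleftrightarrow> (\<forall>i\<in>{5..d}. flex_condition f (f i) p)"
proof -
  have "flex_condition f (f i) p" if "i \<in> {1..4}" for i
  proof -
    have "interpolation_cubic f p (pd 1 (f i) p) (pd 2 (f i) p) = Flex (f i) p"
      using that \<open>4 \<le> d\<close> by (intro interpolation_cubic_node planar_web_jac[OF web _ _ _ p]) auto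
    then show ?thesis
      unfolding interpolation_cubic_Pi[symmetric] flex_condition_def .
  qed
  moreover have "{1..d} = {1..4} \<union> {5..d}" using \<open>4 \<le> d\<close> by auto
  ultimately have "(\<forall>i\<in>{1..d}. flex_condition f (f i) p) \<longleftrightarrow> (\<forall>i\<in>{5..d}. flex_condition f (f i) p)"
    by (metis Un_iff)
  then show ?thesis using flex_condition_iff_geodesic_cubic[of \<Gamma> p f, OF \<Gamma>] by simp
qed

theorem geodesic_web_iff:
  assumes d: "4 \<le> d" and web: "planar_web d U f"
  shows "geodesic_web d U f \<longleftrightarrow> (\<forall>i\<in>{5..d}. \<forall>p\<in>U. flex_condition f (f i) p)"
proof
  assume "geodesic_web d U f"
  then obtain \<Gamma> where \<Gamma>: "torsion_free_connection U \<Gamma>" "\<forall>L\<in>web_leaves d U f. geodesic_leaf \<Gamma> L"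
    by (auto simp: geodesic_web_def)
  have g: "geodesic_cubic \<Gamma> p (pd 1 (f i) p) (pd 2 (f i) p) = Flex (f i) p" if "i \<in> {1..d}" "p \<in> U" for i p
    using web_leaves_geodesic_iff[OF web, of \<Gamma>] d \<Gamma>(2) torsion_free_symmetric[OF \<Gamma>(1)] that by auto
  show "\<forall>i\<in>{5..d}. \<forall>p\<in>U. flex_condition f (f i) p"
  proof (intro ballI)
    fix i p assume "i \<in> {5..d}" and p: "p \<in> U"
    note e = geodesic_cubic_eq_Pi[OF web d p, of \<Gamma>]
    show "flex_condition f (f i) p"
      using flex_condition_iff_geodesic_cubic[of \<Gamma> p f "f i", OF e] g[OF _ p] d \<open>i \<in> {5..d}\<close> by auto
  qed
next
  assume flex: "\<forall>i\<in>{5..d}. \<forall>p\<in>U. flex_condition f (f i) p"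
  \<comment> \<open>Thomas's trace-free representative of the projective class: the sums of
    \<Gamma>^k_{ik} over k vanish, so \<Gamma>^1_{11} = -\<Pi>^2_{12} and \<Gamma>^2_{22} =
    -\<Pi>^1_{12}. This is the origin of the factors -3 in the middle coefficients.\<close>
  define \<Gamma> :: connection where "\<Gamma> k i j =
    (if i = j then (if k = i then (if k = 1 then (\<lambda>p. - Pi_2_12 f p) else (\<lambda>p. - Pi_1_12 f p))
                    else if k = 1 then Pi_1_22 f else Pi_2_11 f)
     else if k = 1 then Pi_1_12 f else Pi_2_12 f)" for k i j
  have "smooth_on U (\<Gamma> k i j)" for k i j
    using smooth_on_Pi[OF web d] planar_web_open[OF web] by (auto simp: \<Gamma>_def intro!: smooth_intros)
  then have tf: "torsion_free_connection U \<Gamma>"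
    by (rule torsion_freeI) (simp add: \<Gamma>_def)
  have "\<forall>i\<in>{1..d}. geodesic_cubic \<Gamma> p (pd 1 (f i) p) (pd 2 (f i) p) = Flex (f i) p" if "p \<in> U" for p
    by (rule geodesic_cubic_all_iff_flex_condition[OF web d that, THEN iffD2])
      (use flex that in \<open>auto simp: \<Gamma>_def\<close>)
  then have "\<forall>L\<in>web_leaves d U f. geodesic_leaf \<Gamma> L"
    using web_leaves_geodesic_iff[OF web, of \<Gamma>] d torsion_free_symmetric[OF tf] by auto
  then show "geodesic_web d U f" using web tf by (auto simp: geodesic_web_def)
qed

section \<open>Curvature of symmetric connections\<close>

text \<open>The k-th component of R(\<partial>_1, \<partial>_2)\<partial>_l. By antisymmetry in the
  first two arguments these four functions are the whole curvature of a planar connection.\<close>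

definition curvature_matrix :: "connection \<Rightarrow> 2 \<Rightarrow> 2 \<Rightarrow> plane \<Rightarrow> real" where
  "curvature_matrix \<Gamma> k l p = pd 1 (\<Gamma> k 2 l) p - pd 2 (\<Gamma> k 1 l) p
     + (\<Gamma> k 1 1 p * \<Gamma> 1 2 l p + \<Gamma> k 1 2 p * \<Gamma> 2 2 l p - \<Gamma> k 2 1 p * \<Gamma> 1 1 l p - \<Gamma> k 2 2 p * \<Gamma> 2 1 l p)"

lemma smooth_on_curvature_matrix [smooth_intros]:
  "open U \<Longrightarrow> (\<And>k i j. smooth_on U (\<Gamma> k i j)) \<Longrightarrow> smooth_on U (\<lambda>p. curvature_matrix \<Gamma> k l p)"
  unfolding curvature_matrix_def by (intro smooth_intros)

lemma smooth_on_christoffel [smooth_intros]: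
  assumes "open U" "\<And>k i j. smooth_on U (\<Gamma> k i j)" "smooth_on U X" "smooth_on U Y"
  shows "smooth_on U (\<lambda>p. christoffel \<Gamma> p (X p) (Y p))"
  unfolding christoffel_def using assms by (intro smooth_intros)

lemma smooth_on_cov [smooth_intros]:
  assumes "open U" "\<And>k i j. smooth_on U (\<Gamma> k i j)" "smooth_on U X" "smooth_on U Y"
  shows "smooth_on U (cov \<Gamma> X Y)"
  unfolding cov_def[abs_def] using assms by (intro smooth_intros)

lemma smooth_on_lie_bracket [smooth_intros]:
  "open U \<Longrightarrow> smooth_on U X \<Longrightarrow> smooth_on U Y \<Longrightarrow> smooth_on U (lie_bracket X Y)"
  unfolding lie_bracket_def[abs_def] by (intro smooth_intros)

lemma smooth_on_curvature [smooth_intros]: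
  assumes "open U" "\<And>k i j. smooth_on U (\<Gamma> k i j)" "smooth_on U X" "smooth_on U Y" "smooth_on U Z"
  shows "smooth_on U (curvature \<Gamma> X Y Z)"
  unfolding curvature_def[abs_def] using assms by (intro smooth_intros)

lemma frechet_component_pd:
  assumes "Y differentiable (at p)"
  shows "frechet_derivative Y (at p) v $ k = v $ 1 * pd 1 (\<lambda>q. Y q $ k) p + v $ 2 * pd 2 (\<lambda>q. Y q $ k) p"
  using frechet_component[OF assms, of k v] frechet_derivative_pd[of "\<lambda>q. Y q $ k" p v] assms
    differentiableI[OF bounded_linear.has_derivative[OF bounded_linear_vec_nth has_derivative_frechet[OF assms]]]
  by metis

lemma cov_component:
  assumes "Y differentiable (at p)"
  shows "cov \<Gamma> X Y p $ k = X p $ 1 * pd 1 (\<lambda>q. Y q $ k) p + X p $ 2 * pd 2 (\<lambda>q. Y q $ k) p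
    + (\<Gamma> k 1 1 p * X p $ 1 * Y p $ 1 + \<Gamma> k 1 2 p * X p $ 1 * Y p $ 2
       + \<Gamma> k 2 1 p * X p $ 2 * Y p $ 1 + \<Gamma> k 2 2 p * X p $ 2 * Y p $ 2)"
  unfolding cov_def by (simp add: frechet_component_pd[OF assms] christoffel_component)

text \<open>The product rule spelled out once, so that iterated covariant derivatives become
  polynomials in values and partial derivatives at one point.\<close>

lemma pd_cov_component:
  assumes U: "open U" "p \<in> U" and \<Gamma>: "\<And>k i j. smooth_on U (\<Gamma> k i j)" and XY: "smooth_on U X" "smooth_on U Y"
  shows "pd i (\<lambda>q. cov \<Gamma> X Y q $ k) p =
      X p $ 1 * pd i (pd 1 (\<lambda>q. Y q $ k)) p + pd i (\<lambda>q. X q $ 1) p * pd 1 (\<lambda>q. Y q $ k) p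
    + (X p $ 2 * pd i (pd 2 (\<lambda>q. Y q $ k)) p + pd i (\<lambda>q. X q $ 2) p * pd 2 (\<lambda>q. Y q $ k) p)
    + (\<Gamma> k 1 1 p * X p $ 1 * pd i (\<lambda>q. Y q $ 1) p + (\<Gamma> k 1 1 p * pd i (\<lambda>q. X q $ 1) p + pd i (\<Gamma> k 1 1) p * X p $ 1) * Y p $ 1
     + (\<Gamma> k 1 2 p * X p $ 1 * pd i (\<lambda>q. Y q $ 2) p + (\<Gamma> k 1 2 p * pd i (\<lambda>q. X q $ 1) p + pd i (\<Gamma> k 1 2) p * X p $ 1) * Y p $ 2)
     + (\<Gamma> k 2 1 p * X p $ 2 * pd i (\<lambda>q. Y q $ 1) p + (\<Gamma> k 2 1 p * pd i (\<lambda>q. X q $ 2) p + pd i (\<Gamma> k 2 1) p * X p $ 2) * Y p $ 1)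
     + (\<Gamma> k 2 2 p * X p $ 2 * pd i (\<lambda>q. Y q $ 2) p + (\<Gamma> k 2 2 p * pd i (\<lambda>q. X q $ 2) p + pd i (\<Gamma> k 2 2) p * X p $ 2) * Y p $ 2))"
proof -
  have D: "(\<lambda>q. X q $ j) differentiable (at p)" "(\<lambda>q. Y q $ j) differentiable (at p)"
    "pd l (\<lambda>q. Y q $ j) differentiable (at p)" "\<Gamma> k l j differentiable (at p)" for j l
    using U XY \<Gamma> by (auto intro!: smooth_on_differentiable[of U] smooth_intros)
  note D' = D differentiable_add differentiable_mult
  have "pd i (\<lambda>q. cov \<Gamma> X Y q $ k) p
      = pd i (\<lambda>p. X p $ 1 * pd 1 (\<lambda>q. Y q $ k) p + X p $ 2 * pd 2 (\<lambda>q. Y q $ k) p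
    + (\<Gamma> k 1 1 p * X p $ 1 * Y p $ 1 + \<Gamma> k 1 2 p * X p $ 1 * Y p $ 2
       + \<Gamma> k 2 1 p * X p $ 2 * Y p $ 1 + \<Gamma> k 2 2 p * X p $ 2 * Y p $ 2)) p"
    by (rule pd_cong_open[OF U], rule cov_component, rule smooth_on_differentiable[OF XY(2)])
  then show ?thesis
    by (simp add: pd_add pd_mult D')
qed

text \<open>Tensoriality of R: second derivatives of Z cancel by \<open>pd_swap\<close>, derivatives
  of X and Y cancel against the Lie bracket term, and what remains is the area of (X, Y) times a
  matrix acting on Z.\<close>

theorem curvature_component:
  assumes U: "open U" "p \<in> U" and \<Gamma>: "\<And>k i j. smooth_on U (\<Gamma> k i j)"
    and XYZ: "smooth_on U X" "smooth_on U Y" "smooth_on U Z"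
  shows "curvature \<Gamma> X Y Z p $ k = (X p $ 1 * Y p $ 2 - X p $ 2 * Y p $ 1) *
    (curvature_matrix \<Gamma> k 1 p * Z p $ 1 + curvature_matrix \<Gamma> k 2 p * Z p $ 2)"
proof -
  have sw: "pd 2 (pd 1 (\<lambda>q. Z q $ k)) p = pd 1 (pd 2 (\<lambda>q. Z q $ k)) p" for k
    by (rule pd_swap[OF U(1) _ U(2)]) (intro smooth_intros U XYZ)
  have D: "cov \<Gamma> Y Z differentiable (at p)" "cov \<Gamma> X Z differentiable (at p)"
    "Z differentiable (at p)" "Y differentiable (at p)" "X differentiable (at p)"
    by (intro smooth_on_differentiable[OF _ U(2)] smooth_intros U XYZ \<Gamma>)+
  have "curvature \<Gamma> X Y Z p $ k
    = cov \<Gamma> X (cov \<Gamma> Y Z) p $ k - cov \<Gamma> Y (cov \<Gamma> X Z) p $ k - cov \<Gamma> (lie_bracket X Y) Z p $ k"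
    by (simp add: curvature_def)
  also have "\<dots> = (X p $ 1 * Y p $ 2 - X p $ 2 * Y p $ 1) *
    (curvature_matrix \<Gamma> k 1 p * Z p $ 1 + curvature_matrix \<Gamma> k 2 p * Z p $ 2)"
    unfolding cov_component[OF D(1)] cov_component[OF D(2)] pd_cov_component[OF U \<Gamma> XYZ(2,3)]
      pd_cov_component[OF U \<Gamma> XYZ(1,3)] cov_component[OF D(3)] lie_bracket_def vector_minus_component
      frechet_component_pd[OF D(4)] frechet_component_pd[OF D(5)] sw curvature_matrix_def
    by (simp add: algebra_simps)
  finally show ?thesis .
qed

text \<open>The components of \<nabla>R along \<partial>_w. The curvature is a matrix times the area
  form; the first two brackets differentiate the matrix, and the last term, a trace of \<Gamma>,
  comes from the area form.\<close>

definition nabla_curvature_matrix :: "connection \<Rightarrow> 2 \<Rightarrow> 2 \<Rightarrow> 2 \<Rightarrow> plane \<Rightarrow> real" where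
  "nabla_curvature_matrix \<Gamma> w k l p = pd w (curvature_matrix \<Gamma> k l) p
    + (\<Gamma> k w 1 p * curvature_matrix \<Gamma> 1 l p + \<Gamma> k w 2 p * curvature_matrix \<Gamma> 2 l p)
    - (curvature_matrix \<Gamma> k 1 p * \<Gamma> 1 w l p + curvature_matrix \<Gamma> k 2 p * \<Gamma> 2 w l p)
    - (\<Gamma> 1 w 1 p + \<Gamma> 2 w 2 p) * curvature_matrix \<Gamma> k l p"

theorem cov_curvature_component:
  assumes U: "open U" "p \<in> U" and \<Gamma>: "\<And>k i j. smooth_on U (\<Gamma> k i j)"
    and WXYZ: "smooth_on U W" "smooth_on U X" "smooth_on U Y" "smooth_on U Z"
  shows "cov_curvature \<Gamma> W X Y Z p $ k = (X p $ 1 * Y p $ 2 - X p $ 2 * Y p $ 1) *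
    (W p $ 1 * (nabla_curvature_matrix \<Gamma> 1 k 1 p * Z p $ 1 + nabla_curvature_matrix \<Gamma> 1 k 2 p * Z p $ 2)
     + W p $ 2 * (nabla_curvature_matrix \<Gamma> 2 k 1 p * Z p $ 1 + nabla_curvature_matrix \<Gamma> 2 k 2 p * Z p $ 2))"
proof -
  let ?R = "curvature \<Gamma> X Y Z" and ?M = "curvature_matrix \<Gamma>"
  have cs: "smooth_on U (cov \<Gamma> W X)" "smooth_on U (cov \<Gamma> W Y)" "smooth_on U (cov \<Gamma> W Z)"
    by (intro smooth_intros U \<Gamma> WXYZ)+
  have D: "?R differentiable (at p)" "X differentiable (at p)" "Y differentiable (at p)" "Z differentiable (at p)"
    by (intro smooth_on_differentiable[OF _ U(2)] smooth_intros U \<Gamma> WXYZ)+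
  have d: "(\<lambda>q. X q $ j) differentiable (at p)" "(\<lambda>q. Y q $ j) differentiable (at p)"
    "(\<lambda>q. Z q $ j) differentiable (at p)" "?M k j differentiable (at p)" for j
    by (intro smooth_on_differentiable[OF _ U(2)] smooth_intros U \<Gamma> WXYZ)+
  note d' = d differentiable_add differentiable_diff differentiable_mult
  have "pd i (\<lambda>q. ?R q $ k) p = pd i (\<lambda>q. (X q $ 1 * Y q $ 2 - X q $ 2 * Y q $ 1) *
      (?M k 1 q * Z q $ 1 + ?M k 2 q * Z q $ 2)) p" for i
    by (rule pd_cong_open[OF U]) (rule curvature_component[OF U(1) _ \<Gamma> WXYZ(2-4)])
  then have pdR: "pd i (\<lambda>q. ?R q $ k) p =
    (X p $ 1 * Y p $ 2 - X p $ 2 * Y p $ 1) *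
      (?M k 1 p * pd i (\<lambda>q. Z q $ 1) p + pd i (?M k 1) p * Z p $ 1
       + (?M k 2 p * pd i (\<lambda>q. Z q $ 2) p + pd i (?M k 2) p * Z p $ 2))
    + (X p $ 1 * pd i (\<lambda>q. Y q $ 2) p + pd i (\<lambda>q. X q $ 1) p * Y p $ 2
       - (X p $ 2 * pd i (\<lambda>q. Y q $ 1) p + pd i (\<lambda>q. X q $ 2) p * Y p $ 1)) *
      (?M k 1 p * Z p $ 1 + ?M k 2 p * Z p $ 2)" for i
    by (simp add: pd_add pd_diff pd_mult d')
  note R = curvature_component[of U p \<Gamma>, OF U \<Gamma>]
  have "cov_curvature \<Gamma> W X Y Z p $ k = cov \<Gamma> W ?R p $ k - curvature \<Gamma> (cov \<Gamma> W X) Y Z p $ k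
     - curvature \<Gamma> X (cov \<Gamma> W Y) Z p $ k - curvature \<Gamma> X Y (cov \<Gamma> W Z) p $ k"
    by (simp add: cov_curvature_def)
  also have "\<dots> = (X p $ 1 * Y p $ 2 - X p $ 2 * Y p $ 1) *
    (W p $ 1 * (nabla_curvature_matrix \<Gamma> 1 k 1 p * Z p $ 1 + nabla_curvature_matrix \<Gamma> 1 k 2 p * Z p $ 2)
     + W p $ 2 * (nabla_curvature_matrix \<Gamma> 2 k 1 p * Z p $ 1 + nabla_curvature_matrix \<Gamma> 2 k 2 p * Z p $ 2))"
    unfolding R[OF cs(1) WXYZ(3,4)] R[OF WXYZ(2) cs(2) WXYZ(4)] R[OF WXYZ(2,3) cs(3)] cov_component[OF D(1)]
      cov_component[OF D(2)] cov_component[OF D(3)] cov_component[OF D(4)] pdR R[OF WXYZ(2-4)]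
      nabla_curvature_matrix_def
    by (simp add: algebra_simps)
  finally show ?thesis .
qed

text \<open>By tensoriality constant coordinate fields suffice as test fields; for \<partial>_1 and
  \<partial>_2 the area factor is 1.\<close>

theorem symmetric_connection_iff:
  assumes U: "open U" and tf: "torsion_free_connection U \<Gamma>"
  shows "symmetric_connection U \<Gamma> \<longleftrightarrow> (\<forall>w k l. \<forall>p\<in>U. nabla_curvature_matrix \<Gamma> w k l p = 0)"
proof
  assume sym: "symmetric_connection U \<Gamma>"
  define e :: "2 \<Rightarrow> vfield" where "e i = (\<lambda>_. axis i 1)" for i
  have e: "smooth_on U (e i)" for i by (simp add: e_def smooth_on_const)
  have ev: "e i p $ j = (if i = j then 1 else 0)" for i j p by (simp add: e_def axis_def)
  have "nabla_curvature_matrix \<Gamma> w k l p = 0" if "p \<in> U" for w k l p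
  proof -
    have "cov_curvature \<Gamma> (e w) (e 1) (e 2) (e l) p $ k = 0"
      using sym that e by (simp add: symmetric_connection_def)
    then show ?thesis
      unfolding cov_curvature_component[of U p \<Gamma>, OF U that torsion_free_smooth[OF tf] e e e e]
      using exhaust_2[of w] exhaust_2[of l] by (auto simp: ev)
  qed
  then show "\<forall>w k l. \<forall>p\<in>U. nabla_curvature_matrix \<Gamma> w k l p = 0" by blast
next
  assume "\<forall>w k l. \<forall>p\<in>U. nabla_curvature_matrix \<Gamma> w k l p = 0"
  then show "symmetric_connection U \<Gamma>"
    unfolding symmetric_connection_def vec_eq_iff
    using tf cov_curvature_component[of U _ \<Gamma>, OF U _ torsion_free_smooth[OF tf]] by simp
qed

section \<open>Restriction to open subsets and consequences of parallel curvature\<close>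

lemma torsion_free_connection_subset:
  assumes "torsion_free_connection U \<Gamma>" "V \<subseteq> U"
  shows "torsion_free_connection V \<Gamma>"
proof (rule torsion_freeI)
  show "smooth_on V (\<Gamma> k i j)" for k i j
    using smooth_on_subset[OF torsion_free_smooth[OF assms(1)] assms(2)] .
  show "\<Gamma> k 2 1 p = \<Gamma> k 1 2 p" if "p \<in> V" for k p
    using torsion_free_symmetric[OF assms(1) subsetD[OF assms(2) that]] .
qed

lemma symmetric_connection_subset:
  assumes "open U" "open V" "symmetric_connection U \<Gamma>" "V \<subseteq> U"
  shows "symmetric_connection V \<Gamma>"
proof -
  have tf: "torsion_free_connection U \<Gamma>" using assms(3) by (simp add: symmetric_connection_def)
  show ?thesis
    using symmetric_connection_iff[OF assms(1) tf] assms
      symmetric_connection_iff[OF assms(2) torsion_free_connection_subset[OF tf assms(4)]] by blast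
qed

lemma symmetric_connection_curvature_matrix:
  assumes U: "open U" "p \<in> U" and sym: "symmetric_connection U \<Gamma>"
  shows "pd w (curvature_matrix \<Gamma> k l) p =
    (\<Gamma> 1 w 1 p + \<Gamma> 2 w 2 p) * curvature_matrix \<Gamma> k l p
    - (\<Gamma> k w 1 p * curvature_matrix \<Gamma> 1 l p + \<Gamma> k w 2 p * curvature_matrix \<Gamma> 2 l p)
    + (curvature_matrix \<Gamma> k 1 p * \<Gamma> 1 w l p + curvature_matrix \<Gamma> k 2 p * \<Gamma> 2 w l p)"
proof -
  have "torsion_free_connection U \<Gamma>" using sym by (simp add: symmetric_connection_def)
  from symmetric_connection_iff[OF U(1) this] sym U(2)
  have "nabla_curvature_matrix \<Gamma> w k l p = 0" by blast
  then show ?thesis by (simp add: nabla_curvature_matrix_def)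
qed

lemma flat_connection_symmetric:
  assumes U: "open U" and tf: "torsion_free_connection U \<Gamma>"
    and flat: "\<And>k l p. p \<in> U \<Longrightarrow> curvature_matrix \<Gamma> k l p = 0"
  shows "symmetric_connection U \<Gamma>"
proof -
  have "pd w (curvature_matrix \<Gamma> k l) p = 0" if "p \<in> U" for w k l p
    using pd_cong_open[OF U that flat] by simp
  then show ?thesis
    unfolding symmetric_connection_iff[OF U tf] nabla_curvature_matrix_def by (simp add: flat)
qed

text \<open>
  The trace of the curvature is an exact 2-form which is itself parallel; commuting its second
  derivatives shows that its square vanishes.
\<close>

lemma symmetric_connection_curvature_trace:
  assumes U: "open U" "p \<in> U" and sym: "symmetric_connection U \<Gamma>"
  shows "curvature_matrix \<Gamma> 1 1 p + curvature_matrix \<Gamma> 2 2 p = 0"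
proof -
  have tf: "torsion_free_connection U \<Gamma>" using sym by (simp add: symmetric_connection_def)
  note \<Gamma> = torsion_free_smooth[OF tf]
  define \<omega> where "\<omega> q = curvature_matrix \<Gamma> 1 1 q + curvature_matrix \<Gamma> 2 2 q" for q
  define t where "t w q = \<Gamma> 1 w 1 q + \<Gamma> 2 w 2 q" for w q
  have sm: "smooth_on U \<omega>" "smooth_on U (t w)" "smooth_on U (curvature_matrix \<Gamma> k l)" for w k l
    unfolding \<omega>_def[abs_def] t_def[abs_def] by (intro smooth_intros U \<Gamma>)+
  note D = smooth_on_differentiable[OF sm(1)] smooth_on_differentiable[OF sm(2)]
    smooth_on_differentiable[OF sm(3)] smooth_on_differentiable[OF \<Gamma>]
  have d\<omega>: "pd w \<omega> q = t w q * \<omega> q" if "q \<in> U" for w q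
  proof -
    have "pd w \<omega> q = pd w (curvature_matrix \<Gamma> 1 1) q + pd w (curvature_matrix \<Gamma> 2 2) q"
      unfolding \<omega>_def[abs_def] by (simp add: pd_add D that)
    then show ?thesis
      unfolding symmetric_connection_curvature_matrix[OF U(1) that sym]
      by (simp add: t_def \<omega>_def algebra_simps)
  qed
  have "pd w (t v) p = pd w (\<Gamma> 1 v 1) p + pd w (\<Gamma> 2 v 2) p" for v w
    unfolding t_def[abs_def] by (simp add: pd_add D U)
  \<comment> \<open>The quadratic terms of the trace drop out: they form the trace of a commutator
    of two matrices.\<close>
  then have \<omega>: "\<omega> p = pd 1 (t 2) p - pd 2 (t 1) p"
    by (simp add: \<omega>_def curvature_matrix_def algebra_simps)
  have dd: "pd v (pd w \<omega>) p = t w p * (t v p * \<omega> p) + pd v (t w) p * \<omega> p" for v w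
  proof -
    have "pd v (pd w \<omega>) p = pd v (\<lambda>q. t w q * \<omega> q) p"
      by (rule pd_cong_open[OF U d\<omega>])
    then show ?thesis by (simp add: pd_mult D U d\<omega>)
  qed
  have "\<omega> p * \<omega> p = 0"
    using pd_swap[OF U(1) sm(1) U(2)] \<omega> unfolding dd by algebra
  then show ?thesis by (simp add: \<omega>_def)
qed

text \<open>Liouville's equations, with \<open>\<alpha>\<close> and \<open>\<beta>\<close> the only nonzero coefficients of the projective structure.\<close>

definition liouville_equations :: "(plane \<Rightarrow> real) \<Rightarrow> (plane \<Rightarrow> real) \<Rightarrow> plane \<Rightarrow> bool" where
  "liouville_equations \<alpha> \<beta> p \<longleftrightarrow>
     pd 1 (pd 1 \<alpha>) p + 2 * pd 2 (pd 1 \<beta>) p = \<beta> p * pd 1 \<alpha> p + 2 * \<beta> p * pd 2 \<beta> p \<and>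
     2 * pd 2 (pd 1 \<alpha>) p + pd 2 (pd 2 \<beta>) p = 2 * \<alpha> p * pd 1 \<alpha> p + \<alpha> p * pd 2 \<beta> p"

text \<open>Parallel curvature forces the Cotton tensor to vanish, and the Cotton tensor depends on
  the connection only through its projective class. Vanishing of the curvature trace, together with
  its first derivatives, removes the part of the symbols not visible in \<alpha> and
  \<beta>.\<close>

theorem symmetric_connection_liouville:
  assumes U: "open U" and sym: "symmetric_connection U \<Gamma>" and p: "p \<in> U"
    and coord: "\<And>q. q \<in> U \<Longrightarrow> \<Gamma> 1 2 2 q = 0" "\<And>q. q \<in> U \<Longrightarrow> \<Gamma> 2 1 1 q = 0"
    and \<alpha>: "\<And>q. q \<in> U \<Longrightarrow> \<alpha> q = \<Gamma> 2 2 2 q - 2 * \<Gamma> 1 1 2 q"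
    and \<beta>: "\<And>q. q \<in> U \<Longrightarrow> \<beta> q = \<Gamma> 1 1 1 q - 2 * \<Gamma> 2 1 2 q"
  shows "liouville_equations \<alpha> \<beta> p"
proof -
  have tf: "torsion_free_connection U \<Gamma>" using sym by (simp add: symmetric_connection_def)
  note \<Gamma> = torsion_free_smooth[OF tf]
  define a b c e where abce: "a = \<Gamma> 1 1 1" "b = \<Gamma> 1 1 2" "c = \<Gamma> 2 1 2" "e = \<Gamma> 2 2 2"
  have sm: "smooth_on U a" "smooth_on U b" "smooth_on U c" "smooth_on U e" by (simp_all add: abce \<Gamma>)
  have pdsm: "smooth_on U (pd i a)" "smooth_on U (pd i b)" "smooth_on U (pd i c)" "smooth_on U (pd i e)" for i
    by (intro smooth_intros sm)+
  note D = sm[THEN smooth_on_differentiable] pdsm[THEN smooth_on_differentiable]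
    differentiable_add differentiable_diff differentiable_mult differentiable_minus
  note sw = sm[THEN pd_swap[OF U _ p]]
  have G: "\<Gamma> 1 1 1 q = a q" "\<Gamma> 1 1 2 q = b q" "\<Gamma> 1 2 1 q = b q" "\<Gamma> 1 2 2 q = 0"
    "\<Gamma> 2 1 1 q = 0" "\<Gamma> 2 1 2 q = c q" "\<Gamma> 2 2 1 q = c q" "\<Gamma> 2 2 2 q = e q" if "q \<in> U" for q
    using coord[OF that] torsion_free_symmetric[OF tf that] by (auto simp: abce)
  have dG: "pd i (\<Gamma> 1 1 1) q = pd i a q" "pd i (\<Gamma> 1 1 2) q = pd i b q" "pd i (\<Gamma> 1 2 1) q = pd i b q"
    "pd i (\<Gamma> 1 2 2) q = 0" "pd i (\<Gamma> 2 1 1) q = 0" "pd i (\<Gamma> 2 1 2) q = pd i c q" "pd i (\<Gamma> 2 2 1) q = pd i c q"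
    "pd i (\<Gamma> 2 2 2) q = pd i e q" if "q \<in> U" for i q
    using pd_cong_open[OF U that G(3)] pd_cong_open[OF U that G(4)] pd_cong_open[OF U that G(5)]
      pd_cong_open[OF U that G(7)] by (auto simp: abce)
  have M: "curvature_matrix \<Gamma> 1 1 q = pd 1 b q - pd 2 a q + b q * c q"
    "curvature_matrix \<Gamma> 2 1 q = pd 1 c q + c q * c q - a q * c q"
    "curvature_matrix \<Gamma> 1 2 q = e q * b q - pd 2 b q - b q * b q"
    "curvature_matrix \<Gamma> 2 2 q = pd 1 e q - pd 2 c q - b q * c q" if "q \<in> U" for q
    unfolding curvature_matrix_def G[OF that] dG[OF that] by (simp_all add: algebra_simps)
  have dM: "pd i (curvature_matrix \<Gamma> 1 1) p = pd i (pd 1 b) p - pd i (pd 2 a) p + (b p * pd i c p + pd i b p * c p)"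
    "pd i (curvature_matrix \<Gamma> 2 1) p = pd i (pd 1 c) p + (c p * pd i c p + pd i c p * c p) - (a p * pd i c p + pd i a p * c p)"
    "pd i (curvature_matrix \<Gamma> 1 2) p = (e p * pd i b p + pd i e p * b p) - pd i (pd 2 b) p - (b p * pd i b p + pd i b p * b p)"
    "pd i (curvature_matrix \<Gamma> 2 2) p = pd i (pd 1 e) p - pd i (pd 2 c) p - (b p * pd i c p + pd i b p * c p)" for i
    using pd_cong_open[OF U p M(1)] pd_cong_open[OF U p M(2)] pd_cong_open[OF U p M(3)] pd_cong_open[OF U p M(4)]
    by (simp_all add: pd_add pd_diff pd_mult D p)
  have \<omega>: "pd 1 b q - pd 2 a q + (pd 1 e q - pd 2 c q) = 0" if "q \<in> U" for q
    using symmetric_connection_curvature_trace[OF U that sym] unfolding M[OF that] by simp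
  \<comment> \<open>The trace vanishes throughout \<open>U\<close>, so the identity may be
    differentiated; this relates the second derivatives in the next steps.\<close>
  have d\<omega>: "pd i (pd 1 b) p - pd i (pd 2 a) p + (pd i (pd 1 e) p - pd i (pd 2 c) p) = 0" for i
  proof -
    have "pd i (\<lambda>q. pd 1 b q - pd 2 a q + (pd 1 e q - pd 2 c q)) p = 0"
      using pd_cong_open[OF U p \<omega>, where j=i] by simp
    then show ?thesis by (simp add: pd_add pd_diff D p)
  qed
  note E = symmetric_connection_curvature_matrix[OF U p sym]
  \<comment> \<open>With Ric the trace of X \<mapsto> R(X, .)., the matrix entries are M_{1l} =
    Ric_{2l} and M_{2l} = -Ric_{1l}. Added in pairs, these four equations become \<nabla>_1 Ric_{2l}
    = \<nabla>_2 Ric_{1l} for l = 1, 2, the two Cotton components.\<close>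
  note E' = E[of 1 1 1] E[of 2 2 1] E[of 1 1 2] E[of 2 2 2]
  have \<alpha>d: "pd i \<alpha> q = pd i e q - 2 * pd i b q" if "q \<in> U" for i q
    using pd_cong_open[OF U that, where f=\<alpha> and g="\<lambda>q. e q - 2 * b q" and j=i] \<alpha> that
    by (simp add: abce[symmetric] pd_diff pd_cmult D)
  have \<beta>d: "pd i \<beta> q = pd i a q - 2 * pd i c q" if "q \<in> U" for i q
    using pd_cong_open[OF U that, where f=\<beta> and g="\<lambda>q. a q - 2 * c q" and j=i] \<beta> that
    by (simp add: abce[symmetric] pd_diff pd_cmult D)
  have \<alpha>dd: "pd j (pd i \<alpha>) p = pd j (pd i e) p - 2 * pd j (pd i b) p" for i j
    using pd_cong_open[OF U p, where f="pd i \<alpha>" and g="\<lambda>q. pd i e q - 2 * pd i b q" and j=j] \<alpha>d p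
    by (simp add: pd_diff pd_cmult D)
  have \<beta>dd: "pd j (pd i \<beta>) p = pd j (pd i a) p - 2 * pd j (pd i c) p" for i j
    using pd_cong_open[OF U p, where f="pd i \<beta>" and g="\<lambda>q. pd i a q - 2 * pd i c q" and j=j] \<beta>d p
    by (simp add: pd_diff pd_cmult D)
  have v: "\<alpha> p = e p - 2 * b p" "\<beta> p = a p - 2 * c p" using \<alpha> \<beta> p by (simp_all add: abce)
  show ?thesis
    unfolding liouville_equations_def v \<alpha>dd \<beta>dd \<alpha>d[OF p] \<beta>d[OF p]
  proof
    show "pd 1 (pd 1 e) p - 2 * pd 1 (pd 1 b) p + 2 * (pd 2 (pd 1 a) p - 2 * pd 2 (pd 1 c) p) =
      (a p - 2 * c p) * (pd 1 e p - 2 * pd 1 b p) + 2 * (a p - 2 * c p) * (pd 2 a p - 2 * pd 2 c p)"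
      using E'(1,2) \<omega>[OF p] d\<omega>[of 1] unfolding G[OF p] dM M[OF p] sw by algebra
    show "2 * (pd 2 (pd 1 e) p - 2 * pd 2 (pd 1 b) p) + (pd 2 (pd 2 a) p - 2 * pd 2 (pd 2 c) p) =
      2 * (e p - 2 * b p) * (pd 1 e p - 2 * pd 1 b p) + (e p - 2 * b p) * (pd 2 a p - 2 * pd 2 c p)"
      using E'(3,4) \<omega>[OF p] d\<omega>[of 2] unfolding G[OF p] dM M[OF p] sw by algebra
  qed
qed

section \<open>Pullback of connections\<close>

definition second_derivative :: "(plane \<Rightarrow> plane) \<Rightarrow> plane \<Rightarrow> plane \<Rightarrow> plane \<Rightarrow> plane" where
  "second_derivative \<phi> p u v = frechet_derivative (\<lambda>q. frechet_derivative \<phi> (at q) v) (at p) u"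

lemma second_derivative_linear:
  assumes "smooth_on S \<phi>" "p \<in> S"
  shows "linear (\<lambda>u. second_derivative \<phi> p u v)"
  unfolding second_derivative_def
  using linear_frechet_derivative[OF smooth_on_differentiable[OF smooth_on_frechet_const[OF assms(1)] assms(2)]]
  by (simp add: eta_contract_eq)

text \<open>Chain and product rule for D\<phi>(g)(w) with both arguments moving. Derivatives of
  D\<phi> are available only with a fixed vector inserted, so w is expanded in the axis vectors with
  scalar coefficients.\<close>

lemma has_derivative_frechet_apply:
  fixes \<phi> :: "plane \<Rightarrow> plane" and g w :: "'a::real_normed_vector \<Rightarrow> plane"
  assumes V: "open V" "smooth_on V \<phi>" and S: "open S" "s \<in> S" "\<And>r. r \<in> S \<Longrightarrow> g r \<in> V"
    and g: "(g has_derivative g') (at s)" and w: "(w has_derivative w') (at s)"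
  shows "((\<lambda>r. frechet_derivative \<phi> (at (g r)) (w r)) has_derivative
    (\<lambda>u. second_derivative \<phi> (g s) (g' u) (w s) + frechet_derivative \<phi> (at (g s)) (w' u))) (at s)"
proof -
  let ?D = "\<lambda>q. frechet_derivative \<phi> (at q)"
  have \<phi>: "\<phi> differentiable (at (g r))" if "r \<in> S" for r
    using smooth_on_differentiable[OF V(2) S(3)[OF that]] .
  have D: "((\<lambda>r. ?D (g r) v) has_derivative (\<lambda>u. second_derivative \<phi> (g s) (g' u) v)) (at s)" for v
    unfolding second_derivative_def
    by (rule has_derivative_compose[OF g, where g = "\<lambda>q. ?D q v"])
      (rule smooth_on_hd[OF smooth_on_frechet_const[OF V(2)] S(3)[OF S(2)]])
  have wc: "((\<lambda>r. w r $ k) has_derivative (\<lambda>u. w' u $ k)) (at s)" for k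
    by (rule bounded_linear.has_derivative[OF bounded_linear_vec_nth w])
  have sd: "second_derivative \<phi> (g s) u v
      = v $ 1 *\<^sub>R second_derivative \<phi> (g s) u (axis 1 1) + v $ 2 *\<^sub>R second_derivative \<phi> (g s) u (axis 2 1)" for u v
  proof -
    have h: "((\<lambda>q. ?D q x) has_derivative (\<lambda>u. second_derivative \<phi> (g s) u x)) (at (g s))" for x
      unfolding second_derivative_def
      by (rule smooth_on_hd[OF smooth_on_frechet_const[OF V(2)] S(3)[OF S(2)]])
    have "((\<lambda>q. v $ 1 *\<^sub>R ?D q (axis 1 1) + v $ 2 *\<^sub>R ?D q (axis 2 1)) has_derivative
      (\<lambda>u. v $ 1 *\<^sub>R second_derivative \<phi> (g s) u (axis 1 1) + v $ 2 *\<^sub>R second_derivative \<phi> (g s) u (axis 2 1))) (at (g s))"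
      by (intro has_derivative_add has_derivative_scaleR_right h)
    then have h': "((\<lambda>q. ?D q v) has_derivative
      (\<lambda>u. v $ 1 *\<^sub>R second_derivative \<phi> (g s) u (axis 1 1) + v $ 2 *\<^sub>R second_derivative \<phi> (g s) u (axis 2 1))) (at (g s))"
      by (rule has_derivative_transform_within_open[OF _ V(1) S(3)[OF S(2)]])
        (metis frechet_derivative_plane smooth_on_differentiable[OF V(2)])
    show ?thesis using fun_cong[OF has_derivative_unique[OF h h']] .
  qed
  have "((\<lambda>r. w r $ 1 *\<^sub>R ?D (g r) (axis 1 1) + w r $ 2 *\<^sub>R ?D (g r) (axis 2 1)) has_derivative
    (\<lambda>u. (w s $ 1 *\<^sub>R second_derivative \<phi> (g s) (g' u) (axis 1 1) + w' u $ 1 *\<^sub>R ?D (g s) (axis 1 1))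
       + (w s $ 2 *\<^sub>R second_derivative \<phi> (g s) (g' u) (axis 2 1) + w' u $ 2 *\<^sub>R ?D (g s) (axis 2 1)))) (at s)"
    by (intro has_derivative_add has_derivative_scaleR wc D)
  then have "((\<lambda>r. ?D (g r) (w r)) has_derivative
    (\<lambda>u. (w s $ 1 *\<^sub>R second_derivative \<phi> (g s) (g' u) (axis 1 1) + w' u $ 1 *\<^sub>R ?D (g s) (axis 1 1))
       + (w s $ 2 *\<^sub>R second_derivative \<phi> (g s) (g' u) (axis 2 1) + w' u $ 2 *\<^sub>R ?D (g s) (axis 2 1)))) (at s)"
    by (rule has_derivative_transform_within_open[OF _ S(1,2)]) (metis \<phi> frechet_derivative_plane)
  then show ?thesis
  proof (rule has_derivative_eq_rhs)
    show "(\<lambda>u. (w s $ 1 *\<^sub>R second_derivative \<phi> (g s) (g' u) (axis 1 1) + w' u $ 1 *\<^sub>R ?D (g s) (axis 1 1))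
       + (w s $ 2 *\<^sub>R second_derivative \<phi> (g s) (g' u) (axis 2 1) + w' u $ 2 *\<^sub>R ?D (g s) (axis 2 1)))
      = (\<lambda>u. second_derivative \<phi> (g s) (g' u) (w s) + ?D (g s) (w' u))"
      unfolding sd[of _ "w s"] frechet_derivative_plane[OF \<phi>[OF S(2)], of "w' _"] by (simp add: algebra_simps)
  qed
qed

locale plane_diffeomorphism =
  fixes V V' :: "plane set" and \<phi> \<psi> :: "plane \<Rightarrow> plane"
  assumes open_source: "open V" and open_target: "open V'"
    and smooth_map: "smooth_on V \<phi>" and smooth_inverse: "smooth_on V' \<psi>"
    and homeo: "homeomorphism V V' \<phi> \<psi>"
begin

lemma map_in: "p \<in> V \<Longrightarrow> \<phi> p \<in> V'" and inverse_in: "q \<in> V' \<Longrightarrow> \<psi> q \<in> V"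
  and inverse_map: "p \<in> V \<Longrightarrow> \<psi> (\<phi> p) = p" and map_inverse: "q \<in> V' \<Longrightarrow> \<phi> (\<psi> q) = q"
  using homeo by (auto simp: homeomorphism_def)

abbreviation D\<phi> :: "plane \<Rightarrow> plane \<Rightarrow> plane" where "D\<phi> p \<equiv> frechet_derivative \<phi> (at p)"
abbreviation D\<psi> :: "plane \<Rightarrow> plane \<Rightarrow> plane" where "D\<psi> q \<equiv> frechet_derivative \<psi> (at q)"

lemma has_derivative_map: "p \<in> V \<Longrightarrow> (\<phi> has_derivative D\<phi> p) (at p)"
  using smooth_on_hd[OF smooth_map] .

lemma has_derivative_inverse: "q \<in> V' \<Longrightarrow> (\<psi> has_derivative D\<psi> q) (at q)"
  using smooth_on_hd[OF smooth_inverse] .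

lemma linear_map: "p \<in> V \<Longrightarrow> linear (D\<phi> p)" and linear_inverse: "q \<in> V' \<Longrightarrow> linear (D\<psi> q)"
  using has_derivative_map has_derivative_inverse has_derivative_linear by blast+

lemma D_inverse_map [simp]:
  assumes "p \<in> V" shows "D\<psi> (\<phi> p) (D\<phi> p v) = v"
proof -
  have "((\<lambda>p. \<psi> (\<phi> p)) has_derivative (\<lambda>v. D\<psi> (\<phi> p) (D\<phi> p v))) (at p)"
    by (rule has_derivative_compose[OF has_derivative_map[OF assms] has_derivative_inverse[OF map_in[OF assms]]])
  then have "((\<lambda>p. p) has_derivative (\<lambda>v. D\<psi> (\<phi> p) (D\<phi> p v))) (at p)"
    by (rule has_derivative_transform_within_open[OF _ open_source assms]) (rule inverse_map)
  from has_derivative_unique[OF this has_derivative_ident] show ?thesis by meson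
qed

lemma D_map_inverse [simp]:
  assumes "p \<in> V" shows "D\<phi> p (D\<psi> (\<phi> p) v) = v"
proof -
  have "surj (D\<phi> p)"
    by (rule linear_inj_imp_surj[OF linear_map[OF assms]])
      (metis D_inverse_map[OF assms] injI)
  then show ?thesis using D_inverse_map[OF assms] by (metis surjD)
qed

lemma D_map_eq_0: "p \<in> V \<Longrightarrow> D\<phi> p v = 0 \<longleftrightarrow> v = 0"
  by (metis D_inverse_map linear_0 linear_map)

text \<open>The transformation law of Christoffel symbols. Its inhomogeneous term, the second
  derivative of \<phi>, is exactly what makes \<phi> carry one covariant derivative to the
  other.\<close>

definition pullback :: "connection \<Rightarrow> connection" where
  "pullback \<Gamma> k i j p = D\<psi> (\<phi> p) (second_derivative \<phi> p (axis i 1) (axis j 1)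
     + christoffel \<Gamma> (\<phi> p) (D\<phi> p (axis i 1)) (D\<phi> p (axis j 1))) $ k"

text \<open>\<open>pullback\<close> is defined on axis vectors only; both sides are bilinear, where
  linearity of the second derivative in its last slot is taken over from the first by
  symmetry.\<close>

lemma christoffel_pullback:
  assumes p: "p \<in> V"
  shows "D\<phi> p (christoffel (pullback \<Gamma>) p u v)
    = second_derivative \<phi> p u v + christoffel \<Gamma> (\<phi> p) (D\<phi> p u) (D\<phi> p v)"
proof -
  let ?H = "\<lambda>u v. second_derivative \<phi> p u v + christoffel \<Gamma> (\<phi> p) (D\<phi> p u) (D\<phi> p v)"
  have sd1: "second_derivative \<phi> p u v
      = u $ 1 *\<^sub>R second_derivative \<phi> p (axis 1 1) v + u $ 2 *\<^sub>R second_derivative \<phi> p (axis 2 1) v" for u v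
    unfolding second_derivative_def
    by (rule frechet_derivative_plane[OF smooth_on_differentiable[OF smooth_on_frechet_const[OF smooth_map] p]])
  have sym: "second_derivative \<phi> p u v = second_derivative \<phi> p v u" for u v
    unfolding second_derivative_def by (rule second_derivative_symmetric_vec[OF open_source smooth_map p])
  have sd2: "second_derivative \<phi> p u v
      = v $ 1 *\<^sub>R second_derivative \<phi> p u (axis 1 1) + v $ 2 *\<^sub>R second_derivative \<phi> p u (axis 2 1)" for u v
    using sd1[of v u] by (simp only: sym[of _ u])
  have c: "D\<phi> p x = x $ 1 *\<^sub>R D\<phi> p (axis 1 1) + x $ 2 *\<^sub>R D\<phi> p (axis 2 1)" for x
    by (rule frechet_derivative_plane[OF smooth_on_differentiable[OF smooth_map p]])
  have H: "?H u v = (u $ 1 * v $ 1) *\<^sub>R ?H (axis 1 1) (axis 1 1) + (u $ 1 * v $ 2) *\<^sub>R ?H (axis 1 1) (axis 2 1)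
     + (u $ 2 * v $ 1) *\<^sub>R ?H (axis 2 1) (axis 1 1) + (u $ 2 * v $ 2) *\<^sub>R ?H (axis 2 1) (axis 2 1)"
    unfolding sd1[of u v] sd2[of "axis 1 1" v] sd2[of "axis 2 1" v] c[of u] c[of v]
    by (simp add: vec_eq_iff christoffel_component algebra_simps)
  have "christoffel (pullback \<Gamma>) p u v = D\<psi> (\<phi> p) (?H u v)"
    unfolding H vec_eq_iff christoffel_component pullback_def
    by (simp add: linear_add[OF linear_inverse[OF map_in[OF p]]] linear_cmul[OF linear_inverse[OF map_in[OF p]]]
        algebra_simps)
  then show ?thesis using p by simp
qed

lemma torsion_free_pullback:
  assumes tf: "torsion_free_connection V' \<Gamma>"
  shows "torsion_free_connection V (pullback \<Gamma>)"
proof (rule torsion_freeI)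
  fix k i j
  have \<Gamma>: "smooth_on V (\<lambda>p. \<Gamma> k i j (\<phi> p))" for k i j
    by (rule smooth_on_compose[OF open_source open_target smooth_map torsion_free_smooth[OF tf]])
      (auto simp: map_in)
  have D\<psi>: "smooth_on V (\<lambda>p. D\<psi> (\<phi> p) v)" for v
    by (rule smooth_on_compose[OF open_source open_target smooth_map smooth_on_frechet_const[OF smooth_inverse]])
      (auto simp: map_in)
  let ?h = "\<lambda>p. second_derivative \<phi> p (axis i 1) (axis j 1)
     + christoffel \<Gamma> (\<phi> p) (D\<phi> p (axis i 1)) (D\<phi> p (axis j 1))"
  have h: "smooth_on V ?h"
    unfolding second_derivative_def christoffel_def
    by (intro smooth_intros open_source \<Gamma> smooth_map)
  have "smooth_on V (\<lambda>p. (?h p $ 1 *\<^sub>R D\<psi> (\<phi> p) (axis 1 1) + ?h p $ 2 *\<^sub>R D\<psi> (\<phi> p) (axis 2 1)) $ k)"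
    by (intro smooth_intros open_source D\<psi> h)
  moreover have "pullback \<Gamma> k i j p
      = (?h p $ 1 *\<^sub>R D\<psi> (\<phi> p) (axis 1 1) + ?h p $ 2 *\<^sub>R D\<psi> (\<phi> p) (axis 2 1)) $ k" if "p \<in> V" for p
    unfolding pullback_def
    using frechet_derivative_plane[OF smooth_on_differentiable[OF smooth_inverse map_in[OF that]], of "?h p"]
    by simp
  ultimately show "smooth_on V (pullback \<Gamma> k i j)"
    by (subst smooth_on_cong[OF open_source])
next
  fix k p assume p: "p \<in> V"
  have "christoffel \<Gamma> (\<phi> p) u v = christoffel \<Gamma> (\<phi> p) v u" for u v
    unfolding vec_eq_iff christoffel_component using torsion_free_symmetric[OF tf map_in[OF p], of _ 1 2] by simp
  then show "pullback \<Gamma> k 2 1 p = pullback \<Gamma> k 1 2 p"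
    unfolding pullback_def second_derivative_def
    using second_derivative_symmetric_vec[OF open_source smooth_map p] by metis
qed

text \<open>The usual \<phi>-relatedness of vector fields. Stating naturality as preservation of
  this relation lets it pass from \<nabla> to R and then to \<nabla>R by mere composition.\<close>

definition related :: "vfield \<Rightarrow> vfield \<Rightarrow> bool" where
  "related X X' \<longleftrightarrow> (\<forall>p\<in>V. D\<phi> p (X p) = X' (\<phi> p))"

definition pushforward :: "vfield \<Rightarrow> vfield" where
  "pushforward X q = D\<phi> (\<psi> q) (X (\<psi> q))"

lemma related_pushforward: "related X (pushforward X)"
  by (simp add: related_def pushforward_def inverse_map)

lemma smooth_on_pushforward:
  assumes "smooth_on V X" shows "smooth_on V' (pushforward X)"
proof -
  have "smooth_on V (\<lambda>p. D\<phi> p (X p))"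
    by (intro smooth_intros open_source smooth_map assms)
  then show ?thesis
    unfolding pushforward_def[abs_def]
    by (intro smooth_on_compose[OF open_target open_source smooth_inverse, of "\<lambda>p. D\<phi> p (X p)"])
      (auto simp: inverse_in)
qed

text \<open>The relation D\<phi>(Y) = Y' o \<phi> is differentiated along X in two ways; the second
  derivative of \<phi> that appears is the one absorbed by
  \<open>christoffel_pullback\<close>.\<close>

lemma related_cov:
  assumes sm: "smooth_on V Y" "smooth_on V' Y'" and rel: "related X X'" "related Y Y'"
  shows "related (cov (pullback \<Gamma>) X Y) (cov \<Gamma> X' Y')"
  unfolding related_def
proof
  fix p assume p: "p \<in> V"
  have "((\<lambda>q. D\<phi> q (Y q)) has_derivative
     (\<lambda>u. second_derivative \<phi> p u (Y p) + D\<phi> p (frechet_derivative Y (at p) u))) (at p)"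
    by (rule has_derivative_frechet_apply[OF open_source smooth_map open_source p _ has_derivative_ident
          smooth_on_hd[OF sm(1) p]])
  then have "((\<lambda>q. Y' (\<phi> q)) has_derivative
     (\<lambda>u. second_derivative \<phi> p u (Y p) + D\<phi> p (frechet_derivative Y (at p) u))) (at p)"
    by (rule has_derivative_transform_within_open[OF _ open_source p]) (use rel in \<open>simp add: related_def\<close>)
  moreover have "((\<lambda>q. Y' (\<phi> q)) has_derivative (\<lambda>u. frechet_derivative Y' (at (\<phi> p)) (D\<phi> p u))) (at p)"
    by (rule has_derivative_compose[OF has_derivative_map[OF p] smooth_on_hd[OF sm(2) map_in[OF p]]])
  ultimately have "(\<lambda>u. second_derivative \<phi> p u (Y p) + D\<phi> p (frechet_derivative Y (at p) u))
      = (\<lambda>u. frechet_derivative Y' (at (\<phi> p)) (D\<phi> p u))"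
    by (rule has_derivative_unique)
  from fun_cong[OF this, of "X p"] have "second_derivative \<phi> p (X p) (Y p) + D\<phi> p (frechet_derivative Y (at p) (X p))
      = frechet_derivative Y' (at (\<phi> p)) (D\<phi> p (X p))" .
  then show "D\<phi> p (cov (pullback \<Gamma>) X Y p) = cov \<Gamma> X' Y' (\<phi> p)"
    using rel p unfolding cov_def
    by (simp add: related_def linear_add[OF linear_map[OF p]] christoffel_pullback algebra_simps)
qed

lemma related_diff: "related X X' \<Longrightarrow> related Y Y' \<Longrightarrow> related (\<lambda>p. X p - Y p) (\<lambda>p. X' p - Y' p)"
  by (simp add: related_def linear_diff[OF linear_map])

lemma related_cong:
  "related X X' \<Longrightarrow> (\<And>p. p \<in> V \<Longrightarrow> Y p = X p) \<Longrightarrow> (\<And>q. q \<in> V' \<Longrightarrow> Y' q = X' q) \<Longrightarrow> related Y Y'"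
  by (simp add: related_def map_in)

context
  fixes \<Gamma> :: connection
  assumes tf: "torsion_free_connection V' \<Gamma>"
begin

text \<open>For a torsion-free connection the bracket is \<nabla>_X Y - \<nabla>_Y X, so its
  naturality follows from that of the covariant derivative.\<close>

lemma related_lie_bracket:
  assumes "smooth_on V X" "smooth_on V' X'" "smooth_on V Y" "smooth_on V' Y'" "related X X'" "related Y Y'"
  shows "related (lie_bracket X Y) (lie_bracket X' Y')"
proof (rule related_cong)
  show "related (\<lambda>p. cov (pullback \<Gamma>) X Y p - cov (pullback \<Gamma>) Y X p) (\<lambda>p. cov \<Gamma> X' Y' p - cov \<Gamma> Y' X' p)"
    by (intro related_diff related_cov assms)
qed (use tf torsion_free_pullback[OF tf] assms in \<open>simp_all add: torsion_free_connection_def\<close>)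

lemma related_curvature:
  assumes sm: "smooth_on V X" "smooth_on V' X'" "smooth_on V Y" "smooth_on V' Y'" "smooth_on V Z" "smooth_on V' Z'"
    and rel: "related X X'" "related Y Y'" "related Z Z'"
  shows "related (curvature (pullback \<Gamma>) X Y Z) (curvature \<Gamma> X' Y' Z')"
  unfolding curvature_def[abs_def]
  by (intro related_diff related_cov related_lie_bracket smooth_on_cov open_source open_target sm rel
      torsion_free_smooth[OF tf] torsion_free_smooth[OF torsion_free_pullback[OF tf]])

lemma related_cov_curvature:
  assumes sm: "smooth_on V W" "smooth_on V' W'" "smooth_on V X" "smooth_on V' X'" "smooth_on V Y" "smooth_on V' Y'"
      "smooth_on V Z" "smooth_on V' Z'"
    and rel: "related W W'" "related X X'" "related Y Y'" "related Z Z'"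
  shows "related (cov_curvature (pullback \<Gamma>) W X Y Z) (cov_curvature \<Gamma> W' X' Y' Z')"
  unfolding cov_curvature_def[abs_def]
  by (intro related_diff related_cov related_curvature smooth_on_cov smooth_on_curvature open_source open_target sm rel
      torsion_free_smooth[OF tf] torsion_free_smooth[OF torsion_free_pullback[OF tf]])

end

text \<open>Every smooth field on the source is related to its pushforward, and D\<phi> is
  injective, so \<nabla>R = 0 travels back.\<close>

theorem symmetric_connection_pullback:
  assumes sym: "symmetric_connection V' \<Gamma>"
  shows "symmetric_connection V (pullback \<Gamma>)"
  unfolding symmetric_connection_def
proof (intro conjI allI impI ballI)
  have tf: "torsion_free_connection V' \<Gamma>" using sym by (simp add: symmetric_connection_def)
  show "torsion_free_connection V (pullback \<Gamma>)" using torsion_free_pullback[OF tf] .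
  fix W X Y Z :: vfield and p
  assume sm: "smooth_on V W" "smooth_on V X" "smooth_on V Y" "smooth_on V Z" and p: "p \<in> V"
  have "related (cov_curvature (pullback \<Gamma>) W X Y Z)
      (cov_curvature \<Gamma> (pushforward W) (pushforward X) (pushforward Y) (pushforward Z))"
    by (intro related_cov_curvature tf sm smooth_on_pushforward related_pushforward)
  moreover have "cov_curvature \<Gamma> (pushforward W) (pushforward X) (pushforward Y) (pushforward Z) (\<phi> p) = 0"
    using sym sm smooth_on_pushforward map_in[OF p] by (simp add: symmetric_connection_def)
  ultimately have "D\<phi> p (cov_curvature (pullback \<Gamma>) W X Y Z p) = 0"
    using p by (simp add: related_def)
  then show "cov_curvature (pullback \<Gamma>) W X Y Z p = 0"
    unfolding D_map_eq_0[OF p] .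
qed

text \<open>The acceleration of \<phi> o \<gamma> is D\<phi>(\<gamma>'') plus the second derivative
  of \<phi> on (\<gamma>', \<gamma>'); the pulled back Christoffel term accounts for the latter, and
  D\<phi> can be cancelled from the geodesic equation.\<close>

theorem geodesic_leaf_pullback:
  assumes L: "L \<subseteq> V" and geo: "geodesic_leaf \<Gamma> (\<phi> ` L)"
  shows "geodesic_leaf (pullback \<Gamma>) L"
  unfolding geodesic_leaf_def
proof (intro allI impI)
  fix a b \<gamma> assume \<gamma>: "regular_curve a b \<gamma>" "\<gamma> ` {a<..<b} \<subseteq> L"
  let ?I = "{a<..<b}"
  have I: "open ?I" by simp
  have \<gamma>V: "\<gamma> t \<in> V" if "t \<in> ?I" for t using \<gamma>(2) L that by (auto simp: image_subset_iff subset_iff)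
  have sm: "smooth_on ?I \<gamma>" using \<gamma>(1) by (simp add: regular_curve_def)
  have d\<gamma>: "(\<gamma> has_derivative (\<lambda>r. r *\<^sub>R velocity \<gamma> t)) (at t)"
    "(velocity \<gamma> has_derivative (\<lambda>r. r *\<^sub>R velocity (velocity \<gamma>) t)) (at t)" if "t \<in> ?I" for t
    using has_vector_derivative_velocity[OF sm that] has_vector_derivative_velocity[OF smooth_on_velocity[OF sm] that]
    by (simp_all add: has_vector_derivative_def)
  define \<delta> where "\<delta> t = \<phi> (\<gamma> t)" for t
  have v\<delta>: "velocity \<delta> t = D\<phi> (\<gamma> t) (velocity \<gamma> t)" if "t \<in> ?I" for t
  proof -
    have "(\<delta> has_derivative (\<lambda>r. D\<phi> (\<gamma> t) (r *\<^sub>R velocity \<gamma> t))) (at t)"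
      unfolding \<delta>_def[abs_def] by (rule has_derivative_compose[OF d\<gamma>(1)[OF that] has_derivative_map[OF \<gamma>V[OF that]]])
    then have "(\<delta> has_vector_derivative D\<phi> (\<gamma> t) (velocity \<gamma> t)) (at t)"
      by (simp add: has_vector_derivative_def linear_cmul[OF linear_map[OF \<gamma>V[OF that]]])
    then show ?thesis unfolding velocity_def by (rule vector_derivative_at)
  qed
  have a\<delta>: "velocity (velocity \<delta>) t = second_derivative \<phi> (\<gamma> t) (velocity \<gamma> t) (velocity \<gamma> t)
      + D\<phi> (\<gamma> t) (velocity (velocity \<gamma>) t)" if "t \<in> ?I" for t
  proof -
    have "((\<lambda>t. D\<phi> (\<gamma> t) (velocity \<gamma> t)) has_derivative
      (\<lambda>r. second_derivative \<phi> (\<gamma> t) (r *\<^sub>R velocity \<gamma> t) (velocity \<gamma> t)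
        + D\<phi> (\<gamma> t) (r *\<^sub>R velocity (velocity \<gamma>) t))) (at t)"
      by (rule has_derivative_frechet_apply[OF open_source smooth_map I that \<gamma>V d\<gamma>[OF that]])
    then have "(velocity \<delta> has_derivative
      (\<lambda>r. second_derivative \<phi> (\<gamma> t) (r *\<^sub>R velocity \<gamma> t) (velocity \<gamma> t)
        + D\<phi> (\<gamma> t) (r *\<^sub>R velocity (velocity \<gamma>) t))) (at t)"
      by (rule has_derivative_transform_within_open[OF _ I that]) (simp add: v\<delta>)
    then have "(velocity \<delta> has_vector_derivative (second_derivative \<phi> (\<gamma> t) (velocity \<gamma> t) (velocity \<gamma> t)
      + D\<phi> (\<gamma> t) (velocity (velocity \<gamma>) t))) (at t)"
      by (simp add: has_vector_derivative_def linear_cmul[OF linear_map[OF \<gamma>V[OF that]]]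
          linear_cmul[OF second_derivative_linear[OF smooth_map \<gamma>V[OF that]]] scaleR_add_right)
    then show ?thesis unfolding velocity_def[of "velocity \<delta>"] by (rule vector_derivative_at)
  qed
  have "smooth_on ?I \<delta>"
    unfolding \<delta>_def[abs_def]
    by (rule smooth_on_compose[OF I open_source sm smooth_map]) (auto intro: \<gamma>V)
  then have "regular_curve a b \<delta>"
    using \<gamma>(1) D_map_eq_0[OF \<gamma>V] by (auto simp: regular_curve_def v\<delta>)
  moreover have "\<delta> ` ?I \<subseteq> \<phi> ` L" using \<gamma>(2) by (auto simp: \<delta>_def)
  ultimately have geo\<delta>: "unparam_geodesic \<Gamma> a b \<delta>" using geo by (simp add: geodesic_leaf_def)
  show "unparam_geodesic (pullback \<Gamma>) a b \<gamma>"
    unfolding unparam_geodesic_def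
  proof
    fix t assume t: "t \<in> ?I"
    note lin = linear_map[OF \<gamma>V[OF t]]
    let ?z = "velocity (velocity \<gamma>) t + christoffel (pullback \<Gamma>) (\<gamma> t) (velocity \<gamma> t) (velocity \<gamma> t)"
    obtain \<mu> where "velocity (velocity \<delta>) t + christoffel \<Gamma> (\<delta> t) (velocity \<delta> t) (velocity \<delta> t) = \<mu> *\<^sub>R velocity \<delta> t"
      using geo\<delta> t unfolding unparam_geodesic_def by blast
    moreover have "D\<phi> (\<gamma> t) ?z = velocity (velocity \<delta>) t + christoffel \<Gamma> (\<delta> t) (velocity \<delta> t) (velocity \<delta> t)"
      unfolding v\<delta>[OF t] a\<delta>[OF t] by (simp add: linear_add[OF lin] christoffel_pullback[OF \<gamma>V[OF t]] \<delta>_def)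
    ultimately have "D\<phi> (\<gamma> t) (?z - \<mu> *\<^sub>R velocity \<gamma> t) = 0"
      by (simp add: linear_diff[OF lin] linear_cmul[OF lin] v\<delta>[OF t])
    then have "?z = \<mu> *\<^sub>R velocity \<gamma> t" using D_map_eq_0[OF \<gamma>V[OF t]] by simp
    then show "\<exists>\<mu>. ?z = \<mu> *\<^sub>R velocity \<gamma> t" by blast
  qed
qed

end

section \<open>Flat linear systems in two variables\<close>

text \<open>Moves the variable endpoint into the integrand, so that continuity jointly in the
  endpoint and a parameter becomes continuity of a parameter integral over a fixed interval.\<close>

lemma integral_substitution_unit_interval:
  fixes f :: "real \<Rightarrow> 'a::banach"
  assumes "b \<le> y" "continuous_on {b..y} f"
  shows "integral {b..y} f = (y - b) *\<^sub>R integral {0..1} (\<lambda>\<tau>. f (b + \<tau> * (y - b)))"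
proof (cases "y = b")
  case False
  with assms have m: "y - b > 0" by simp
  have "(f has_integral integral {b..y} f) (cbox b y)"
    using integrable_continuous_real[OF assms(2)] by (simp add: integrable_integral)
  moreover have "cbox ((b - b) /\<^sub>R (y - b)) ((y - b) /\<^sub>R (y - b)) = {0..1}"
    using m by simp
  ultimately have "((\<lambda>\<tau>. f (b + \<tau> * (y - b))) has_integral integral {b..y} f /\<^sub>R (y - b)) {0..1}"
    using has_integral_affinity'[of f "integral {b..y} f" b y "y - b" b] m
    by (simp add: add.commute mult.commute)
  then have "integral {0..1} (\<lambda>\<tau>. f (b + \<tau> * (y - b))) = integral {b..y} f /\<^sub>R (y - b)"
    by (rule integral_unique)
  then show ?thesis using m by simp
qed simp

lemma continuous_on_integral_upper:
  fixes F :: "'a::topological_space \<Rightarrow> real \<Rightarrow> 'b::banach"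
  assumes F: "continuous_on (X \<times> {b..b'}) (\<lambda>(x, t). F x t)"
  shows "continuous_on (X \<times> {b..b'}) (\<lambda>(x, y). integral {b..y} (F x))"
proof -
  have inn: "b + \<tau> * (y - b) \<in> {b..b'}" if "\<tau> \<in> {0..1}" "y \<in> {b..b'}" for \<tau> y
  proof -
    have "0 \<le> \<tau> * (y - b)" using that by simp
    moreover have "\<tau> * (y - b) \<le> 1 * (y - b)" using that by (intro mult_right_mono) auto
    ultimately show ?thesis using that by auto
  qed
  have "continuous_on ((X \<times> {b..b'}) \<times> {0..1}) (\<lambda>z. (\<lambda>(x, t). F x t) (fst (fst z), b + snd z * (snd (fst z) - b)))"
    by (rule continuous_on_compose2[OF F]) (auto intro!: continuous_intros inn)
  then have "continuous_on ((X \<times> {b..b'}) \<times> cbox 0 1) (\<lambda>(z, \<tau>). F (fst z) (b + \<tau> * (snd z - b)))"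
    by (simp add: case_prod_unfold)
  then have "continuous_on (X \<times> {b..b'}) (\<lambda>z. integral (cbox 0 1) (\<lambda>\<tau>. F (fst z) (b + \<tau> * (snd z - b))))"
    by (rule integral_continuous_on_param)
  then have "continuous_on (X \<times> {b..b'}) (\<lambda>z. (snd z - b) *\<^sub>R integral {0..1} (\<lambda>\<tau>. F (fst z) (b + \<tau> * (snd z - b))))"
    by (intro continuous_intros) simp
  then show ?thesis
  proof (rule continuous_on_eq)
    fix z assume z: "z \<in> X \<times> {b..b'}"
    obtain x y where xy: "z = (x, y)" "x \<in> X" "b \<le> y" "y \<le> b'" using z by auto
    have "continuous_on {b..y} (\<lambda>t. (\<lambda>(x, t). F x t) (x, t))"
      by (rule continuous_on_compose2[OF F]) (use xy in \<open>auto intro!: continuous_intros\<close>)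
    then show "(snd z - b) *\<^sub>R integral {0..1} (\<lambda>\<tau>. F (fst z) (b + \<tau> * (snd z - b)))
        = (case z of (x, y) \<Rightarrow> integral {b..y} (F x))"
      using integral_substitution_unit_interval[of b y "F x"] xy by simp
  qed
qed

text \<open>Banach's fixed point theorem for integration along the path that runs from (a, b) along
  the lower edge and then vertically.\<close>

lemma integral_equation_solution:
  fixes A B :: "real \<times> real \<Rightarrow> 'e::banach \<Rightarrow>\<^sub>L 'e" and c :: 'e
  assumes l: "0 \<le> l" "l * K \<le> 1 / 8" and Q: "Q = {a..a+l} \<times> {b..b+l}"
    and cont: "continuous_on Q A" "continuous_on Q B"
    and bound: "\<And>q. q \<in> Q \<Longrightarrow> norm (A q) \<le> K" "\<And>q. q \<in> Q \<Longrightarrow> norm (B q) \<le> K"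
  obtains s where "continuous_on Q s"
    "\<And>x y. (x, y) \<in> Q \<Longrightarrow> s (x, y) = c + integral {a..x} (\<lambda>\<xi>. A (\<xi>, b) (s (\<xi>, b))) + integral {b..y} (\<lambda>t. B (x, t) (s (x, t)))"
    "\<And>q. q \<in> Q \<Longrightarrow> norm (s q - c) \<le> norm c / 2"
proof -
  define J where "J f q = integral {a..fst q} (\<lambda>\<xi>. A (\<xi>, b) (f (\<xi>, b)))
      + integral {b..snd q} (\<lambda>t. B (fst q, t) (f (fst q, t)))" for f :: "real \<times> real \<Rightarrow> 'e" and q
  have contA: "continuous_on {a..x} (\<lambda>\<xi>. A (\<xi>, b) (f (\<xi>, b)))" if "continuous_on Q f" "x \<le> a + l" for f x
    by (rule continuous_on_compose2[OF bounded_bilinear.continuous_on[OF bounded_bilinear_blinfun_apply cont(1) that(1)],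
          where f="\<lambda>\<xi>. (\<xi>, b)"])
      (use that l in \<open>auto simp: Q intro!: continuous_intros\<close>)
  have contB: "continuous_on {b..y} (\<lambda>t. B (x, t) (f (x, t)))"
    if "continuous_on Q f" "x \<in> {a..a+l}" "y \<le> b + l" for f x y
    by (rule continuous_on_compose2[OF bounded_bilinear.continuous_on[OF bounded_bilinear_blinfun_apply cont(2) that(1)],
          where f="\<lambda>t. (x, t)"])
      (use that l in \<open>auto simp: Q intro!: continuous_intros\<close>)
  \<comment> \<open>Each of the two integrals has length at most l and an integrand bounded by KN;
    as lK is at most 1/8, each contributes N/8. The contraction factor is therefore 1/4.\<close>
  have J_bound: "norm (J f q) \<le> N / 4"
    if f: "continuous_on Q f" "\<And>q. q \<in> Q \<Longrightarrow> norm (f q) \<le> N" and q: "q \<in> Q" for f q N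
  proof -
    have xy: "fst q \<in> {a..a+l}" "snd q \<in> {b..b+l}" using q by (auto simp: Q)
    have N: "0 \<le> N" using f(2)[OF q] norm_ge_zero order_trans by blast
    have K: "0 \<le> K" using bound(1)[OF q] norm_ge_zero order_trans by blast
    have app: "norm (blinfun_apply M w) \<le> K * N" if "norm M \<le> K" "norm w \<le> N" for M :: "'e \<Rightarrow>\<^sub>L 'e" and w
    proof -
      have "norm (blinfun_apply M w) \<le> norm M * norm w" by (rule norm_blinfun)
      also have "\<dots> \<le> K * N" using that K by (intro mult_mono) auto
      finally show ?thesis .
    qed
    have "norm (integral {a..fst q} (\<lambda>\<xi>. A (\<xi>, b) (f (\<xi>, b)))) \<le> K * N * (fst q - a)"
      using xy l by (intro integral_bound contA f app bound) (auto simp: Q)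
    also have "\<dots> \<le> K * N * l" using xy K N by (intro mult_left_mono) auto
    also have "\<dots> \<le> N / 8" using mult_right_mono[OF l(2) N] by (simp add: algebra_simps)
    finally have 1: "norm (integral {a..fst q} (\<lambda>\<xi>. A (\<xi>, b) (f (\<xi>, b)))) \<le> N / 8" .
    have "norm (integral {b..snd q} (\<lambda>t. B (fst q, t) (f (fst q, t)))) \<le> K * N * (snd q - b)"
      using xy l by (intro integral_bound contB f app bound) (auto simp: Q)
    also have "\<dots> \<le> K * N * l" using xy K N by (intro mult_left_mono) auto
    also have "\<dots> \<le> N / 8" using mult_right_mono[OF l(2) N] by (simp add: algebra_simps)
    finally have 2: "norm (integral {b..snd q} (\<lambda>t. B (fst q, t) (f (fst q, t)))) \<le> N / 8" .
    show ?thesis unfolding J_def using norm_triangle_mono[OF 1 2] by simp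
  qed
  have J_cont: "continuous_on Q (J f)" if f: "continuous_on Q f" for f
  proof -
    have "continuous_on ({a..a+l} \<times> {b..b+l}) (\<lambda>(x, t). B (x, t) (f (x, t)))"
      using bounded_bilinear.continuous_on[OF bounded_bilinear_blinfun_apply cont(2) f]
      by (simp add: Q case_prod_unfold)
    from continuous_on_integral_upper[OF this]
    have B: "continuous_on Q (\<lambda>q. integral {b..snd q} (\<lambda>t. B (fst q, t) (f (fst q, t))))"
      by (simp add: Q case_prod_unfold)
    have "continuous_on {a..a+l} (\<lambda>x. integral {a..x} (\<lambda>\<xi>. A (\<xi>, b) (f (\<xi>, b))))"
      by (rule indefinite_integral_continuous_1[OF integrable_continuous_real[OF contA[OF f order_refl]]])
    then have A: "continuous_on Q (\<lambda>q. integral {a..fst q} (\<lambda>\<xi>. A (\<xi>, b) (f (\<xi>, b))))"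
      by (rule continuous_on_compose2[where f=fst]) (auto simp: Q intro!: continuous_intros)
    show ?thesis unfolding J_def[abs_def] by (intro continuous_on_add A B)
  qed
  have J_diff: "J f q - J g q = J (\<lambda>q. f q - g q) q" if "continuous_on Q f" "continuous_on Q g" "q \<in> Q" for f g q
  proof -
    have "fst q \<in> {a..a+l}" "snd q \<in> {b..b+l}" using that(3) by (auto simp: Q)
    then show ?thesis
      unfolding J_def blinfun.diff_right
      by (subst (1 2) integral_diff) (auto intro!: integrable_continuous_real contA contB that(1,2))
  qed
  have Qcbox: "Q = cbox (a, b) (a + l, b + l)" by (simp add: Q cbox_Pair_eq)
  have ne: "clamp (a, b) (a + l, b + l) q \<in> Q" for q
    unfolding Qcbox using l by (intro clamp_in_interval) (auto simp: Basis_prod_def)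
  \<comment> \<open>The complete space at hand consists of bounded continuous functions on the whole
    plane; composing with \<open>clamp\<close> extends a function from the square to it.\<close>
  have "\<exists>g :: (real \<times> real) \<Rightarrow>\<^sub>C 'e. \<forall>q. apply_bcontfun g q = c + J (apply_bcontfun f) (clamp (a, b) (a + l, b + l) q)" for f
  proof -
    have "continuous_on (cbox (a, b) (a + l, b + l)) (\<lambda>q. c + J (apply_bcontfun f) q)"
      unfolding Qcbox[symmetric] by (intro continuous_on_add continuous_on_const J_cont) simp
    then show ?thesis using continuous_on_cbox_bcontfunE by metis
  qed
  then obtain T :: "((real \<times> real) \<Rightarrow>\<^sub>C 'e) \<Rightarrow> ((real \<times> real) \<Rightarrow>\<^sub>C 'e)" where
    T: "\<And>f q. apply_bcontfun (T f) q = c + J (apply_bcontfun f) (clamp (a, b) (a + l, b + l) q)" by metis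
  have "dist (T f) (T g) \<le> 1 / 4 * dist f g" for f g
  proof (rule dist_bound)
    fix q
    let ?q = "clamp (a, b) (a + l, b + l) q"
    have "dist (T f q) (T g q) = norm (J (\<lambda>q. f q - g q) ?q)"
      unfolding T dist_norm by (simp add: J_diff[symmetric] ne)
    also have "\<dots> \<le> dist f g / 4"
      by (intro J_bound ne continuous_on_diff) (auto simp: dist_norm[symmetric] dist_bounded)
    finally show "dist (T f q) (T g q) \<le> 1 / 4 * dist f g" by simp
  qed
  then obtain f where f: "T f = f"
    using banach_fix_type[of "1/4" T] by auto
  have "norm f \<le> norm c + norm f / 4"
  proof (rule norm_bound)
    fix q
    have "norm (f q) = norm (c + J f (clamp (a, b) (a + l, b + l) q))" using T[of f q] f by simp
    also have "\<dots> \<le> norm c + norm f / 4"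
      by (intro norm_triangle_mono order_refl J_bound ne) (auto simp: norm_bounded)
    finally show "norm (f q) \<le> norm c + norm f / 4" .
  qed
  \<comment> \<open>The estimate gives |f| at most 4/3 |c|, so that |J f| is at most |c|/3, within
    the claimed |c|/2.\<close>
  then have nf: "norm f / 4 \<le> norm c / 2" using norm_ge_zero[of c] by linarith
  have fq: "f q = c + J f q" if "q \<in> Q" for q
    using T[of f q] f that by (simp add: Qcbox)
  show ?thesis
  proof (rule that[of "apply_bcontfun f"])
    show "continuous_on Q (apply_bcontfun f)" by simp
    show "f (x, y) = c + integral {a..x} (\<lambda>\<xi>. A (\<xi>, b) (f (\<xi>, b))) + integral {b..y} (\<lambda>t. B (x, t) (f (x, t)))"
      if "(x, y) \<in> Q" for x y
      using fq[OF that] by (simp add: J_def add.assoc)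
    show "norm (f q - c) \<le> norm c / 2" if "q \<in> Q" for q
    proof -
      have "norm (f q - c) = norm (J f q)" using fq[OF that] by simp
      also have "\<dots> \<le> norm f / 4" by (intro J_bound that) (auto simp: norm_bounded)
      finally show ?thesis using nf by simp
    qed
  qed
qed

text \<open>
  The solution \<open>s\<close> of the integral equation solves the \<open>x\<close>-equation on the lower edge and the
  \<open>y\<close>-equation everywhere. The field \<open>S\<close> obtained by integrating \<open>A s\<close> in the \<open>x\<close>-direction satisfies,
  by flatness, a linear equation in \<open>y\<close> whose error term involves only \<open>S - s\<close>; so \<open>S = s\<close>.
\<close>

lemma flat_linear_system_box:
  fixes A B A' B' :: "real \<times> real \<Rightarrow> 'e::banach \<Rightarrow>\<^sub>L 'e" and c :: 'e
  assumes l: "0 \<le> l" "l \<le> 1" "l * K \<le> 1 / 8" and Q: "Q = {a..a+l} \<times> {b..b+l}"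
    and cont: "continuous_on Q A" "continuous_on Q B" "continuous_on Q A'" "continuous_on Q B'"
    and bound: "\<And>q. q \<in> Q \<Longrightarrow> norm (A q) \<le> K" "\<And>q. q \<in> Q \<Longrightarrow> norm (B q) \<le> K" "\<And>q. q \<in> Q \<Longrightarrow> norm (B' q) \<le> K"
    and dA: "\<And>x y. (x, y) \<in> Q \<Longrightarrow> ((\<lambda>y. A (x, y)) has_vector_derivative A' (x, y)) (at y within {b..b+l})"
    and dB: "\<And>x y. (x, y) \<in> Q \<Longrightarrow> ((\<lambda>x. B (x, y)) has_vector_derivative B' (x, y)) (at x within {a..a+l})"
    and flat: "\<And>q v. q \<in> Q \<Longrightarrow> A' q v + A q (B q v) = B' q v + B q (A q v)"
  obtains s where "continuous_on Q s"
    "\<And>x y. (x, y) \<in> Q \<Longrightarrow> ((\<lambda>x. s (x, y)) has_vector_derivative A (x, y) (s (x, y))) (at x within {a..a+l})"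
    "\<And>x y. (x, y) \<in> Q \<Longrightarrow> ((\<lambda>y. s (x, y)) has_vector_derivative B (x, y) (s (x, y))) (at y within {b..b+l})"
    "\<And>q. q \<in> Q \<Longrightarrow> norm (s q - c) \<le> norm c / 2"
proof -
  obtain s where s: "continuous_on Q s"
    "\<And>x y. (x, y) \<in> Q \<Longrightarrow> s (x, y) = c + integral {a..x} (\<lambda>\<xi>. A (\<xi>, b) (s (\<xi>, b))) + integral {b..y} (\<lambda>t. B (x, t) (s (x, t)))"
    "\<And>q. q \<in> Q \<Longrightarrow> norm (s q - c) \<le> norm c / 2"
    by (rule integral_equation_solution[OF l(1,3) Q cont(1,2) bound(1,2), of c]) (assumption | rule that)+
  note blin = bounded_bilinear.continuous_on[OF bounded_bilinear_blinfun_apply]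
  have hor: "continuous_on {a..x} (\<lambda>\<xi>. F (\<xi>, y))" if "continuous_on Q F" "x \<le> a + l" "y \<in> {b..b+l}"
    for F :: "real \<times> real \<Rightarrow> 'e" and x y
    by (rule continuous_on_compose2[OF that(1)]) (use that in \<open>auto simp: Q intro!: continuous_intros\<close>)
  have ver: "continuous_on {b..y} (\<lambda>t. F (x, t))" if "continuous_on Q F" "y \<le> b + l" "x \<in> {a..a+l}"
    for F :: "real \<times> real \<Rightarrow> 'e" and x y
    by (rule continuous_on_compose2[OF that(1)]) (use that in \<open>auto simp: Q intro!: continuous_intros\<close>)
  define S where "S q = s (a, snd q) + integral {a..fst q} (\<lambda>\<xi>. A (\<xi>, snd q) (s (\<xi>, snd q)))" for q
  define D where "D q = S q - s q" for q
  have "continuous_on ({b..b+l} \<times> {a..a+l}) (\<lambda>(y, \<xi>). A (\<xi>, y) (s (\<xi>, y)))"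
    unfolding case_prod_unfold
    by (rule continuous_on_compose2[OF blin[OF cont(1) s(1)], where f="\<lambda>z. (snd z, fst z)"])
      (auto simp: Q intro!: continuous_intros)
  note upper = continuous_on_compose2[OF continuous_on_integral_upper[OF this], of Q "\<lambda>z. (snd z, fst z)"]
  have "continuous_on Q (\<lambda>z. (snd z, fst z))" "(\<lambda>z. (snd z, fst z)) ` Q \<subseteq> {b..b+l} \<times> {a..a+l}"
    by (auto simp: Q intro!: continuous_intros)
  from upper[OF this]
  have "continuous_on Q (\<lambda>q. integral {a..fst q} (\<lambda>\<xi>. A (\<xi>, snd q) (s (\<xi>, snd q))))"
    by simp
  moreover have "continuous_on Q (\<lambda>q. s (a, snd q))"
    by (rule continuous_on_compose2[OF s(1)]) (use l in \<open>auto simp: Q intro!: continuous_intros\<close>)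
  ultimately have S_cont: "continuous_on Q S" unfolding S_def[abs_def] by (intro continuous_on_add)
  then have D_cont: "continuous_on Q D" unfolding D_def[abs_def] by (intro continuous_on_diff s(1))
  have s_y: "((\<lambda>y. s (x, y)) has_vector_derivative B (x, y) (s (x, y))) (at y within {b..b+l})" if "(x, y) \<in> Q" for x y
  proof (rule has_vector_derivative_transform)
    have xy: "x \<in> {a..a+l}" "y \<in> {b..b+l}" using that by (auto simp: Q)
    show "y \<in> {b..b+l}" by fact
    show "s (x, t) = (c + integral {a..x} (\<lambda>\<xi>. A (\<xi>, b) (s (\<xi>, b)))) + integral {b..t} (\<lambda>t. B (x, t) (s (x, t)))"
      if "t \<in> {b..b+l}" for t using s(2)[of x t] xy that by (auto simp: Q)
    have "((\<lambda>t. integral {b..t} (\<lambda>t. B (x, t) (s (x, t)))) has_vector_derivative B (x, y) (s (x, y))) (at y within {b..b+l})"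
      using ver[OF blin[OF cont(2) s(1)] order_refl xy(1)] xy(2) by (rule integral_has_vector_derivative)
    then show "((\<lambda>t. (c + integral {a..x} (\<lambda>\<xi>. A (\<xi>, b) (s (\<xi>, b)))) + integral {b..t} (\<lambda>t. B (x, t) (s (x, t))))
        has_vector_derivative B (x, y) (s (x, y))) (at y within {b..b+l})"
      using has_vector_derivative_add[OF has_vector_derivative_const] by fastforce
  qed
  have S_x: "((\<lambda>x. S (x, y)) has_vector_derivative A (x, y) (s (x, y))) (at x within {a..a+l})" if "(x, y) \<in> Q" for x y
  proof -
    have xy: "x \<in> {a..a+l}" "y \<in> {b..b+l}" using that by (auto simp: Q)
    have "((\<lambda>x. integral {a..x} (\<lambda>\<xi>. A (\<xi>, y) (s (\<xi>, y)))) has_vector_derivative A (x, y) (s (x, y))) (at x within {a..a+l})"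
      using hor[OF blin[OF cont(1) s(1)] order_refl xy(2)] xy(1) by (rule integral_has_vector_derivative)
    then show ?thesis
      unfolding S_def fst_conv snd_conv using has_vector_derivative_add[OF has_vector_derivative_const] by fastforce
  qed
  \<comment> \<open>Differentiating S under the integral produces A(Bs) + A's. By flatness this is
    B(As) + B's, whereas the x-derivative of BS is B(As) + B'S. Integrating that derivative over
    [a, x] leaves only the defect B'(S - s).\<close>
  have D_y: "((\<lambda>y. D (x, y)) has_vector_derivative
      B (x, y) (D (x, y)) - integral {a..x} (\<lambda>\<xi>. B' (\<xi>, y) (D (\<xi>, y)))) (at y within {b..b+l})" if "(x, y) \<in> Q" for x y
  proof -
    have xy: "x \<in> {a..a+l}" "y \<in> {b..b+l}" using that by (auto simp: Q)
    define G where "G = (\<lambda>q. A q (B q (s q)) + A' q (s q))"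
    have G_cont: "continuous_on Q G" unfolding G_def by (intro continuous_on_add blin cont s(1))
    have "((\<lambda>y. integral (cbox a x) (\<lambda>\<xi>. A (\<xi>, y) (s (\<xi>, y)))) has_vector_derivative
        integral (cbox a x) (\<lambda>\<xi>. G (\<xi>, y))) (at y within {b..b+l})"
    proof (rule leibniz_rule_vector_derivative[OF _ _ _ xy(2) convex_real_interval(5)])
      fix t \<xi> assume t: "t \<in> {b..b+l}" and \<xi>: "\<xi> \<in> cbox a x"
      then have "(\<xi>, t) \<in> Q" using xy by (auto simp: Q)
      then show "((\<lambda>y. A (\<xi>, y) (s (\<xi>, y))) has_vector_derivative G (\<xi>, t)) (at t within {b..b+l})"
        unfolding G_def by (intro bounded_bilinear.has_vector_derivative[OF bounded_bilinear_blinfun_apply] dA s_y)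
    next
      fix t assume "t \<in> {b..b+l}"
      then show "(\<lambda>\<xi>. A (\<xi>, t) (s (\<xi>, t))) integrable_on cbox a x"
        using integrable_continuous_real[OF hor[OF blin[OF cont(1) s(1)], of x t]] xy by simp
    next
      show "continuous_on ({b..b+l} \<times> cbox a x) (\<lambda>(y, \<xi>). G (\<xi>, y))"
        unfolding case_prod_unfold
        by (rule continuous_on_compose2[OF G_cont]) (use xy in \<open>auto simp: Q intro!: continuous_intros\<close>)
    qed
    then have S_y: "((\<lambda>y. S (x, y)) has_vector_derivative B (a, y) (s (a, y)) + integral {a..x} (\<lambda>\<xi>. G (\<xi>, y)))
        (at y within {b..b+l})"
      unfolding S_def fst_conv snd_conv cbox_interval
      by (intro has_vector_derivative_add s_y) (use xy l in \<open>simp add: Q\<close>)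
    have "((\<lambda>\<xi>. B (\<xi>, y) (A (\<xi>, y) (s (\<xi>, y))) + B' (\<xi>, y) (S (\<xi>, y))) has_integral
        B (x, y) (S (x, y)) - B (a, y) (S (a, y))) {a..x}"
    proof (rule fundamental_theorem_of_calculus)
      fix \<xi> assume "\<xi> \<in> {a..x}"
      then have "(\<xi>, y) \<in> Q" using xy by (auto simp: Q)
      then have "((\<lambda>\<xi>. B (\<xi>, y) (S (\<xi>, y))) has_vector_derivative
          B (\<xi>, y) (A (\<xi>, y) (s (\<xi>, y))) + B' (\<xi>, y) (S (\<xi>, y))) (at \<xi> within {a..a+l})"
        by (intro bounded_bilinear.has_vector_derivative[OF bounded_bilinear_blinfun_apply] dB S_x)
      then show "((\<lambda>\<xi>. B (\<xi>, y) (S (\<xi>, y))) has_vector_derivative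
          B (\<xi>, y) (A (\<xi>, y) (s (\<xi>, y))) + B' (\<xi>, y) (S (\<xi>, y))) (at \<xi> within {a..x})"
        by (rule has_vector_derivative_within_subset) (use xy in auto)
    qed (use xy in simp)
    moreover have "((\<lambda>\<xi>. B' (\<xi>, y) (D (\<xi>, y))) has_integral integral {a..x} (\<lambda>\<xi>. B' (\<xi>, y) (D (\<xi>, y)))) {a..x}"
      using hor[OF blin[OF cont(4) D_cont], of x y] xy
      by (intro integrable_integral integrable_continuous_real) auto
    ultimately have "((\<lambda>\<xi>. (B (\<xi>, y) (A (\<xi>, y) (s (\<xi>, y))) + B' (\<xi>, y) (S (\<xi>, y))) - B' (\<xi>, y) (D (\<xi>, y))) has_integral
        (B (x, y) (S (x, y)) - B (a, y) (S (a, y))) - integral {a..x} (\<lambda>\<xi>. B' (\<xi>, y) (D (\<xi>, y)))) {a..x}"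
      by (rule has_integral_diff)
    then have "((\<lambda>\<xi>. G (\<xi>, y)) has_integral
        (B (x, y) (S (x, y)) - B (a, y) (S (a, y))) - integral {a..x} (\<lambda>\<xi>. B' (\<xi>, y) (D (\<xi>, y)))) {a..x}"
    proof (rule has_integral_eq[rotated])
      fix \<xi> assume "\<xi> \<in> {a..x}"
      then have "(\<xi>, y) \<in> Q" using xy by (auto simp: Q)
      from flat[OF this, of "s (\<xi>, y)"]
      show "(B (\<xi>, y) (A (\<xi>, y) (s (\<xi>, y))) + B' (\<xi>, y) (S (\<xi>, y))) - B' (\<xi>, y) (D (\<xi>, y)) = G (\<xi>, y)"
        by (simp add: G_def D_def blinfun.diff_right algebra_simps)
    qed
    then have "integral {a..x} (\<lambda>\<xi>. G (\<xi>, y))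
        = (B (x, y) (S (x, y)) - B (a, y) (s (a, y))) - integral {a..x} (\<lambda>\<xi>. B' (\<xi>, y) (D (\<xi>, y)))"
      by (simp add: integral_unique S_def)
    then have "B (a, y) (s (a, y)) + integral {a..x} (\<lambda>\<xi>. G (\<xi>, y)) - B (x, y) (s (x, y))
        = B (x, y) (D (x, y)) - integral {a..x} (\<lambda>\<xi>. B' (\<xi>, y) (D (\<xi>, y)))"
      by (simp add: D_def blinfun.diff_right)
    then show ?thesis
      using has_vector_derivative_diff[OF S_y s_y[OF that]] by (simp add: D_def)
  qed
  have D_b: "D (x, b) = 0" if "x \<in> {a..a+l}" for x
    using s(2)[of x b] s(2)[of a b] that l by (simp add: D_def S_def Q)
  have "D q = 0" if "q \<in> Q" for q
  proof -
    have Qc: "compact Q" unfolding Q by (intro compact_Times) auto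
    \<comment> \<open>At a point where |D| has its maximum m, integrating \<open>D_y\<close> upwards
      from the lower edge, where D = 0, gives m at most 2Klm, hence at most m/4. The bound l \<le> 1
      controls the inner integral.\<close>
    have "\<exists>q0\<in>Q. \<forall>q\<in>Q. norm (D q) \<le> norm (D q0)"
      using that by (intro continuous_attains_sup Qc continuous_on_norm D_cont) auto
    then obtain q0 where q0: "q0 \<in> Q" "\<And>q. q \<in> Q \<Longrightarrow> norm (D q) \<le> norm (D q0)" by blast
    define m where "m = norm (D q0)"
    obtain x y where xy: "q0 = (x, y)" "x \<in> {a..a+l}" "y \<in> {b..b+l}" using q0(1) by (auto simp: Q)
    have m: "0 \<le> m" by (simp add: m_def)
    have K: "0 \<le> K" using bound(1)[OF q0(1)] norm_ge_zero order_trans by blast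
    have app: "norm (blinfun_apply M w) \<le> K * m" if "norm M \<le> K" "norm w \<le> m" for M :: "'e \<Rightarrow>\<^sub>L 'e" and w
    proof -
      have "norm (blinfun_apply M w) \<le> norm M * norm w" by (rule norm_blinfun)
      also have "\<dots> \<le> K * m" using that K by (intro mult_mono) auto
      finally show ?thesis .
    qed
    let ?d = "\<lambda>t. B (x, t) (D (x, t)) - integral {a..x} (\<lambda>\<xi>. B' (\<xi>, t) (D (\<xi>, t)))"
    have "(?d has_integral D (x, y) - D (x, b)) {b..y}"
    proof (rule fundamental_theorem_of_calculus)
      fix t assume "t \<in> {b..y}"
      then have "(x, t) \<in> Q" using xy by (auto simp: Q)
      from D_y[OF this] show "((\<lambda>y. D (x, y)) has_vector_derivative ?d t) (at t within {b..y})"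
        by (rule has_vector_derivative_within_subset) (use xy in auto)
    qed (use xy in simp)
    moreover have "norm (?d t) \<le> 2 * K * m" if "t \<in> {b..y}" for t
    proof -
      have Qt: "(\<xi>, t) \<in> Q" if "\<xi> \<in> {a..x}" for \<xi> using \<open>t \<in> {b..y}\<close> that xy by (auto simp: Q)
      have dm: "norm (D (\<xi>, t)) \<le> m" if "\<xi> \<in> {a..x}" for \<xi> using q0(2)[OF Qt[OF that]] by (simp add: m_def)
      have "norm (integral {a..x} (\<lambda>\<xi>. B' (\<xi>, t) (D (\<xi>, t)))) \<le> K * m * (x - a)"
        using xy \<open>t \<in> {b..y}\<close>
        by (intro integral_bound hor[OF blin[OF cont(4) D_cont]] app bound Qt dm) auto
      also have "\<dots> \<le> K * m * 1" using xy l K m by (intro mult_left_mono) auto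
      finally have 2: "norm (integral {a..x} (\<lambda>\<xi>. B' (\<xi>, t) (D (\<xi>, t)))) \<le> K * m" by simp
      have 1: "norm (B (x, t) (D (x, t))) \<le> K * m"
        using xy by (intro app bound Qt dm) auto
      show ?thesis
        using norm_triangle_ineq4[of "B (x, t) (D (x, t))" "integral {a..x} (\<lambda>\<xi>. B' (\<xi>, t) (D (\<xi>, t)))"] 1 2
        by linarith
    qed
    ultimately have "norm (D (x, y) - D (x, b)) \<le> 2 * K * m * measure lborel (cbox b y)"
      using K m by (intro has_integral_bound) auto
    also have "\<dots> \<le> 2 * K * m * l" using xy K m by (intro mult_left_mono) auto
    also have "\<dots> \<le> m / 4" using mult_right_mono[OF l(3) m] by (simp add: algebra_simps)
    finally have "m \<le> m / 4" using D_b[OF xy(2)] xy(1) by (simp add: m_def)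
    then have "m \<le> 0" by simp
    then show ?thesis using q0(2)[OF that] unfolding m_def by simp
  qed
  then have SS: "s q = S q" if "q \<in> Q" for q using that by (simp add: D_def)
  show ?thesis
  proof (rule that[OF s(1) _ s_y s(3)])
    fix x y assume "(x, y) \<in> Q"
    then show "((\<lambda>x. s (x, y)) has_vector_derivative A (x, y) (s (x, y))) (at x within {a..a+l})"
      by (intro has_vector_derivative_transform[OF _ _ S_x]) (auto simp: Q intro!: SS)
  qed
qed

text \<open>A Frobenius theorem for a linear system with integrability condition A_y + AB = B_x +
  BA, obtained by placing a small square around p. The final estimate is what later keeps a
  component of the solution from vanishing.\<close>

theorem flat_linear_system:
  fixes A B :: "plane \<Rightarrow> 'e::banach \<Rightarrow>\<^sub>L 'e" and c :: 'e
  assumes U: "open U" "p \<in> U" and A: "C_on (Suc 0) U A" and B: "C_on (Suc 0) U B"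
    and flat: "\<And>q v. q \<in> U \<Longrightarrow> frechet_derivative A (at q) (axis 2 1) v + A q (B q v)
      = frechet_derivative B (at q) (axis 1 1) v + B q (A q v)"
  obtains V \<sigma> where "open V" "p \<in> V" "V \<subseteq> U"
    "\<And>q. q \<in> V \<Longrightarrow> (\<sigma> has_derivative (\<lambda>u. u $ 1 *\<^sub>R A q (\<sigma> q) + u $ 2 *\<^sub>R B q (\<sigma> q))) (at q)"
    "\<And>q. q \<in> V \<Longrightarrow> norm (\<sigma> q - c) \<le> norm c / 2"
proof -
  let ?A' = "\<lambda>q. frechet_derivative A (at q) (axis 2 1)" and ?B' = "\<lambda>q. frechet_derivative B (at q) (axis 1 1)"
  obtain \<delta> where \<delta>: "0 < \<delta>" "cball p \<delta> \<subseteq> U" using U open_contains_cball by blast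
  have cont: "continuous_on (cball p \<delta>) A" "continuous_on (cball p \<delta>) B"
    "continuous_on (cball p \<delta>) ?A'" "continuous_on (cball p \<delta>) ?B'"
    using A B C_on_imp_continuous_on \<delta>(2) continuous_on_subset by (blast, blast, (simp; blast)+)
  have "\<exists>K. \<forall>q\<in>cball p \<delta>. norm (F q) \<le> K" if "continuous_on (cball p \<delta>) F" for F :: "plane \<Rightarrow> 'e \<Rightarrow>\<^sub>L 'e"
    using compact_imp_bounded[OF compact_continuous_image[OF that compact_cball]]
    by (auto simp: bounded_iff)
  then obtain K1 K2 K3 where K': "\<And>q. q \<in> cball p \<delta> \<Longrightarrow> norm (A q) \<le> K1"
    "\<And>q. q \<in> cball p \<delta> \<Longrightarrow> norm (B q) \<le> K2" "\<And>q. q \<in> cball p \<delta> \<Longrightarrow> norm (?B' q) \<le> K3"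
    using cont by metis
  define K where "K = max (max K1 K2) (max K3 1)"
  have K: "1 \<le> K" "\<And>q. q \<in> cball p \<delta> \<Longrightarrow> norm (A q) \<le> K"
    "\<And>q. q \<in> cball p \<delta> \<Longrightarrow> norm (B q) \<le> K" "\<And>q. q \<in> cball p \<delta> \<Longrightarrow> norm (?B' q) \<le> K"
    using K' by (fastforce simp: K_def le_max_iff_disj)+
  \<comment> \<open>The square of side l centred at p lies in the ball of radius \<delta>, since
    each coordinate deviates by at most l/2. The second bound is the contraction condition lK \<le>
    1/8; with K \<ge> 1 it also forces l \<le> 1.\<close>
  define l where "l = min \<delta> (1 / (8 * K))"
  have l: "0 < l" "l \<le> \<delta>" "l \<le> 1 / (8 * K)" using \<delta>(1) K(1) by (auto simp: l_def)
  have lK: "l * K \<le> 1 / 8" using mult_right_mono[OF l(3), of K] K(1) by simp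
  have l1: "l \<le> 1"
  proof -
    have "l * 1 \<le> l * K" using l(1) K(1) by (intro mult_left_mono) auto
    then show ?thesis using lK by simp
  qed
  define a where "a = p $ 1 - l / 2"
  define b where "b = p $ 2 - l / 2"
  define Q where "Q = {a..a+l} \<times> {b..b+l}"
  define P :: "real \<times> real \<Rightarrow> plane" where "P z = fst z *\<^sub>R axis 1 1 + snd z *\<^sub>R axis 2 1" for z
  have P1: "P (x, y) = x *\<^sub>R axis 1 1 + y *\<^sub>R axis 2 1" for x y by (simp add: P_def)
  have PQ: "P z \<in> cball p \<delta>" if "z \<in> Q" for z
  proof -
    have "norm (P z - p) \<le> (\<Sum>i\<in>UNIV. \<bar>(P z - p) $ i\<bar>)" by (rule norm_le_l1_cart)
    also have "\<dots> = \<bar>fst z - p $ 1\<bar> + \<bar>snd z - p $ 2\<bar>" by (simp add: sum_2 P_def axis_def)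
    also have "\<dots> \<le> l / 2 + l / 2"
      using that by (intro add_mono; unfold abs_diff_le_iff) (auto simp: Q_def a_def b_def)
    finally show ?thesis using l(2) by (simp add: dist_norm norm_minus_commute)
  qed
  have PU: "P z \<in> U" if "z \<in> Q" for z using PQ[OF that] \<delta>(2) by blast
  have P_cont: "continuous_on Q P" unfolding P_def by (intro continuous_intros)
  have cQ: "continuous_on Q (\<lambda>z. F (P z))" if "continuous_on (cball p \<delta>) F" for F :: "plane \<Rightarrow> 'e \<Rightarrow>\<^sub>L 'e"
    by (rule continuous_on_compose2[OF that P_cont]) (use PQ in blast)
  have dA: "((\<lambda>y. A (P (x, y))) has_vector_derivative ?A' (P (x, y))) (at y within {b..b+l})" if "(x, y) \<in> Q" for x y
  proof -
    have h: "(A has_derivative frechet_derivative A (at (P (x, y)))) (at (P (x, y)))"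
      by (rule C_on_Suc_hd[OF A PU[OF that]])
    have g: "((\<lambda>y. P (x, y)) has_derivative (\<lambda>r. r *\<^sub>R axis 2 1)) (at y within {b..b+l})"
      unfolding P1 by (auto intro!: derivative_eq_intros)
    show ?thesis
      using has_derivative_compose[OF g h]
      by (simp add: has_vector_derivative_def linear_cmul[OF has_derivative_linear[OF h]])
  qed
  have dB: "((\<lambda>x. B (P (x, y))) has_vector_derivative ?B' (P (x, y))) (at x within {a..a+l})" if "(x, y) \<in> Q" for x y
  proof -
    have h: "(B has_derivative frechet_derivative B (at (P (x, y)))) (at (P (x, y)))"
      by (rule C_on_Suc_hd[OF B PU[OF that]])
    have g: "((\<lambda>x. P (x, y)) has_derivative (\<lambda>r. r *\<^sub>R axis 1 1)) (at x within {a..a+l})"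
      unfolding P1 by (auto intro!: derivative_eq_intros)
    show ?thesis
      using has_derivative_compose[OF g h]
      by (simp add: has_vector_derivative_def linear_cmul[OF has_derivative_linear[OF h]])
  qed
  obtain s where s: "continuous_on Q s"
    "\<And>x y. (x, y) \<in> Q \<Longrightarrow> ((\<lambda>x. s (x, y)) has_vector_derivative A (P (x, y)) (s (x, y))) (at x within {a..a+l})"
    "\<And>x y. (x, y) \<in> Q \<Longrightarrow> ((\<lambda>y. s (x, y)) has_vector_derivative B (P (x, y)) (s (x, y))) (at y within {b..b+l})"
    "\<And>q. q \<in> Q \<Longrightarrow> norm (s q - c) \<le> norm c / 2"
    using flat_linear_system_box[OF less_imp_le[OF l(1)] l1 lK Q_def cQ[OF cont(1)] cQ[OF cont(2)] cQ[OF cont(3)]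
        cQ[OF cont(4)] K(2)[OF PQ] K(3)[OF PQ] K(4)[OF PQ] dA dB flat[OF PU], of c thesis] by blast
  define V where "V = {q :: plane. a < q $ 1} \<inter> {q. q $ 1 < a + l} \<inter> ({q. b < q $ 2} \<inter> {q. q $ 2 < b + l})"
  have V: "open V"
    unfolding V_def by (intro open_Int open_Collect_less continuous_intros)
  have pV: "p \<in> V" using l(1) by (simp add: V_def a_def b_def)
  have VQ: "(q $ 1, q $ 2) \<in> Q" if "q \<in> V" for q using that by (auto simp: V_def Q_def)
  have Pq: "P (q $ 1, q $ 2) = q" for q unfolding P1 by (rule plane_expand[symmetric])
  have VU: "V \<subseteq> U" using PU[OF VQ] by (auto simp: Pq)
  have "((\<lambda>q. s (q $ 1, q $ 2)) has_derivative (\<lambda>u. u $ 1 *\<^sub>R A q (s (q $ 1, q $ 2)) + u $ 2 *\<^sub>R B q (s (q $ 1, q $ 2)))) (at q)"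
    if q: "q \<in> V" for q
  proof -
    let ?x = "q $ 1" and ?y = "q $ 2"
    have int: "(?x, ?y) \<in> {a<..<a+l} \<times> {b<..<b+l}" using q by (auto simp: V_def)
    \<comment> \<open>Both partial derivatives exist and the one in y is continuous, so the total
      derivative exists, first relative to the closed square and then, at interior points, in the
      full sense.\<close>
    have "((\<lambda>(x, y). s (x, y)) has_derivative
      (\<lambda>(t, u). t *\<^sub>R A (P (?x, ?y)) (s (?x, ?y)) + blinfun_scaleR_left (B (P (?x, ?y)) (s (?x, ?y))) u))
      (at (?x, ?y) within {a..a+l} \<times> {b..b+l})"
    proof (rule has_derivative_partialsI)
      show "((\<lambda>x. s (x, ?y)) has_derivative (\<lambda>t. t *\<^sub>R A (P (?x, ?y)) (s (?x, ?y)))) (at ?x within {a..a+l})"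
        using s(2)[OF VQ[OF q]] by (simp add: has_vector_derivative_def)
      show "((\<lambda>y. s (x, y)) has_derivative blinfun_apply (blinfun_scaleR_left (B (P (x, y)) (s (x, y))))) (at y within {b..b+l})"
        if "x \<in> {a..a+l}" "y \<in> {b..b+l}" for x y
        using s(3)[of x y] that by (simp add: has_vector_derivative_def Q_def)
      have "continuous_on Q (\<lambda>z. blinfun_scaleR_left (B (P z) (s z)))"
        by (intro bounded_linear.continuous_on[OF bounded_linear_blinfun_scaleR_left]
            bounded_bilinear.continuous_on[OF bounded_bilinear_blinfun_apply] cQ cont s(1))
      then show "continuous (at (?x, ?y) within {a..a+l} \<times> {b..b+l}) (\<lambda>(x, y). blinfun_scaleR_left (B (P (x, y)) (s (x, y))))"
        using VQ[OF q] by (simp add: Q_def case_prod_unfold continuous_on_eq_continuous_within)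
    qed (use q in \<open>auto simp: V_def\<close>)
    then have h': "(s has_derivative (\<lambda>z. fst z *\<^sub>R A q (s (?x, ?y)) + snd z *\<^sub>R B q (s (?x, ?y))))
        (at (?x, ?y) within {a..a+l} \<times> {b..b+l})"
      by (simp add: Pq case_prod_unfold)
    have "{a<..<a+l} \<times> {b<..<b+l} \<subseteq> {a..a+l} \<times> {b..b+l}" by auto
    note h'' = has_derivative_subset[OF h' this]
    have op: "open ({a<..<a+l} \<times> {b<..<b+l})" by (intro open_Times open_greaterThanLessThan)
    have h: "(s has_derivative (\<lambda>z. fst z *\<^sub>R A q (s (?x, ?y)) + snd z *\<^sub>R B q (s (?x, ?y)))) (at (?x, ?y))"
      using h'' unfolding at_within_open[OF int op] .
    have g: "((\<lambda>q :: plane. (q $ 1, q $ 2)) has_derivative (\<lambda>u. (u $ 1, u $ 2))) (at q)"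
      by (intro has_derivative_Pair bounded_linear_imp_has_derivative bounded_linear_vec_nth)
    show ?thesis using has_derivative_compose[OF g h] by simp
  qed
  then show ?thesis
    using that[OF V pV VU, of "\<lambda>q. s (q $ 1, q $ 2)"] s(4)[OF VQ] by simp
qed

section \<open>Liouville's equations and flat connections\<close>

lemma pd_divide_const: "f differentiable (at p) \<Longrightarrow> pd j (\<lambda>q. f q / c) p = pd j f p / c"
  by (simp add: divide_inverse pd_mult)

lemma differentiable_divide_const:
  fixes f :: "plane \<Rightarrow> real"
  shows "f differentiable (at p) \<Longrightarrow> (\<lambda>q. f q / c) differentiable (at p)"
  by (simp add: divide_inverse differentiable_mult)

text \<open>The system expresses the derivative of \<sigma> through \<sigma> and smooth
  coefficients, so regularity climbs by one at each step.\<close>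

lemma linear_system_solution_smooth:
  fixes A B :: "plane \<Rightarrow> 'e::real_normed_vector \<Rightarrow>\<^sub>L 'e"
  assumes V: "open V" and A: "smooth_on V A" and B: "smooth_on V B"
    and \<sigma>: "\<And>q. q \<in> V \<Longrightarrow> (\<sigma> has_derivative (\<lambda>u. u $ 1 *\<^sub>R A q (\<sigma> q) + u $ 2 *\<^sub>R B q (\<sigma> q))) (at q)"
  shows "smooth_on V \<sigma>"
  unfolding smooth_on_def
proof
  fix n show "C_on n V \<sigma>"
  proof (induction n)
    case 0
    show ?case
      by (auto intro!: continuous_at_imp_continuous_on has_derivative_continuous[OF \<sigma>])
  next
    case (Suc n)
    have "C_on n V A" "C_on n V B" using A B by (simp_all add: smooth_on_def)
    with Suc show ?case
      by (intro C_on_SucI[OF V \<sigma>] C_on_add C_on_bilinear[OF bounded_bilinear_scaleR]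
          C_on_bilinear[OF bounded_bilinear_blinfun_apply] C_on_const V)
  qed
qed

definition matrix_unit :: "3 \<Rightarrow> 3 \<Rightarrow> (real ^ 3) \<Rightarrow>\<^sub>L (real ^ 3)" where
  "matrix_unit i j = Blinfun (\<lambda>v. v $ j *\<^sub>R axis i 1)"

lemma matrix_unit_apply: "matrix_unit i j v = v $ j *\<^sub>R axis i 1"
  unfolding matrix_unit_def
  by (subst bounded_linear_Blinfun_apply)
    (auto intro!: bounded_linear_compose[OF bounded_linear_scaleR_left bounded_linear_vec_nth])

text \<open>Writing the operator as a combination of constant matrix units reduces smoothness and
  differentiation of an operator-valued map to its scalar entries.\<close>

definition operator_of :: "(3 \<Rightarrow> 3 \<Rightarrow> plane \<Rightarrow> real) \<Rightarrow> plane \<Rightarrow> (real ^ 3) \<Rightarrow>\<^sub>L (real ^ 3)" where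
  "operator_of m q = (\<Sum>i\<in>UNIV. \<Sum>j\<in>UNIV. m i j q *\<^sub>R matrix_unit i j)"

lemma combination_of_matrix_units_apply:
  "blinfun_apply (\<Sum>i\<in>UNIV. \<Sum>j\<in>UNIV. c i j *\<^sub>R matrix_unit i j) v $ i = c i 1 * v $ 1 + c i 2 * v $ 2 + c i 3 * v $ 3"
  using exhaust_3[of i]
  by (auto simp: sum_3 blinfun.add_left blinfun.scaleR_left matrix_unit_apply axis_def)

lemma operator_of_apply: "operator_of m q v $ i = m i 1 q * v $ 1 + m i 2 q * v $ 2 + m i 3 q * v $ 3"
  unfolding operator_of_def by (rule combination_of_matrix_units_apply)

lemma smooth_on_operator_of:
  "open U \<Longrightarrow> (\<And>i j. smooth_on U (m i j)) \<Longrightarrow> smooth_on U (operator_of m)"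
  unfolding operator_of_def[abs_def] by (intro smooth_intros)

lemma frechet_derivative_operator_of:
  assumes "\<And>i j. m i j differentiable (at q)"
  shows "frechet_derivative (operator_of m) (at q) (axis k 1) v $ i
    = pd k (m i 1) q * v $ 1 + pd k (m i 2) q * v $ 2 + pd k (m i 3) q * v $ 3"
proof -
  have "(operator_of m has_derivative (\<lambda>u. \<Sum>i\<in>UNIV. \<Sum>j\<in>UNIV. frechet_derivative (m i j) (at q) u *\<^sub>R matrix_unit i j)) (at q)"
    unfolding operator_of_def[abs_def]
    by (intro has_derivative_sum has_derivative_scaleR_left has_derivative_frechet assms)
  from frechet_derivative_eqI[OF this, of "axis k 1"] show ?thesis
    by (simp add: combination_of_matrix_units_apply pd_def)
qed

text \<open>
  A projective structure with Thomas symbols \<open>\<Pi>\<close> contains a flat connection \<open>\<Pi> + \<delta>\<rho> + \<rho>\<delta>\<close> whenever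
  \<open>\<nabla>\<rho> = \<rho>\<otimes>\<rho> + P\<close>, where \<open>P\<close> is the Ricci tensor of \<open>\<Pi>\<close>. Substituting \<open>\<rho> = -d log \<sigma>\<close> turns this Riccati
  system into a linear one for \<open>(\<sigma>, \<sigma>\<^sub>x, \<sigma>\<^sub>y)\<close>, whose integrability conditions are Liouville's equations.
\<close>

theorem liouville_imp_flat_connection:
  assumes U: "open U" "p \<in> U" and sm: "smooth_on U \<alpha>" "smooth_on U \<beta>"
    and liou: "\<And>q. q \<in> U \<Longrightarrow> liouville_equations \<alpha> \<beta> q"
  obtains V \<Gamma> where "open V" "p \<in> V" "V \<subseteq> U" "torsion_free_connection V \<Gamma>"
    "\<And>k l q. q \<in> V \<Longrightarrow> curvature_matrix \<Gamma> k l q = 0"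
    "\<And>q. \<Gamma> 1 2 2 q = 0" "\<And>q. \<Gamma> 2 1 1 q = 0"
    "\<And>q. \<Gamma> 2 2 2 q - 2 * \<Gamma> 1 1 2 q = \<alpha> q" "\<And>q. \<Gamma> 1 1 1 q - 2 * \<Gamma> 2 1 2 q = \<beta> q"
proof -
  \<comment> \<open>\<open>P11\<close>, \<open>P12\<close>, \<open>P22\<close> form the Ricci tensor
    of the trace-free representative \<Pi>^1_{11} = \<beta>/3, \<Pi>^1_{12} = -\<alpha>/3,
    \<Pi>^2_{12} = -\<beta>/3, \<Pi>^2_{22} = \<alpha>/3, with the other two symbols zero.\<close>
  define P11 where "P11 q = 1/3 * pd 1 \<beta> q - 2/9 * (\<beta> q * \<beta> q)" for q
  define P22 where "P22 q = 1/3 * pd 2 \<alpha> q - 2/9 * (\<alpha> q * \<alpha> q)" for q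
  define P12 where "P12 q = 1/9 * (\<alpha> q * \<beta> q) - 1/3 * (pd 1 \<alpha> q + pd 2 \<beta> q)" for q
  have smP: "smooth_on U P11" "smooth_on U P22" "smooth_on U P12"
    unfolding P11_def[abs_def] P22_def[abs_def] P12_def[abs_def] by (intro smooth_intros U sm)+
  have sm': "smooth_on U (pd i \<alpha>)" "smooth_on U (pd i \<beta>)" for i by (intro smooth_intros sm)+
  note D = sm[THEN smooth_on_differentiable] sm'[THEN smooth_on_differentiable] smP[THEN smooth_on_differentiable]
    differentiable_add differentiable_diff differentiable_mult differentiable_minus differentiable_divide_const
  have dP: "pd i P11 q = 1/3 * pd i (pd 1 \<beta>) q - 2/9 * (\<beta> q * pd i \<beta> q + pd i \<beta> q * \<beta> q)"
    "pd i P22 q = 1/3 * pd i (pd 2 \<alpha>) q - 2/9 * (\<alpha> q * pd i \<alpha> q + pd i \<alpha> q * \<alpha> q)"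
    "pd i P12 q = 1/9 * (\<alpha> q * pd i \<beta> q + pd i \<alpha> q * \<beta> q) - 1/3 * (pd i (pd 1 \<alpha>) q + pd i (pd 2 \<beta>) q)"
    if "q \<in> U" for i q
    unfolding P11_def[abs_def] P22_def[abs_def] P12_def[abs_def]
    using that by (simp_all add: pd_add pd_diff pd_mult pd_divide_const D)
  \<comment> \<open>The matrices of \<sigma>_{ij} = \<Pi>^k_{ij} \<sigma>_k - P_{ij} \<sigma> for
    the vector (\<sigma>, \<sigma>_x, \<sigma>_y): \<open>a\<close> for its x-derivative,
    \<open>b\<close> for its y-derivative. The first rows only say that the last two entries are the
    derivatives of the first.\<close>
  define a :: "3 \<Rightarrow> 3 \<Rightarrow> plane \<Rightarrow> real" where "a i j q =
    (if i = 1 then (if j = 2 then 1 else 0)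
     else if i = 2 then (if j = 1 then - P11 q else if j = 2 then 1/3 * \<beta> q else 0)
     else (if j = 1 then - P12 q else if j = 2 then - (1/3 * \<alpha> q) else - (1/3 * \<beta> q)))" for i j q
  define b :: "3 \<Rightarrow> 3 \<Rightarrow> plane \<Rightarrow> real" where "b i j q =
    (if i = 1 then (if j = 3 then 1 else 0)
     else if i = 2 then (if j = 1 then - P12 q else if j = 2 then - (1/3 * \<alpha> q) else - (1/3 * \<beta> q))
     else (if j = 1 then - P22 q else if j = 2 then 0 else 1/3 * \<alpha> q))" for i j q
  have smab: "smooth_on U (a i j)" "smooth_on U (b i j)" for i j
    using exhaust_3[of i] exhaust_3[of j] U(1) smP sm
    by (auto simp: a_def[abs_def] b_def[abs_def] intro!: smooth_intros)
  note Dab = smab[THEN smooth_on_differentiable]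
  have smAB: "smooth_on U (operator_of a)" "smooth_on U (operator_of b)"
    by (intro smooth_on_operator_of U smab)+
  \<comment> \<open>In the last two rows the coefficients of \<sigma>_x and \<sigma>_y agree by the
    choice of P; the coefficient of \<sigma> gives one Liouville equation in each row.\<close>
  have flat: "frechet_derivative (operator_of a) (at q) (axis 2 1) v + operator_of a q (operator_of b q v)
      = frechet_derivative (operator_of b) (at q) (axis 1 1) v + operator_of b q (operator_of a q v)"
    if q: "q \<in> U" for q v
  proof -
    have L: "pd 1 (pd 1 \<alpha>) q + 2 * pd 2 (pd 1 \<beta>) q = \<beta> q * pd 1 \<alpha> q + 2 * \<beta> q * pd 2 \<beta> q"
      "2 * pd 2 (pd 1 \<alpha>) q + pd 2 (pd 2 \<beta>) q = 2 * \<alpha> q * pd 1 \<alpha> q + \<alpha> q * pd 2 \<beta> q"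
      using liou[OF q] by (simp_all add: liouville_equations_def)
    note sw = sm[THEN pd_swap[OF U(1) _ q], symmetric]
    have pda: "pd k (a 1 j) q = 0" "pd k (a 2 1) q = - pd k P11 q" "pd k (a 2 2) q = 1/3 * pd k \<beta> q" "pd k (a 2 3) q = 0"
      "pd k (a 3 1) q = - pd k P12 q" "pd k (a 3 2) q = - (1/3 * pd k \<alpha> q)" "pd k (a 3 3) q = - (1/3 * pd k \<beta> q)" for k j
      using q by (simp_all add: a_def[abs_def] pd_minus pd_mult pd_divide_const D)
    have pdb: "pd k (b 1 j) q = 0" "pd k (b 2 1) q = - pd k P12 q" "pd k (b 2 2) q = - (1/3 * pd k \<alpha> q)"
      "pd k (b 2 3) q = - (1/3 * pd k \<beta> q)"
      "pd k (b 3 1) q = - pd k P22 q" "pd k (b 3 2) q = 0" "pd k (b 3 3) q = 1/3 * pd k \<alpha> q" for k j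
      using q by (simp_all add: b_def[abs_def] pd_minus pd_mult pd_divide_const D)
    have ab: "a 1 1 q = 0" "a 1 2 q = 1" "a 1 3 q = 0" "a 2 1 q = - P11 q" "a 2 2 q = 1/3 * \<beta> q" "a 2 3 q = 0"
      "a 3 1 q = - P12 q" "a 3 2 q = - (1/3 * \<alpha> q)" "a 3 3 q = - (1/3 * \<beta> q)"
      "b 1 1 q = 0" "b 1 2 q = 0" "b 1 3 q = 1" "b 2 1 q = - P12 q" "b 2 2 q = - (1/3 * \<alpha> q)" "b 2 3 q = - (1/3 * \<beta> q)"
      "b 3 1 q = - P22 q" "b 3 2 q = 0" "b 3 3 q = 1/3 * \<alpha> q"
      by (simp_all add: a_def b_def)
    show ?thesis
      unfolding vec_eq_iff forall_3 vector_add_component operator_of_apply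
        frechet_derivative_operator_of[of a, OF Dab(1)[OF q]] frechet_derivative_operator_of[of b, OF Dab(2)[OF q]]
        pda pdb ab dP[OF q] sw
      unfolding P11_def P12_def P22_def sw
      by (intro conjI) (simp, use L(1) in algebra, use L(2) in algebra)
  qed
  have C1: "C_on (Suc 0) U (operator_of a)" "C_on (Suc 0) U (operator_of b)"
    using smAB by (simp_all only: smooth_on_def)
  \<comment> \<open>The reference value (1, 0, 0) means \<sigma> = 1 with zero gradient; deviation
    at most 1/2 keeps \<sigma> away from 0, so that \<rho> = -d\<sigma>/\<sigma> is defined.\<close>
  obtain V s where V: "open V" "p \<in> V" "V \<subseteq> U"
    and s: "\<And>q. q \<in> V \<Longrightarrow> (s has_derivative (\<lambda>u. u $ 1 *\<^sub>R operator_of a q (s q) + u $ 2 *\<^sub>R operator_of b q (s q))) (at q)"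
    and near: "\<And>q. q \<in> V \<Longrightarrow> norm (s q - axis 1 1) \<le> norm (axis 1 1 :: real ^ 3) / 2"
    by (rule flat_linear_system[OF U C1 flat, of "axis 1 1"]) (assumption | rule that)+
  have sV: "smooth_on V s"
    by (rule linear_system_solution_smooth[OF V(1) smAB[THEN smooth_on_subset[OF _ V(3)]] s])
  have s1: "s q $ 1 \<noteq> 0" if "q \<in> V" for q
  proof -
    have "\<bar>(s q - axis 1 1) $ 1\<bar> \<le> 1 / 2"
      using component_le_norm_cart[of "s q - axis 1 1" 1] near[OF that] by simp
    then show ?thesis by (auto simp: axis_def)
  qed
  have ds: "pd k (\<lambda>q. s q $ i) q = (if k = 1 then operator_of a q (s q) else operator_of b q (s q)) $ i"
    if "q \<in> V" for k q i
  proof -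
    have "pd k (\<lambda>q. s q $ i) q = frechet_derivative s (at q) (axis k 1) $ i"
      unfolding pd_def by (rule frechet_component[OF smooth_on_differentiable[OF sV that]])
    also have "\<dots> = (if k = 1 then operator_of a q (s q) else operator_of b q (s q)) $ i"
      using frechet_derivative_eqI[OF s[OF that], of "axis k 1"] exhaust_2[of k] by (auto simp: axis_def)
    finally show ?thesis .
  qed
  define r1 where "r1 q = - (s q $ 2 / s q $ 1)" for q
  define r2 where "r2 q = - (s q $ 3 / s q $ 1)" for q
  have smr: "smooth_on V r1" "smooth_on V r2"
    unfolding r1_def[abs_def] r2_def[abs_def] using s1 by (intro smooth_intros V(1) sV; blast)+
  have smV: "smooth_on V \<alpha>" "smooth_on V \<beta>" using sm smooth_on_subset V(3) by blast+
  have dr: "pd 1 r1 q = r1 q * r1 q + 1/3 * \<beta> q * r1 q + P11 q"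
    "pd 1 r2 q = r1 q * r2 q - 1/3 * \<alpha> q * r1 q - 1/3 * \<beta> q * r2 q + P12 q"
    "pd 2 r1 q = r1 q * r2 q - 1/3 * \<alpha> q * r1 q - 1/3 * \<beta> q * r2 q + P12 q"
    "pd 2 r2 q = r2 q * r2 q + 1/3 * \<alpha> q * r2 q + P22 q" if q: "q \<in> V" for q
  proof -
    have dc: "(\<lambda>q. s q $ i) differentiable (at q)" for i
      by (intro smooth_on_differentiable[OF _ q] smooth_intros V(1) sV)
    have ddc: "(\<lambda>q. s q $ i / s q $ 1) differentiable (at q)" for i
      using s1 by (intro smooth_on_differentiable[OF _ q] smooth_intros V(1) sV) blast
    have r: "pd k r1 q = - (pd k (\<lambda>q. s q $ 2) q / s q $ 1 - s q $ 2 * pd k (\<lambda>q. s q $ 1) q / (s q $ 1)\<^sup>2)"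
      "pd k r2 q = - (pd k (\<lambda>q. s q $ 3) q / s q $ 1 - s q $ 3 * pd k (\<lambda>q. s q $ 1) q / (s q $ 1)\<^sup>2)" for k
      unfolding r1_def[abs_def] r2_def[abs_def] using s1[OF q] by (simp_all add: pd_minus pd_divide dc ddc)
    show "pd 1 r1 q = r1 q * r1 q + 1/3 * \<beta> q * r1 q + P11 q"
      "pd 1 r2 q = r1 q * r2 q - 1/3 * \<alpha> q * r1 q - 1/3 * \<beta> q * r2 q + P12 q"
      "pd 2 r1 q = r1 q * r2 q - 1/3 * \<alpha> q * r1 q - 1/3 * \<beta> q * r2 q + P12 q"
      "pd 2 r2 q = r2 q * r2 q + 1/3 * \<alpha> q * r2 q + P22 q"
      unfolding r ds[OF q] r1_def r2_def
      using s1[OF q] by (simp_all add: operator_of_apply a_def b_def field_simps power2_eq_square)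
  qed
  define \<Gamma> :: connection where "\<Gamma> k i j q =
    (if k = 1 then (if i = 1 \<and> j = 1 then 1/3 * \<beta> q + 2 * r1 q else if i = 2 \<and> j = 2 then 0 else r2 q - 1/3 * \<alpha> q)
     else (if i = 1 \<and> j = 1 then 0 else if i = 2 \<and> j = 2 then 1/3 * \<alpha> q + 2 * r2 q else r1 q - 1/3 * \<beta> q))" for k i j q
  have "smooth_on V (\<Gamma> k i j)" for k i j
    using exhaust_2[of i] exhaust_2[of j] exhaust_2[of k] V(1) smr smV
    by (auto simp: \<Gamma>_def[abs_def] intro!: smooth_intros)
  then have tf: "torsion_free_connection V \<Gamma>"
    by (rule torsion_freeI) (simp add: \<Gamma>_def)
  have curv: "curvature_matrix \<Gamma> k l q = 0" if q: "q \<in> V" for k l q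
  proof -
    note DV = smr[THEN smooth_on_differentiable, OF q] smV[THEN smooth_on_differentiable, OF q]
      differentiable_add differentiable_diff differentiable_mult differentiable_minus differentiable_divide_const
    have pdG: "pd i (\<Gamma> 1 1 1) q = 1/3 * pd i \<beta> q + 2 * pd i r1 q" "pd i (\<Gamma> 1 1 2) q = pd i r2 q - 1/3 * pd i \<alpha> q"
      "pd i (\<Gamma> 1 2 1) q = pd i r2 q - 1/3 * pd i \<alpha> q" "pd i (\<Gamma> 1 2 2) q = 0"
      "pd i (\<Gamma> 2 1 1) q = 0" "pd i (\<Gamma> 2 1 2) q = pd i r1 q - 1/3 * pd i \<beta> q"
      "pd i (\<Gamma> 2 2 1) q = pd i r1 q - 1/3 * pd i \<beta> q" "pd i (\<Gamma> 2 2 2) q = 1/3 * pd i \<alpha> q + 2 * pd i r2 q" for i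
      by (simp_all add: \<Gamma>_def[abs_def] pd_add pd_diff pd_mult pd_divide_const DV)
    have G: "\<Gamma> 1 1 1 q = 1/3 * \<beta> q + 2 * r1 q" "\<Gamma> 1 1 2 q = r2 q - 1/3 * \<alpha> q" "\<Gamma> 1 2 1 q = r2 q - 1/3 * \<alpha> q"
      "\<Gamma> 1 2 2 q = 0" "\<Gamma> 2 1 1 q = 0" "\<Gamma> 2 1 2 q = r1 q - 1/3 * \<beta> q" "\<Gamma> 2 2 1 q = r1 q - 1/3 * \<beta> q"
      "\<Gamma> 2 2 2 q = 1/3 * \<alpha> q + 2 * r2 q"
      by (simp_all add: \<Gamma>_def)
    have "curvature_matrix \<Gamma> 1 1 q = 0" "curvature_matrix \<Gamma> 1 2 q = 0" "curvature_matrix \<Gamma> 2 1 q = 0"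
      "curvature_matrix \<Gamma> 2 2 q = 0"
      unfolding curvature_matrix_def pdG G dr[OF q] P11_def P12_def P22_def by (simp_all add: algebra_simps)
    then show ?thesis using exhaust_2[of k] exhaust_2[of l] by auto
  qed
  show ?thesis
    by (rule that[OF V tf curv]) (simp_all add: \<Gamma>_def)
qed

section \<open>Webs containing the coordinate lines\<close>

text \<open>The nodes x and y have gradients (1, 0) and (0, 1) and zero Flex, which kills the two
  outer coefficients of the cubic. The nodes 3 and 4 then form a 2 by 2 linear system for the middle
  ones, and \<open>alpha\<close>, \<open>beta\<close> are its solution by Cramer's rule.\<close>

lemma coordinate_web_Pi:
  assumes web: "planar_web d U f" and d: "4 \<le> d" and p: "p \<in> U"
    and coord: "\<And>q. q \<in> U \<Longrightarrow> f 1 q = q $ 1" "\<And>q. q \<in> U \<Longrightarrow> f 2 q = q $ 2"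
  shows "Pi_1_22 f p = 0" "Pi_2_11 f p = 0" "alpha f p = - 3 * Pi_1_12 f p" "beta f p = - 3 * Pi_2_12 f p"
proof -
  note U = planar_web_open[OF web]
  have pd1: "pd j (f 1) q = (if j = 1 then 1 else 0)" and pd2: "pd j (f 2) q = (if j = 2 then 1 else 0)"
    if "q \<in> U" for j q
    using pd_cong_open[OF U that coord(1), where j=j] pd_cong_open[OF U that coord(2), where j=j]
    by (simp_all add: pd_component_coordinate)
  have "pd i (pd j (f 1)) p = 0" "pd i (pd j (f 2)) p = 0" for i j
    using pd_cong_open[OF U p pd1, where j=i] pd_cong_open[OF U p pd2, where j=i] by simp_all
  then have F: "Flex (f 1) p = 0" "Flex (f 2) p = 0" by (simp_all add: Flex_def)
  have jac: "jac (f i) (f k) p \<noteq> 0" if "i \<in> {1..4}" "k \<in> {1..4}" "i \<noteq> k" for i k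
    using that d by (intro planar_web_jac[OF web _ _ _ p]) auto
  have node: "Pi_1_22 f p * (pd 1 (f j) p)^3 - 3 * Pi_1_12 f p * (pd 1 (f j) p)\<^sup>2 * pd 2 (f j) p
      - 3 * Pi_2_12 f p * pd 1 (f j) p * (pd 2 (f j) p)\<^sup>2 + Pi_2_11 f p * (pd 2 (f j) p)^3 = Flex (f j) p"
    if "j \<in> {1..4}" for j
    unfolding interpolation_cubic_Pi using that by (intro interpolation_cubic_node jac) auto
  show P: "Pi_1_22 f p = 0" "Pi_2_11 f p = 0"
    using node[of 1, unfolded F pd1[OF p]] node[of 2, unfolded F pd2[OF p]] by simp_all
  define a1 b1 a2 b2 where ab: "a1 = pd 1 (f 3) p" "b1 = pd 2 (f 3) p" "a2 = pd 1 (f 4) p" "b2 = pd 2 (f 4) p"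
  have nz: "a1 \<noteq> 0" "b1 \<noteq> 0" "a2 \<noteq> 0" "b2 \<noteq> 0" "a1 * b2 - b1 * a2 \<noteq> 0"
    using jac[of 1 3, unfolded jac_def pd1[OF p]] jac[of 2 3, unfolded jac_def pd2[OF p]]
      jac[of 1 4, unfolded jac_def pd1[OF p]] jac[of 2 4, unfolded jac_def pd2[OF p]] jac[of 3 4, unfolded jac_def]
    by (simp_all add: ab)
  define u v where uv: "u = - 3 * Pi_1_12 f p" "v = - 3 * Pi_2_12 f p"
  have F3: "Flex (f 3) p = a1 * b1 * (u * a1 + v * b1)" and F4: "Flex (f 4) p = a2 * b2 * (u * a2 + v * b2)"
    using node[of 3] node[of 4] by (simp_all add: P ab uv power2_eq_square algebra_simps)
  have "alpha f p = (b2 * (u * a1 + v * b1) - b1 * (u * a2 + v * b2)) / (a1 * b2 - b1 * a2)"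
    unfolding alpha_def F3 F4 jac_def ab[symmetric] using nz by (simp add: diff_divide_distrib)
  also have "\<dots> = u" using nz(5) by (simp add: field_simps)
  finally show "alpha f p = - 3 * Pi_1_12 f p" by (simp add: uv)
  have "beta f p = (a1 * (u * a2 + v * b2) - a2 * (u * a1 + v * b1)) / (a1 * b2 - b1 * a2)"
    unfolding beta_def F3 F4 jac_def ab[symmetric] using nz by (simp add: diff_divide_distrib)
  also have "\<dots> = v" using nz(5) by (simp add: field_simps)
  finally show "beta f p = - 3 * Pi_2_12 f p" by (simp add: uv)
qed

text \<open>A projective change alters \<Gamma>(v, v) by 2\<rho>(v)v, which the covector
  annihilating v does not see. This transfers geodesy of a web from one connection to its entire
  class.\<close>

lemma projectively_equivalent_geodesic_cubic:
  assumes "projectively_equivalent U \<Gamma> \<Gamma>'" "torsion_free_connection U \<Gamma>" "torsion_free_connection U \<Gamma>'" "p \<in> U"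
  shows "geodesic_cubic \<Gamma> p \<xi> \<eta> = geodesic_cubic \<Gamma>' p \<xi> \<eta>"
proof -
  obtain \<rho> :: vfield where \<rho>: "\<And>X Y. smooth_on U X \<Longrightarrow> smooth_on U Y \<Longrightarrow>
      cov \<Gamma> X Y p - cov \<Gamma>' X Y p = (\<rho> p \<bullet> X p) *\<^sub>R Y p + (\<rho> p \<bullet> Y p) *\<^sub>R X p"
    using assms(1,4) unfolding projectively_equivalent_def by blast
  have "\<Gamma> k i j p - \<Gamma>' k i j p = \<rho> p $ i * (if j = k then 1 else 0) + \<rho> p $ j * (if i = k then 1 else 0)" for k i j
  proof -
    have "christoffel \<Gamma> p (axis i 1) (axis j 1) - christoffel \<Gamma>' p (axis i 1) (axis j 1)
        = (\<rho> p \<bullet> axis i 1) *\<^sub>R axis j 1 + (\<rho> p \<bullet> axis j 1) *\<^sub>R axis i 1"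
      using \<rho>[OF smooth_on_const smooth_on_const] by (simp add: cov_const)
    from arg_cong[OF this, of "\<lambda>v. v $ k"] show ?thesis
      by (simp add: christoffel_axis inner_axis) (simp add: axis_def)
  qed
  then have "\<Gamma> k i j p = \<Gamma>' k i j p + \<rho> p $ i * (if j = k then 1 else 0) + \<rho> p $ j * (if i = k then 1 else 0)" for k i j
    by (simp add: algebra_simps)
  then show ?thesis by (simp add: geodesic_cubic_def)
qed

lemma projectively_equivalent_refl: "projectively_equivalent U \<Gamma> \<Gamma>"
  unfolding projectively_equivalent_def
  by (intro exI[of _ "\<lambda>_. 0"]) (simp add: smooth_on_const)

text \<open>A local equivalence is given on a smaller open set, where a leaf may fall into several
  components; each of them still lies in a leaf of the larger web.\<close>

lemma web_leaf_subset:
  assumes "L \<in> web_leaves d V g" "V \<subseteq> U"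
  obtains L' where "L' \<in> web_leaves d U g" "L \<subseteq> L'"
proof -
  obtain i c where i: "i \<in> {1..d}" and L: "L \<in> components {q \<in> V. g i q = c}"
    using assms(1) by (auto simp: web_leaves_def leaves_def)
  have "L \<subseteq> {q \<in> V. g i q = c}" by (rule in_components_subset[OF L])
  then have "L \<subseteq> {q \<in> U. g i q = c}" using assms(2) by auto
  moreover have "L \<noteq> {}" "connected L"
    using in_components_nonempty[OF L] in_components_connected[OF L] by simp_all
  ultimately obtain L' where "L' \<in> components {q \<in> U. g i q = c}" "L \<subseteq> L'"
    using exists_component_superset[of L "{q \<in> U. g i q = c}"] by blast
  moreover from this i have "L' \<in> web_leaves d U g"
    unfolding web_leaves_def leaves_def by blast
  ultimately show ?thesis using that by blast
qed

lemma geodesic_leaf_subset: "geodesic_leaf \<Gamma> L' \<Longrightarrow> L \<subseteq> L' \<Longrightarrow> geodesic_leaf \<Gamma> L"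
  unfolding geodesic_leaf_def by blast

text \<open>The local diffeomorphism may permute the foliations of the web. Pulling back the
  symmetric connection avoids any matching of indices: every leaf of \<open>f\<close> maps into a
  geodesic leaf of \<open>g\<close>, hence is geodesic for \<open>pullback \<Gamma>\<close>.\<close>

lemma symmetric_geodesic_web_imp:
  assumes web: "planar_web d U f" and d: "4 \<le> d" and p: "p \<in> U"
    and coord: "\<And>q. q \<in> U \<Longrightarrow> f 1 q = q $ 1" "\<And>q. q \<in> U \<Longrightarrow> f 2 q = q $ 2"
    and P: "symmetric_projective_structure U' P" "geodesic_web_wrt d U' g P"
    and eq: "locally_equivalent_at d p U f U' g"
  shows "(\<forall>i\<in>{5..d}. flex_condition f (f i) p) \<and> liouville_equations (alpha f) (beta f) p"
proof -
  obtain \<Gamma> where \<Gamma>: "\<Gamma> \<in> P" "symmetric_connection U' \<Gamma>"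
    using P(1) by (auto simp: symmetric_projective_structure_def)
  obtain V V' \<phi> \<psi> where V: "open V" "p \<in> V" "V \<subseteq> U" "open V'" "V' \<subseteq> U'"
    and \<phi>: "smooth_on V \<phi>" "smooth_on V' \<psi>" "homeomorphism V V' \<phi> \<psi>"
    and leaves: "image \<phi> ` web_leaves d V f = web_leaves d V' g"
    using eq by (auto simp: locally_equivalent_at_def diffeomorphism_def)
  interpret plane_diffeomorphism V V' \<phi> \<psi>
    using V \<phi> by unfold_locales
  have U': "open U'" using P(2) by (simp add: geodesic_web_wrt_def planar_web_def)
  have sym: "symmetric_connection V (pullback \<Gamma>)"
    by (rule symmetric_connection_pullback[OF symmetric_connection_subset[OF U' V(4) \<Gamma>(2) V(5)]])
  then have tf: "torsion_free_connection V (pullback \<Gamma>)" by (simp add: symmetric_connection_def)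
  have webV: "planar_web d V f" using planar_web_subset[OF web V(1,3)] .
  have "geodesic_leaf (pullback \<Gamma>) L" if L: "L \<in> web_leaves d V f" for L
  proof (rule geodesic_leaf_pullback)
    show "L \<subseteq> V" using L leaf_subset by (auto simp: web_leaves_def)
    have "\<phi> ` L \<in> web_leaves d V' g" using L leaves by blast
    then obtain L' where "L' \<in> web_leaves d U' g" "\<phi> ` L \<subseteq> L'" using web_leaf_subset V(5) by metis
    then show "geodesic_leaf \<Gamma> (\<phi> ` L)"
      using P(2) \<Gamma>(1) geodesic_leaf_subset[of \<Gamma> L' "\<phi> ` L"] by (auto simp: geodesic_web_wrt_def)
  qed
  then have cubic: "geodesic_cubic (pullback \<Gamma>) q (pd 1 (f i) q) (pd 2 (f i) q) = Flex (f i) q"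
    if "i \<in> {1..d}" "q \<in> V" for i q
    using web_leaves_geodesic_iff[OF webV, of "pullback \<Gamma>"] d torsion_free_symmetric[OF tf] that by auto
  have e: "pullback \<Gamma> 1 2 2 q = Pi_1_22 f q" "pullback \<Gamma> 2 2 2 q - 2 * pullback \<Gamma> 1 1 2 q = - 3 * Pi_1_12 f q"
    "pullback \<Gamma> 1 1 1 q - 2 * pullback \<Gamma> 2 1 2 q = - 3 * Pi_2_12 f q" "pullback \<Gamma> 2 1 1 q = Pi_2_11 f q"
    if "q \<in> V" for q
    using d that by (intro geodesic_cubic_eq_Pi[OF webV d that] cubic; simp)+
  have "\<forall>i\<in>{5..d}. flex_condition f (f i) p"
    using geodesic_cubic_all_iff_flex_condition[OF webV d V(2), of "pullback \<Gamma>", OF e[OF V(2)]] cubic[OF _ V(2)] by blast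
  moreover have "liouville_equations (alpha f) (beta f) p"
  proof (rule symmetric_connection_liouville[OF V(1) sym V(2)])
    fix q assume q: "q \<in> V"
    note c = coordinate_web_Pi[OF webV d q coord[OF subsetD[OF V(3)]]]
    show "pullback \<Gamma> 1 2 2 q = 0" "pullback \<Gamma> 2 1 1 q = 0"
      "alpha f q = pullback \<Gamma> 2 2 2 q - 2 * pullback \<Gamma> 1 1 2 q"
      "beta f q = pullback \<Gamma> 1 1 1 q - 2 * pullback \<Gamma> 2 1 2 q"
      using e[OF q] c by simp_all
  qed
  ultimately show ?thesis by blast
qed

text \<open>The witness is the web itself on a smaller neighbourhood of p, with the identity as
  equivalence and the projective class of the flat connection produced by Liouville's
  equations.\<close>

lemma symmetric_geodesic_web_exists:
  assumes web: "planar_web d U f" and d: "4 \<le> d" and p: "p \<in> U"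
    and coord: "\<And>q. q \<in> U \<Longrightarrow> f 1 q = q $ 1" "\<And>q. q \<in> U \<Longrightarrow> f 2 q = q $ 2"
    and flex: "\<And>i q. i \<in> {5..d} \<Longrightarrow> q \<in> U \<Longrightarrow> flex_condition f (f i) q"
    and liou: "\<And>q. q \<in> U \<Longrightarrow> liouville_equations (alpha f) (beta f) q"
  shows "\<exists>U' g P. planar_web d U' g \<and> symmetric_projective_structure U' P \<and>
            geodesic_web_wrt d U' g P \<and> locally_equivalent_at d p U f U' g"
proof -
  note U = planar_web_open[OF web]
  note Pi = coordinate_web_Pi[OF web d _ coord]
  have sm: "smooth_on U (alpha f)" "smooth_on U (beta f)"
  proof -
    have "smooth_on U (\<lambda>q. - 3 * Pi_1_12 f q)" "smooth_on U (\<lambda>q. - 3 * Pi_2_12 f q)"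
      using smooth_on_Pi[OF web d] U by (auto intro!: smooth_intros)
    then show "smooth_on U (alpha f)" "smooth_on U (beta f)"
      using smooth_on_cong[OF U, of "alpha f"] smooth_on_cong[OF U, of "beta f"] Pi(3,4) by auto
  qed
  obtain V \<Gamma> where V: "open V" "p \<in> V" "V \<subseteq> U" and tf: "torsion_free_connection V \<Gamma>"
    and flat: "\<And>k l q. q \<in> V \<Longrightarrow> curvature_matrix \<Gamma> k l q = 0"
    and \<Gamma>: "\<And>q. \<Gamma> 1 2 2 q = 0" "\<And>q. \<Gamma> 2 1 1 q = 0"
    "\<And>q. \<Gamma> 2 2 2 q - 2 * \<Gamma> 1 1 2 q = alpha f q" "\<And>q. \<Gamma> 1 1 1 q - 2 * \<Gamma> 2 1 2 q = beta f q"
    by (rule liouville_imp_flat_connection[OF U p sm liou]) (assumption | rule that)+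
  define P where "P = {\<Gamma>'. torsion_free_connection V \<Gamma>' \<and> projectively_equivalent V \<Gamma> \<Gamma>'}"
  have webV: "planar_web d V f" using planar_web_subset[OF web V(1,3)] .
  have "symmetric_connection V \<Gamma>" by (rule flat_connection_symmetric[OF V(1) tf flat])
  moreover have "\<Gamma> \<in> P" using tf projectively_equivalent_refl by (simp add: P_def)
  moreover have "projective_structure V P" using tf unfolding projective_structure_def P_def by blast
  ultimately have symP: "symmetric_projective_structure V P" by (auto simp: symmetric_projective_structure_def)
  have cubic: "\<forall>i\<in>{1..d}. geodesic_cubic \<Gamma> q (pd 1 (f i) q) (pd 2 (f i) q) = Flex (f i) q" if "q \<in> V" for q
    using V(3) that flex
    by (intro geodesic_cubic_all_iff_flex_condition[OF webV d that, THEN iffD2]) (auto simp: \<Gamma> Pi)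
  have "geodesic_web_wrt d V f P"
    unfolding geodesic_web_wrt_def
  proof (intro conjI webV ballI)
    fix \<Gamma>' L assume "\<Gamma>' \<in> P" and L: "L \<in> web_leaves d V f"
    then have \<Gamma>': "torsion_free_connection V \<Gamma>'" "projectively_equivalent V \<Gamma> \<Gamma>'" by (auto simp: P_def)
    have "\<forall>i\<in>{1..d}. \<forall>q\<in>V. geodesic_cubic \<Gamma>' q (pd 1 (f i) q) (pd 2 (f i) q) = Flex (f i) q"
      using cubic projectively_equivalent_geodesic_cubic[OF \<Gamma>'(2) tf \<Gamma>'(1)] by simp
    then show "geodesic_leaf \<Gamma>' L"
      using web_leaves_geodesic_iff[OF webV, of \<Gamma>'] d L torsion_free_symmetric[OF \<Gamma>'(1)] by auto
  qed
  moreover have "locally_equivalent_at d p U f V f"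
  proof -
    have "homeomorphism V V (\<lambda>x. x) (\<lambda>x. x)" by (simp add: homeomorphism_def)
    then have "diffeomorphism V V (\<lambda>x. x)"
      unfolding diffeomorphism_def using smooth_on_id[OF V(1)] by blast
    then show ?thesis
      unfolding locally_equivalent_at_def using V
      by (intro exI[of _ V] exI[of _ V] exI[of _ "\<lambda>x. x"]) simp
  qed
  ultimately show ?thesis using webV symP by blast
qed

theorem theorem12:
  fixes d :: nat and U :: "plane set" and f :: "nat \<Rightarrow> plane \<Rightarrow> real"
  assumes "d \<ge> 5" and "planar_web d U f"
  shows
    "(geodesic_web d U f \<longleftrightarrow> (\<forall>i\<in>{5..d}. \<forall>p\<in>U. flex_condition f (f i) p))
     \<and>
     ((\<forall>p\<in>U. f 1 p = p $ 1 \<and> f 2 p = p $ 2) \<longrightarrow>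
       ((\<forall>p\<in>U. \<exists>U' g P. planar_web d U' g \<and> symmetric_projective_structure U' P \<and>
            geodesic_web_wrt d U' g P \<and> locally_equivalent_at d p U f U' g)
        \<longleftrightarrow>
        (\<forall>i\<in>{5..d}. \<forall>p\<in>U. flex_condition f (f i) p) \<and>
        (\<forall>p\<in>U.
           pd 1 (pd 1 (alpha f)) p + 2 * pd 2 (pd 1 (beta f)) p
             = beta f p * pd 1 (alpha f) p + 2 * beta f p * pd 2 (beta f) p \<and>
           2 * pd 2 (pd 1 (alpha f)) p + pd 2 (pd 2 (beta f)) p
             = 2 * alpha f p * pd 1 (alpha f) p + alpha f p * pd 2 (beta f) p)))"
proof (intro conjI impI)
  have d: "4 \<le> d" using assms(1) by simp
  show "geodesic_web d U f \<longleftrightarrow> (\<forall>i\<in>{5..d}. \<forall>p\<in>U. flex_condition f (f i) p)"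
    by (rule geodesic_web_iff[OF d assms(2)])
  assume "\<forall>p\<in>U. f 1 p = p $ 1 \<and> f 2 p = p $ 2"
  then have coord: "\<And>q. q \<in> U \<Longrightarrow> f 1 q = q $ 1" "\<And>q. q \<in> U \<Longrightarrow> f 2 q = q $ 2" by auto
  show "(\<forall>p\<in>U. \<exists>U' g P. planar_web d U' g \<and> symmetric_projective_structure U' P \<and>
            geodesic_web_wrt d U' g P \<and> locally_equivalent_at d p U f U' g)
        \<longleftrightarrow>
        (\<forall>i\<in>{5..d}. \<forall>p\<in>U. flex_condition f (f i) p) \<and>
        (\<forall>p\<in>U.
           pd 1 (pd 1 (alpha f)) p + 2 * pd 2 (pd 1 (beta f)) p
             = beta f p * pd 1 (alpha f) p + 2 * beta f p * pd 2 (beta f) p \<and>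
           2 * pd 2 (pd 1 (alpha f)) p + pd 2 (pd 2 (beta f)) p
             = 2 * alpha f p * pd 1 (alpha f) p + alpha f p * pd 2 (beta f) p)"
    unfolding liouville_equations_def[symmetric]
  proof
    assume E: "\<forall>p\<in>U. \<exists>U' g P. planar_web d U' g \<and> symmetric_projective_structure U' P \<and>
            geodesic_web_wrt d U' g P \<and> locally_equivalent_at d p U f U' g"
    have "(\<forall>i\<in>{5..d}. flex_condition f (f i) p) \<and> liouville_equations (alpha f) (beta f) p" if p: "p \<in> U" for p
    proof -
      obtain U' g P where "symmetric_projective_structure U' P" "geodesic_web_wrt d U' g P"
        "locally_equivalent_at d p U f U' g"
        using E p by blast
      then show ?thesis using symmetric_geodesic_web_imp[OF assms(2) d p coord] by blast
    qed
    then show "(\<forall>i\<in>{5..d}. \<forall>p\<in>U. flex_condition f (f i) p) \<and> (\<forall>p\<in>U. liouville_equations (alpha f) (beta f) p)"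
      by blast
  next
    assume "(\<forall>i\<in>{5..d}. \<forall>p\<in>U. flex_condition f (f i) p) \<and> (\<forall>p\<in>U. liouville_equations (alpha f) (beta f) p)"
    then show "\<forall>p\<in>U. \<exists>U' g P. planar_web d U' g \<and> symmetric_projective_structure U' P \<and>
            geodesic_web_wrt d U' g P \<and> locally_equivalent_at d p U f U' g"
      by (intro ballI symmetric_geodesic_web_exists[OF assms(2) d _ coord]) auto
  qed
qed

end
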